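(* Let $N\ge7$ and fix $\lambda$ with $\frac{N(N-2)}{4}<\lambda<\left(\frac{N-1}{2}\right)^2$. Let $\mathcal{A}$ be a bounded subset of $H^1_r(\mathbb{B}^N)$ such that every $u\in\mathcal{A}$ is a weak solution of $$-\Delta_{\mathbb{B}^N}u-\lambda u=|u|^{p-2}u,\qquad u\in H^1_r(\mathbb{B}^N),$$ for some $p=p(u)\in(2,2^*]$. Then there exists a constant $C$ depending only on $\mathcal{A}$ such that $|u(x)|\le C(1-|x|^2)^{\frac{N-1}{2}}$ for all $u\in\mathcal{A}$ and all $x\in\mathbb{B}^N$.
   Context: $\mathbb{B}^N=\{x\in\mathbb{R}^N:|x|<1\}$ with hyperbolic metric $g_{ij}=\left(\frac{2}{1-|x|^2}\right)^2\delta_{ij}$; $dV_{\mathbb{B}^N}=\left(\frac{2}{1-|x|^2}\right)^N dx$; $|\nabla_{\mathbb{B}^N}u|_g^2=\left(\frac{1-|x|^2}{2}\right)^2|\nabla u|^2$; $\Delta_{\mathbb{B}^N}u=\left(\frac{1-|x|^2}{2}\right)^2\Delta u+(N-2)\frac{1-|x|^2}{2}\,x\cdot\nabla u$. $H^1(\mathbb{B}^N)$ is the completion of $C_c^\infty(\mathbb{B}^N)$ under $\left(\int(|\nabla_{\mathbb{B}^N}u|_g^2+u^2)\,dV_{\mathbb{B}^N}\right)^{1/2}$, and $H^1_r(\mathbb{B}^N)$ is its closed subspace of radial functions (functions of $|x|$ only). $2^*=\frac{2N}{N-2}$. *)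

theory Defs
  imports "HOL-Analysis.Analysis"
begin

text \<open>Points of R^N are vectors of type real^'n, N = CARD('n). The Poincare ball is ball 0 1.\<close>

definition pgrad :: "(real^'n \<Rightarrow> real) \<Rightarrow> real^'n \<Rightarrow> real^'n" where
  "pgrad f x = (\<chi> i. frechet_derivative f (at x) (axis i 1))"

fun smooth_k :: "nat \<Rightarrow> (real^'n \<Rightarrow> real) \<Rightarrow> bool" where
  "smooth_k 0 f = continuous_on UNIV f"
| "smooth_k (Suc k) f = (f differentiable_on UNIV \<and> continuous_on UNIV f \<and>
      (\<forall>i. smooth_k k (\<lambda>x. frechet_derivative f (at x) (axis i 1))))"

definition test_fun :: "(real^'n \<Rightarrow> real) \<Rightarrow> bool" where
  "test_fun f \<longleftrightarrow> (\<forall>k. smooth_k k f) \<and> compact (closure {x. f x \<noteq> 0})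
     \<and> closure {x. f x \<noteq> 0} \<subseteq> ball 0 1"

definition hypvol :: "(real^'n) measure" where
  "hypvol = density lborel
     (\<lambda>x. indicator (ball 0 1) x * ennreal ((2 / (1 - (norm x)\<^sup>2)) ^ CARD('n)))"

text \<open>Hyperbolic squared length of a Euclidean gradient vector v at x: |grad_B u|_g^2.\<close>
definition hgrad_sq :: "real^'n \<Rightarrow> real^'n \<Rightarrow> real" where
  "hgrad_sq x v = ((1 - (norm x)\<^sup>2) / 2)\<^sup>2 * (norm v)\<^sup>2"

text \<open>H^1(B^N) as completion of C_c^infinity: u (with Euclidean weak gradient G) belongs to H^1
  iff it is the limit in the H^1 norm of test functions, i.e. phi_k -> u in L^2(dV)
  and grad phi_k -> G in L^2 with respect to the hyperbolic metric.\<close>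
definition H1 :: "(real^'n \<Rightarrow> real) \<Rightarrow> (real^'n \<Rightarrow> real^'n) \<Rightarrow> bool" where
  "H1 u G \<longleftrightarrow> u \<in> borel_measurable lborel \<and> G \<in> borel_measurable lborel \<and>
     (\<exists>\<phi>. (\<forall>k. test_fun (\<phi> k)) \<and>
        ((\<lambda>k. \<integral>\<^sup>+ x. ennreal ((\<phi> k x - u x)\<^sup>2) \<partial>hypvol) \<longlongrightarrow> 0) sequentially \<and>
        ((\<lambda>k. \<integral>\<^sup>+ x. ennreal (hgrad_sq x (pgrad (\<phi> k) x - G x)) \<partial>hypvol) \<longlongrightarrow> 0) sequentially)"

definition H1_normsq :: "(real^'n \<Rightarrow> real) \<Rightarrow> (real^'n \<Rightarrow> real^'n) \<Rightarrow> ennreal" where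
  "H1_normsq u G = (\<integral>\<^sup>+ x. ennreal (hgrad_sq x (G x) + (u x)\<^sup>2) \<partial>hypvol)"

definition radial :: "(real^'n \<Rightarrow> real) \<Rightarrow> bool" where
  "radial u \<longleftrightarrow> (\<exists>f. \<forall>x \<in> ball 0 1. u x = f (norm x))"

text \<open>Weak solution of -Delta_B u - lambda u = |u|^(p-2) u, tested against C_c^infinity(B^N).
  The metric inner product <grad_B u, grad_B phi>_g = ((1-|x|^2)/2)^2 (grad u . grad phi).\<close>
definition weak_sol :: "real \<Rightarrow> real \<Rightarrow> (real^'n \<Rightarrow> real) \<Rightarrow> (real^'n \<Rightarrow> real^'n) \<Rightarrow> bool" where
  "weak_sol lam p u G \<longleftrightarrow> (\<forall>\<phi>. test_fun \<phi> \<longrightarrow>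
     integrable hypvol (\<lambda>x. ((1 - (norm x)\<^sup>2) / 2)\<^sup>2 * (G x \<bullet> pgrad \<phi> x)) \<and>
     integrable hypvol (\<lambda>x. u x * \<phi> x) \<and>
     integrable hypvol (\<lambda>x. \<bar>u x\<bar> powr (p - 2) * u x * \<phi> x) \<and>
     (\<integral>x. ((1 - (norm x)\<^sup>2) / 2)\<^sup>2 * (G x \<bullet> pgrad \<phi> x) \<partial>hypvol)
       - lam * (\<integral>x. u x * \<phi> x \<partial>hypvol)
       = (\<integral>x. \<bar>u x\<bar> powr (p - 2) * u x * \<phi> x \<partial>hypvol))"

end

theory Submission
  imports Defs "HOL-Computational_Algebra.Polynomial"
begin

text \<open>In the coordinate t = - ln |x| hyperbolic space is conformal to a half cylinder, and a radial solution
  u becomes w = sinh^{-m} u with m = (N - 2)/2, which solves the Emden-Fowler equation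
  w'' = (m^2 - \<kappa> / sinh^2 - |w|^{p-2} sinh^{-\<delta>}) w on a half line, where \<kappa> = \<lambda> - N(N-2)/4 > 0.
  A loss of compactness is a solution that is not small far out in t.  By the energy bound and the
  pigeonhole principle there is, within a bounded range, a long window on which w is small; there w decays
  like e^{-9t/4} from both ends.  If w became large again at some \<beta> beyond the window, the Pohozaev functional
  would be exponentially small in the middle of the window, but it decreases and is at least of order e^{-2\<beta>}
  at \<beta>; as 9/4 > 2 this is impossible for a long window.  Hence w stays small from a uniform point on, and comparison
  with a supersolution gives w = O(e^{-mt}), that is, a uniform bound on u near the origin.  Near the boundary the
  bound is Strauss' radial lemma.  That u solves an ordinary differential equation in the classical sense
  follows by testing the weak equation with functions of s = |x|^2.\<close>

section \<open>The Emden-Fowler equation on a half line\<close>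

text \<open>The constants may depend only on \<open>m\<close>, \<open>kap\<close> and
  \<open>M\<close>, while p ranges over the whole of (2, 2N/(N-2)]. As p tends to 2, |w|^(p-2) tends
  to 1 for every fixed nonzero w, and at the critical p the weight sinh^(-\<delta>) is constant, so
  neither factor is uniformly small by itself. The identity (p-2) m + \<delta> = 2 restores
  uniformity: for t \<ge> s0 the threshold |w| \<le> e^(-m s0) bounds their product by 9 e^(-2 s0)
  for every p. At the critical p the exponent \<delta> vanishes and \<kappa> > 0 is the only source
  of strict decrease of the Pohozaev functional; it yields the rate e^(-2t). The window lengths come
  from the same comparison. If w decays at rate k from both ends of [a,b], it has size e^(-k(b-a)/2)
  in the middle, where the quadratic functional has size e^(-k(b-a)). Against e^(-2b) this gives
  (k-2) b \<le> k a + const, so k must exceed 2, while comparison needs k < m. For k = 9/4 the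
  result is b \<le> 9 a + const, hence windows with T(i+1) = 9 T(i) + D.\<close>

lemma abs_powr_has_real_derivative:
  fixes p x :: real
  assumes "2 < p"
  shows "((\<lambda>x. \<bar>x\<bar> powr p) has_real_derivative p * (\<bar>x\<bar> powr (p - 2) * x)) (at x)"
proof -
  consider "x > 0" | "x < 0" | "x = 0" by linarith
  then show ?thesis
  proof cases
    case 1
    have "((\<lambda>x. x powr p) has_real_derivative p * x powr (p - 1)) (at x)"
      using 1 by (auto intro!: derivative_eq_intros)
    moreover have "\<forall>\<^sub>F y in nhds x. y powr p = \<bar>y\<bar> powr p"
      using eventually_nhds_in_open[of "{0<..}" x] 1
      by (auto elim!: eventually_mono)
    moreover have "x powr (p - 1) = \<bar>x\<bar> powr (p - 2) * x"
      using 1 powr_add[of x "p - 2" 1] by simp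
    ultimately show ?thesis
      using DERIV_cong_ev[OF refl, of "\<lambda>y. y powr p" "\<lambda>y. \<bar>y\<bar> powr p" x] by auto
  next
    case 2
    have "((\<lambda>x. (- x) powr p) has_real_derivative - (p * (- x) powr (p - 1))) (at x)"
      using 2 by (auto intro!: derivative_eq_intros)
    moreover have "\<forall>\<^sub>F y in nhds x. (- y) powr p = \<bar>y\<bar> powr p"
      using eventually_nhds_in_open[of "{..<0}" x] 2
      by (auto elim!: eventually_mono)
    moreover have "- ((- x) powr (p - 1)) = \<bar>x\<bar> powr (p - 2) * x"
      using 2 powr_add[of "- x" "p - 2" 1] by simp
    ultimately show ?thesis
      using DERIV_cong_ev[OF refl, of "\<lambda>y. (- y) powr p" "\<lambda>y. \<bar>y\<bar> powr p" x]
      by (metis (no_types, lifting) minus_mult_right)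
  next
    case 3
    \<comment> \<open>At \<open>0\<close> the difference quotient of |h|^p is bounded by |h|^(p-1),
      so its limit exists and is 0.\<close>
    have lim: "((\<lambda>h::real. \<bar>h\<bar> powr (p - 1)) \<longlongrightarrow> 0) (at 0)"
    proof -
      have "((\<lambda>h::real. \<bar>h\<bar> powr (p - 1)) \<longlongrightarrow> 0 powr (p - 1)) (at 0)"
        using assms by (intro tendsto_powr2 tendsto_eq_intros) (auto intro!: tendsto_rabs_zero)
      then show ?thesis by simp
    qed
    have "((\<lambda>h::real. \<bar>h\<bar> powr p / h) \<longlongrightarrow> 0) (at 0)"
    proof (rule Lim_null_comparison[OF _ lim])
      show "\<forall>\<^sub>F h in at (0::real). norm (\<bar>h\<bar> powr p / h) \<le> \<bar>h\<bar> powr (p - 1)"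
      proof (rule eventually_at_filter[THEN iffD2], intro always_eventually allI impI)
        fix h :: real assume "h \<noteq> 0"
        then have "\<bar>h\<bar> powr p = \<bar>h\<bar> powr (p - 1) * \<bar>h\<bar>"
          using powr_add[of "\<bar>h\<bar>" "p - 1" 1] by simp
        then show "norm (\<bar>h\<bar> powr p / h) \<le> \<bar>h\<bar> powr (p - 1)" using \<open>h \<noteq> 0\<close> by simp
      qed
    qed
    then show ?thesis using 3 by (simp add: DERIV_def)
  qed
qed

text \<open>One-dimensional maximum principle: at a positive interior maximum \<open>f'\<close>
  vanishes and \<open>f''\<close> is positive, so \<open>f\<close> would still increase to the right
  of it.\<close>

lemma nonpos_of_convex_where_pos:
  fixes f f' f'' :: "real \<Rightarrow> real"
  assumes ab: "a \<le> b"
    and d1: "\<And>t. a \<le> t \<Longrightarrow> t \<le> b \<Longrightarrow> (f has_real_derivative f' t) (at t)"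
    and d2: "\<And>t. a \<le> t \<Longrightarrow> t \<le> b \<Longrightarrow> (f' has_real_derivative f'' t) (at t)"
    and pos: "\<And>t. a \<le> t \<Longrightarrow> t \<le> b \<Longrightarrow> 0 < f t \<Longrightarrow> 0 < f'' t"
    and ends: "f a \<le> 0" "f b \<le> 0"
    and t: "a \<le> t" "t \<le> b"
  shows "f t \<le> 0"
proof (rule ccontr)
  assume "\<not> f t \<le> 0"
  have "continuous_on {a..b} f"
    by (meson DERIV_atLeastAtMost_imp_continuous_on d1)
  then obtain s where s: "s \<in> {a..b}" "\<And>y. y \<in> {a..b} \<Longrightarrow> f y \<le> f s"
    using continuous_attains_sup[of "{a..b}" f] ab by auto
  have fs: "0 < f s" using s(2)[of t] t \<open>\<not> f t \<le> 0\<close> by auto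
  then have sab: "a < s" "s < b" using s(1) ends by (auto simp: less_le)
  define e where "e = min (s - a) (b - s)"
  have "f' s = 0"
  proof (rule DERIV_local_max[OF d1])
    show "0 < e" using sab by (auto simp: e_def)
    show "\<forall>y. \<bar>s - y\<bar> < e \<longrightarrow> f y \<le> f s" using s(2) by (auto simp: e_def abs_less_iff)
  qed (use s in auto)
  moreover obtain d where d: "0 < d" "\<And>h. 0 < h \<Longrightarrow> h < d \<Longrightarrow> f' s < f' (s + h)"
    using DERIV_pos_inc_right[OF d2 pos[OF _ _ fs], of ] s(1) by auto
  define y where "y = s + min d (b - s) / 2"
  have y: "s < y" "y < b" "y - s < d" using d(1) sab by (auto simp: y_def min_def field_simps)
  obtain x where x: "s < x" "x < y" "f y - f s = (y - s) * f' x"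
    using MVT2[of s y f f'] d1 y sab by (meson less_eq_real_def order_trans)
  have "0 < f' x" using d(2)[of "x - s"] x y \<open>f' s = 0\<close> by auto
  then have "f y > f s" using x y by (smt (verit) mult_pos_pos)
  then show False using s(2)[of y] y sab by auto
qed


section \<open>Bounds for sinh, the Emden-Fowler equation and its a priori estimates\<close>

lemma sinh_ge_exp_third:
  fixes t :: real
  assumes "1 \<le> t"
  shows "exp t / 3 \<le> sinh t"
proof -
  have "exp (-2) \<le> (1/3 :: real)"
    using exp_ge_add_one_self[of "2::real"] by (simp add: exp_minus field_simps)
  have "exp (- t) \<le> exp (t - 2)" using assms by simp
  also have "\<dots> = exp t * exp (-2)" by (simp add: exp_diff exp_minus field_simps)
  also have "\<dots> \<le> exp t * (1/3)" using \<open>exp (-2) \<le> 1/3\<close> by (intro mult_left_mono) auto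
  finally show ?thesis by (simp add: sinh_def field_simps)
qed

lemma sinh_ge_one:
  fixes t :: real
  assumes "1 \<le> t"
  shows "1 \<le> sinh t"
proof -
  have "0 < t" using assms by simp
  have "t \<le> sinh t"
  proof -
    have "(\<lambda>x. sinh x - x) 0 \<le> (\<lambda>x. sinh x - x) t"
    proof (rule DERIV_nonneg_imp_nondecreasing[where f = "\<lambda>x. sinh x - x"])
      fix x :: real
      show "\<exists>y. ((\<lambda>x. sinh x - x) has_real_derivative y) (at x) \<and> 0 \<le> y"
        by (intro exI[of _ "cosh x - 1"] conjI derivative_eq_intros | simp add: cosh_real_ge_1)+
    qed (use \<open>0 < t\<close> in simp)
    then show ?thesis by simp
  qed
  then show ?thesis using assms by simp
qed

text \<open>The exponent \<open>2 * m + 2 - p * m\<close> vanishes exactly at the critical p =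
  2N/(N-2), where the nonlinearity is conformally invariant and carries no weight.\<close>

definition ef_potential :: "real \<Rightarrow> real \<Rightarrow> real \<Rightarrow> (real \<Rightarrow> real) \<Rightarrow> real \<Rightarrow> real" where
  "ef_potential m kap p w t =
     kap / (sinh t)\<^sup>2 + \<bar>w t\<bar> powr (p - 2) * sinh t powr (- (2 * m + 2 - p * m))"

text \<open>The energy enters through a primitive \<open>En\<close> of its density, so energy
  estimates become monotonicity arguments or the mean value theorem, without integrals.\<close>

locale emden_fowler =
  fixes m kap M p :: real and w w1 En :: "real \<Rightarrow> real"
  assumes m_ge: "5/2 \<le> m" and kap_pos: "0 < kap"
    and p_gt: "2 < p" and p_le: "p * m \<le> 2 * m + 2"
    and w_deriv: "\<And>t. 1 \<le> t \<Longrightarrow> (w has_real_derivative w1 t) (at t)"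
    and w1_deriv: "\<And>t. 1 \<le> t \<Longrightarrow>
          (w1 has_real_derivative (m\<^sup>2 - ef_potential m kap p w t) * w t) (at t)"
    and En_deriv: "\<And>t. 1 \<le> t \<Longrightarrow> (En has_real_derivative (w t)\<^sup>2 + (w1 t)\<^sup>2) (at t)"
    and En_le: "\<And>t. 1 \<le> t \<Longrightarrow> En t - En 1 \<le> M"
begin

abbreviation q :: "real \<Rightarrow> real" where "q \<equiv> ef_potential m kap p w"

definition del :: real where "del = 2 * m + 2 - p * m"

lemma del_bounds: "0 \<le> del" "del \<le> 2"
  using p_le p_gt m_ge by (auto simp: del_def)

text \<open>Source of all uniformity in \<open>p\<close>: what the amplitude contributes to the
  decay of the nonlinear potential and what the weight contributes always add up to 2.\<close>

lemma p_minus_two: "(p - 2) * m = 2 - del"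
  by (simp add: del_def algebra_simps)

lemma p_less: "p - 2 < 1"
proof -
  have "(p - 2) * (5/2) \<le> (p - 2) * m" using p_gt m_ge by (intro mult_left_mono) auto
  also have "\<dots> \<le> 2" using p_minus_two del_bounds by simp
  finally show ?thesis by simp
qed

lemma q_nonneg: "0 \<le> q t"
  using kap_pos by (simp add: ef_potential_def)

lemma En_mono: "1 \<le> s \<Longrightarrow> s \<le> t \<Longrightarrow> En s \<le> En t"
  by (rule DERIV_nonneg_imp_nondecreasing[of s t En])
     (auto intro!: exI[of _ "(w x)\<^sup>2 + (w1 x)\<^sup>2" for x] En_deriv)

lemma En_diff_le: "1 \<le> s \<Longrightarrow> 1 \<le> t \<Longrightarrow> En t - En s \<le> M"
  using En_le[of t] En_mono[of 1 s] by linarith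

lemma M_nonneg: "0 \<le> M" using En_le[of 1] by simp

text \<open>Together with the next lemma this is the one-dimensional Sobolev bound |(w^2)'| \<le>
  w^2 + w'^2; the derivative here is minus the square of w - w'.\<close>

lemma w_sq_minus_En_antimono:
  assumes "1 \<le> s" "s \<le> t"
  shows "(w t)\<^sup>2 - En t \<le> (w s)\<^sup>2 - En s"
proof (rule DERIV_nonpos_imp_nonincreasing[OF assms(2)])
  fix x assume "s \<le> x" "x \<le> t"
  then have "((\<lambda>x. (w x)\<^sup>2 - En x) has_real_derivative - (w x - w1 x)\<^sup>2) (at x)"
    using assms by (auto intro!: derivative_eq_intros w_deriv En_deriv simp: power2_eq_square algebra_simps)
  then show "\<exists>y. ((\<lambda>x. (w x)\<^sup>2 - En x) has_real_derivative y) (at x) \<and> y \<le> 0"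
    by (intro exI conjI) auto
qed

lemma w_sq_plus_En_mono:
  assumes "1 \<le> s" "s \<le> t"
  shows "(w s)\<^sup>2 + En s \<le> (w t)\<^sup>2 + En t"
proof (rule DERIV_nonneg_imp_nondecreasing[OF assms(2)])
  fix x assume "s \<le> x" "x \<le> t"
  then have "((\<lambda>x. (w x)\<^sup>2 + En x) has_real_derivative (w x + w1 x)\<^sup>2) (at x)"
    using assms by (auto intro!: derivative_eq_intros w_deriv En_deriv simp: power2_eq_square algebra_simps)
  then show "\<exists>y. ((\<lambda>x. (w x)\<^sup>2 + En x) has_real_derivative y) (at x) \<and> 0 \<le> y"
    by (intro exI conjI) auto
qed

text \<open>On an interval of length at least 1 the mean value theorem finds a point where w^2 is at
  most the energy; moving from it to \<open>t\<close> changes w^2 by at most the energy once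
  more.\<close>

lemma energy_window:
  assumes "1 \<le> a" "a + 1 \<le> b" "a \<le> t" "t \<le> b"
  shows "(w t)\<^sup>2 \<le> 2 * (En b - En a)"
proof -
  have "\<exists>s. a < s \<and> s < b \<and> En b - En a = (b - a) * ((w s)\<^sup>2 + (w1 s)\<^sup>2)"
    using assms by (intro MVT2) (auto intro!: En_deriv)
  then obtain s where s: "a < s" "s < b" "En b - En a = (b - a) * ((w s)\<^sup>2 + (w1 s)\<^sup>2)" by blast
  have "1 * ((w s)\<^sup>2 + (w1 s)\<^sup>2) \<le> (b - a) * ((w s)\<^sup>2 + (w1 s)\<^sup>2)"
    using assms by (intro mult_right_mono) auto
  then have "(w s)\<^sup>2 \<le> En b - En a" using s(3) by (smt (verit) zero_le_power2)
  moreover have "(w t)\<^sup>2 - (w s)\<^sup>2 \<le> En b - En a"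
    using w_sq_minus_En_antimono[of s t] w_sq_plus_En_mono[of t s] assms s
      En_mono[of a s] En_mono[of s b] En_mono[of a t] En_mono[of t b] by linarith
  ultimately show ?thesis by simp
qed

lemma w_sq_le: "1 \<le> t \<Longrightarrow> (w t)\<^sup>2 \<le> 2 * M"
  using energy_window[of t "t + 1" t] En_diff_le[of t "t + 1"] by simp

lemma abs_w_le: "1 \<le> t \<Longrightarrow> \<bar>w t\<bar> \<le> sqrt (2 * M)"
  using w_sq_le[of t] real_le_rsqrt by fastforce

text \<open>A crude bound free of \<open>p\<close>: since \<open>p - 2 < 1\<close>, the power of |w|
  is at most \<open>1 + sqrt (2 * M)\<close>.\<close>

lemma q_le:
  assumes "1 \<le> t"
  shows "q t \<le> kap + 1 + sqrt (2 * M)"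
proof -
  have s: "1 \<le> sinh t" using sinh_ge_one assms by simp
  have "kap / (sinh t)\<^sup>2 \<le> kap / 1" using s kap_pos
    by (intro divide_left_mono one_le_power) auto
  moreover have "\<bar>w t\<bar> powr (p - 2) * sinh t powr (- del) \<le> (1 + sqrt (2 * M)) * 1"
  proof (rule mult_mono)
    have "\<bar>w t\<bar> powr (p - 2) \<le> (1 + sqrt (2 * M)) powr (p - 2)"
      using abs_w_le[OF assms] p_gt by (intro powr_mono2) auto
    also have "\<dots> \<le> (1 + sqrt (2 * M)) powr 1"
      using p_less M_nonneg by (intro powr_mono) auto
    finally show "\<bar>w t\<bar> powr (p - 2) \<le> 1 + sqrt (2 * M)" using M_nonneg by simp
    show "sinh t powr (- del) \<le> 1"
      using s del_bounds powr_mono[of "- del" 0 "sinh t"] by (simp split: if_splits)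
  qed (use M_nonneg in auto)
  ultimately show ?thesis by (simp add: ef_potential_def del_def)
qed

text \<open>By \<open>p_minus_two\<close> the exponent (p-2) a + del t is at least 2 a / m whenever
  a \<le> m t, whatever \<open>p\<close> is. The constant 9 is the square of the 3 in
  \<open>sinh_ge_exp_third\<close>.\<close>

lemma q_small:
  assumes "1 \<le> t" "0 \<le> a" "a \<le> m * t" "\<bar>w t\<bar> \<le> exp (- a)"
  shows "q t \<le> 9 * (kap + 1) * exp (- (2 * a / m))"
proof -
  have s: "exp t / 3 \<le> sinh t" using sinh_ge_exp_third assms by simp
  have at: "a / m \<le> t" using assms m_ge by (simp add: field_simps)
  have "kap / (sinh t)\<^sup>2 \<le> kap / (exp t / 3)\<^sup>2"
    using s kap_pos by (intro divide_left_mono power_mono) (auto intro!: mult_pos_pos zero_less_power simp del: zero_less_power2 intro: less_le_trans[of 0 "exp t / 3"])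
  also have "\<dots> = 9 * kap * exp (- (2 * t))"
    by (simp add: power_divide exp_minus field_simps exp_double[symmetric])
  also have "\<dots> \<le> 9 * kap * exp (- (2 * a / m))"
    using at kap_pos by simp
  finally have 1: "kap / (sinh t)\<^sup>2 \<le> 9 * kap * exp (- (2 * a / m))" .
  have "\<bar>w t\<bar> powr (p - 2) * sinh t powr (- del) \<le> exp (- a) powr (p - 2) * (9 * exp (- del * t))"
  proof (rule mult_mono)
    show "\<bar>w t\<bar> powr (p - 2) \<le> exp (- a) powr (p - 2)"
      using assms p_gt by (intro powr_mono2) auto
    have "sinh t powr (- del) \<le> (exp t / 3) powr (- del)"
      using s del_bounds by (intro powr_mono2') auto
    also have "\<dots> = exp (- del * t) * 3 powr del"
      by (simp add: powr_def exp_add[symmetric] ln_div algebra_simps)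
    also have "\<dots> \<le> exp (- del * t) * 3 powr 2"
      using del_bounds by (intro mult_left_mono powr_mono) auto
    finally show "sinh t powr (- del) \<le> 9 * exp (- del * t)" by simp
  qed auto
  also have "\<dots> = 9 * exp (- ((p - 2) * a + del * t))"
    by (simp add: powr_def exp_add[symmetric] algebra_simps)
  also have "\<dots> \<le> 9 * exp (- (2 * a / m))"
  proof -
    have "2 * a / m = (p - 2) * a + del * (a / m)"
    proof -
      have "(p - 2) * a + del * (a / m) = a * ((p - 2) * m + del) / m"
        using m_ge by (simp add: field_simps)
      then show ?thesis using p_minus_two by simp
    qed
    also have "\<dots> \<le> (p - 2) * a + del * t" using at del_bounds by (intro add_left_mono mult_left_mono)
    finally show ?thesis by simp
  qed
  finally show ?thesis using 1 by (simp add: ef_potential_def del_def algebra_simps)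
qed

end

section \<open>The derivative bound and the Pohozaev functional\<close>

context emden_fowler
begin

text \<open>Within distance 1 there is a point where w'^2 is at most the energy, and by the equation
  |(w'^2)'| is at most \<open>L\<close> times the energy density on the way to it.\<close>

lemma w1_sq_le:
  assumes "1 \<le> t"
  shows "(w1 t)\<^sup>2 \<le> (1 + m\<^sup>2 + kap + 1 + sqrt (2 * M)) * M"
proof -
  define L where "L = m\<^sup>2 + kap + 1 + sqrt (2 * M)"
  have L: "0 \<le> L" using kap_pos M_nonneg by (simp add: L_def)
  have "\<exists>s. t < s \<and> s < t + 1 \<and> En (t + 1) - En t = (t + 1 - t) * ((w s)\<^sup>2 + (w1 s)\<^sup>2)"
    using assms by (intro MVT2) (auto intro!: En_deriv)
  then obtain s where s: "t < s" "s < t + 1" "En (t + 1) - En t = (w s)\<^sup>2 + (w1 s)\<^sup>2" by auto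
  have "(w1 t)\<^sup>2 + L * En t \<le> (w1 s)\<^sup>2 + L * En s"
  proof (rule DERIV_nonneg_imp_nondecreasing[where f = "\<lambda>x. (w1 x)\<^sup>2 + L * En x"])
    fix x assume x: "t \<le> x" "x \<le> s"
    then have x1: "1 \<le> x" using assms by simp
    have d: "((\<lambda>x. (w1 x)\<^sup>2 + L * En x) has_real_derivative
        2 * ((m\<^sup>2 - q x) * w x) * w1 x + L * ((w x)\<^sup>2 + (w1 x)\<^sup>2)) (at x)"
      using x1 by (auto intro!: derivative_eq_intros w1_deriv En_deriv)
    have "\<bar>m\<^sup>2 - q x\<bar> \<le> L"
      using q_le[OF x1] q_nonneg[of x] kap_pos M_nonneg by (simp add: L_def abs_le_iff) (smt (verit) zero_le_power2)
    moreover have "2 * \<bar>w x * w1 x\<bar> \<le> (w x)\<^sup>2 + (w1 x)\<^sup>2"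
      using sum_squares_bound[of "\<bar>w x\<bar>" "\<bar>w1 x\<bar>"] by (simp add: abs_mult)
    ultimately have "\<bar>m\<^sup>2 - q x\<bar> * (2 * \<bar>w x * w1 x\<bar>) \<le> L * ((w x)\<^sup>2 + (w1 x)\<^sup>2)"
      using L by (intro mult_mono) auto
    moreover have "\<bar>2 * ((m\<^sup>2 - q x) * w x) * w1 x\<bar> = \<bar>m\<^sup>2 - q x\<bar> * (2 * \<bar>w x * w1 x\<bar>)"
      by (simp add: abs_mult)
    ultimately have "0 \<le> 2 * ((m\<^sup>2 - q x) * w x) * w1 x + L * ((w x)\<^sup>2 + (w1 x)\<^sup>2)"
      by linarith
    with d show "\<exists>y. ((\<lambda>x. (w1 x)\<^sup>2 + L * En x) has_real_derivative y) (at x) \<and> 0 \<le> y" by blast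
  qed (use s in simp)
  then have "(w1 t)\<^sup>2 \<le> (w1 s)\<^sup>2 + L * (En s - En t)" by (simp add: algebra_simps)
  also have "\<dots> \<le> M + L * M"
    using s En_diff_le[of t "t + 1"] En_diff_le[of t s] assms L
    by (intro add_mono mult_left_mono) (auto intro: order_trans[of _ "(w s)\<^sup>2 + (w1 s)\<^sup>2"])
  finally show ?thesis by (simp add: L_def algebra_simps)
qed

text \<open>The Pohozaev functional; it is nonincreasing because kap and del are nonnegative.\<close>

definition P :: "real \<Rightarrow> real" where
  "P t = (w1 t)\<^sup>2 / 2 - m\<^sup>2 * (w t)\<^sup>2 / 2 + kap * (w t)\<^sup>2 / (2 * (sinh t)\<^sup>2)
     + sinh t powr (- del) * \<bar>w t\<bar> powr p / p"

text \<open>All terms containing w w' cancel by the equation; only the derivatives of the two sinh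
  weights survive.\<close>

lemma P_deriv:
  assumes t: "1 \<le> t"
  shows "(P has_real_derivative - (kap * (w t)\<^sup>2 * cosh t / sinh t ^ 3
     + del * cosh t * sinh t powr (- del - 1) * \<bar>w t\<bar> powr p / p)) (at t)"
proof -
  have s: "0 < sinh t" using t by simp
  have a: "((\<lambda>t. \<bar>w t\<bar> powr p) has_real_derivative p * (\<bar>w t\<bar> powr (p - 2) * w t) * w1 t) (at t)"
    using DERIV_chain2[OF abs_powr_has_real_derivative[OF p_gt] w_deriv[OF t]] by simp
  have b: "((\<lambda>t. sinh t powr (- del)) has_real_derivative - del * sinh t powr (- del - 1) * cosh t) (at t)"
    using s by (auto intro!: derivative_eq_intros)
  have c: "((\<lambda>t. kap * (w t)\<^sup>2 / (2 * (sinh t)\<^sup>2)) has_real_derivative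
      kap * w t * w1 t / (sinh t)\<^sup>2 - kap * (w t)\<^sup>2 * cosh t / sinh t ^ 3) (at t)"
    using s by (auto intro!: derivative_eq_intros w_deriv t simp: field_simps power2_eq_square power3_eq_cube)
  have d: "((\<lambda>t. (w1 t)\<^sup>2 / 2 - m\<^sup>2 * (w t)\<^sup>2 / 2) has_real_derivative
      (m\<^sup>2 - q t) * w t * w1 t - m\<^sup>2 * w t * w1 t) (at t)"
    by (auto intro!: derivative_eq_intros w_deriv w1_deriv t simp: field_simps)
  have "(P has_real_derivative ((m\<^sup>2 - q t) * w t * w1 t - m\<^sup>2 * w t * w1 t
     + (kap * w t * w1 t / (sinh t)\<^sup>2 - kap * (w t)\<^sup>2 * cosh t / sinh t ^ 3)
     + (sinh t powr (- del) * (p * (\<bar>w t\<bar> powr (p - 2) * w t) * w1 t)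
        + (- del * sinh t powr (- del - 1) * cosh t) * \<bar>w t\<bar> powr p) / p)) (at t)"
    unfolding P_def by (intro DERIV_add c d DERIV_cdivide DERIV_mult' a b)
  moreover have "(m\<^sup>2 - q t) * w t * w1 t - m\<^sup>2 * w t * w1 t
     + (kap * w t * w1 t / (sinh t)\<^sup>2 - kap * (w t)\<^sup>2 * cosh t / sinh t ^ 3)
     + (sinh t powr (- del) * (p * (\<bar>w t\<bar> powr (p - 2) * w t) * w1 t)
        + (- del * sinh t powr (- del - 1) * cosh t) * \<bar>w t\<bar> powr p) / p
     = - (kap * (w t)\<^sup>2 * cosh t / sinh t ^ 3
     + del * cosh t * sinh t powr (- del - 1) * \<bar>w t\<bar> powr p / p)"
    using p_gt by (simp add: ef_potential_def del_def[symmetric] add_divide_distrib diff_divide_distrib)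
      (simp add: algebra_simps)
  ultimately show ?thesis by metis
qed

lemma P_antimono:
  assumes "1 \<le> s" "s \<le> t"
  shows "P t \<le> P s"
proof (rule DERIV_nonpos_imp_nonincreasing[OF assms(2)])
  fix x assume "s \<le> x" "x \<le> t"
  then have x: "1 \<le> x" using assms by simp
  have "0 < sinh x" using x by simp
  then have "0 \<le> kap * (w x)\<^sup>2 * cosh x / sinh x ^ 3
     + del * cosh x * sinh x powr (- del - 1) * \<bar>w x\<bar> powr p / p"
    using kap_pos del_bounds p_gt
    by (intro add_nonneg_nonneg divide_nonneg_pos mult_nonneg_nonneg) auto
  then show "\<exists>y. (P has_real_derivative y) (at x) \<and> y \<le> 0"
    using P_deriv[OF x] by (meson neg_le_0_iff_le)
qed

lemma small_points:
  assumes "1 \<le> s" "0 < e"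
  obtains t where "s \<le> t" "(w t)\<^sup>2 + (w1 t)\<^sup>2 < e"
proof -
  \<comment> \<open>If the energy density were at least \<open>e\<close> on an interval of this
    length, the energy spent there would exceed \<open>M\<close>.\<close>
  define t where "t = s + (M + 1) / e"
  have t: "s < t" using assms M_nonneg by (auto simp: t_def)
  then have "\<exists>x. s < x \<and> x < t \<and> En t - En s = (t - s) * ((w x)\<^sup>2 + (w1 x)\<^sup>2)"
    using assms by (intro MVT2) (auto intro!: En_deriv)
  then obtain x where x: "s < x" "En t - En s = (M + 1) / e * ((w x)\<^sup>2 + (w1 x)\<^sup>2)"
    by (auto simp: t_def)
  have "(M + 1) / e * ((w x)\<^sup>2 + (w1 x)\<^sup>2) \<le> M" using x En_diff_le[of s t] assms t by simp
  also have "\<dots> < M + 1" by simp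
  finally have "(M + 1) * (((w x)\<^sup>2 + (w1 x)\<^sup>2) / e) < (M + 1) * 1" by (simp add: field_simps)
  then have "((w x)\<^sup>2 + (w1 x)\<^sup>2) / e < 1" using M_nonneg by (subst (asm) mult_less_cancel_left_pos) auto
  then have "(w x)\<^sup>2 + (w1 x)\<^sup>2 < e" using assms by simp
  then show ?thesis using that[of x] x by simp
qed

text \<open>\<open>P\<close> is nonincreasing, and finite energy gives points arbitrarily far out
  where its only negative term is as small as desired.\<close>

lemma P_nonneg:
  assumes "1 \<le> s"
  shows "0 \<le> P s"
proof (rule ccontr)
  assume "\<not> 0 \<le> P s"
  define e where "e = - P s / m\<^sup>2"
  have e: "0 < e" using \<open>\<not> 0 \<le> P s\<close> m_ge by (auto simp: e_def field_simps)
  obtain t where t: "s \<le> t" "(w t)\<^sup>2 + (w1 t)\<^sup>2 < e" using small_points[OF assms e] .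
  have "m\<^sup>2 * (w t)\<^sup>2 / 2 \<le> m\<^sup>2 * e / 2"
    using t by (intro divide_right_mono mult_left_mono) (auto intro: order_trans[of _ "(w t)\<^sup>2 + (w1 t)\<^sup>2"])
  also have "\<dots> = - P s / 2" using m_ge by (simp add: e_def)
  finally have "m\<^sup>2 * (w t)\<^sup>2 / 2 \<le> - P s / 2" .
  moreover have "- (m\<^sup>2 * (w t)\<^sup>2 / 2) \<le> P t"
  proof -
    have "0 \<le> kap * (w t)\<^sup>2 / (2 * (sinh t)\<^sup>2)" "0 \<le> sinh t powr (- del) * \<bar>w t\<bar> powr p / p"
      using kap_pos p_gt by auto
    then show ?thesis unfolding P_def by (smt (verit) zero_le_power2 divide_nonneg_nonneg)
  qed
  moreover have "P t \<le> P s" using P_antimono assms t by simp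
  ultimately show False using \<open>\<not> 0 \<le> P s\<close> by linarith
qed

text \<open>For \<open>e\<close> at most 1 everything is quadratic in \<open>e\<close>: sinh t \<ge>
  1 removes the weights, and p > 2 gives |w|^p \<le> w^2. The bound \<open>2 * e\<close> fits a
  derivative obtained as a difference of two values of w.\<close>

lemma P_upper:
  assumes "1 \<le> t" "\<bar>w t\<bar> \<le> e" "\<bar>w1 t\<bar> \<le> 2 * e" "e \<le> 1"
  shows "P t \<le> (kap + 3) * e\<^sup>2"
proof -
  have s: "1 \<le> sinh t" using sinh_ge_one assms by simp
  have w2: "(w t)\<^sup>2 \<le> e\<^sup>2" "(w1 t)\<^sup>2 \<le> (2 * e)\<^sup>2"
    using assms by (metis abs_le_square_iff abs_of_nonneg abs_ge_zero order_trans)+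
  have "kap * (w t)\<^sup>2 / (2 * (sinh t)\<^sup>2) \<le> kap * e\<^sup>2 / 1"
    using s kap_pos w2 by (intro frac_le mult_left_mono) (auto intro: order_trans[OF one_le_power[OF s, of 2]])
  moreover have "sinh t powr (- del) * \<bar>w t\<bar> powr p / p \<le> 1 * e\<^sup>2 / 1"
  proof (intro frac_le mult_mono)
    show "sinh t powr (- del) \<le> 1"
      using s del_bounds powr_mono[of "- del" 0 "sinh t"] by (simp split: if_splits)
    have "\<bar>w t\<bar> powr p \<le> \<bar>w t\<bar> powr 2" using assms p_gt by (intro powr_mono') auto
    also have "\<dots> \<le> e\<^sup>2" using w2 by simp
    finally show "\<bar>w t\<bar> powr p \<le> e\<^sup>2" .
  qed (use p_gt in auto)
  moreover have "0 \<le> m\<^sup>2 * (w t)\<^sup>2 / 2" by simp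
  moreover have "(w1 t)\<^sup>2 \<le> 4 * e\<^sup>2" using w2 by (simp add: power_mult_distrib)
  moreover have "(kap + 3) * e\<^sup>2 = kap * e\<^sup>2 + 3 * e\<^sup>2" by (simp add: distrib_right)
  ultimately show ?thesis unfolding P_def using zero_le_power2[of e] by linarith
qed

text \<open>Since \<open>P\<close> stays nonnegative, its value at \<open>b\<close> is at least what
  it loses just after \<open>b\<close>. The \<open>kap\<close> term of the derivative alone gives a
  loss rate of order w^2 e^(-2t).\<close>

lemma P_lower:
  assumes b: "1 \<le> b" and e: "0 < e" "e \<le> \<bar>w b\<bar>" "e \<le> 1"
    and W: "1 \<le> W" "\<And>t. 1 \<le> t \<Longrightarrow> \<bar>w1 t\<bar> \<le> W"
  shows "kap * e ^ 3 / (2 * W) * exp (- 1) * exp (- (2 * b)) \<le> P b"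
proof -
  \<comment> \<open>During a time \<open>c\<close> the derivative bound \<open>W\<close> lets |w|
    drop by at most \<open>e / 2\<close>. As \<open>c\<close> is at most 1/2, exp (-2 t) loses at
    most the factor \<open>exp (- 1)\<close>.\<close>
  define c where "c = e / (2 * W)"
  have "e / (2 * W) \<le> 1 / 2" using e W by (intro frac_le) auto
  then have c: "0 < c" "c \<le> 1 / 2" using e W by (auto simp: c_def)
  define dP where "dP x = kap * (w x)\<^sup>2 * cosh x / sinh x ^ 3
     + del * cosh x * sinh x powr (- del - 1) * \<bar>w x\<bar> powr p / p" for x
  have "\<exists>x. b < x \<and> x < b + c \<and> P (b + c) - P b = (b + c - b) * (- dP x)"
    using c b by (intro MVT2) (auto intro!: P_deriv simp: dP_def simp del: minus_add_distrib)
  then obtain x where x: "b < x" "x < b + c" and Px: "P b - P (b + c) = c * dP x"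
    by (auto simp: algebra_simps)
  have x1: "1 \<le> x" using x b by simp
  have sx: "0 < sinh x" using x1 by simp
  have "\<exists>y. b < y \<and> y < x \<and> w x - w b = (x - b) * w1 y"
    using x b by (intro MVT2) (auto intro!: w_deriv)
  then obtain y where y: "b < y" "y < x" "w x - w b = (x - b) * w1 y" by blast
  have "\<bar>w x - w b\<bar> \<le> c * W"
    unfolding y(3) abs_mult using x y W(2)[of y] b c by (intro mult_mono) auto
  then have "\<bar>w x - w b\<bar> \<le> e / 2" using W by (simp add: c_def)
  then have wx: "e / 2 \<le> \<bar>w x\<bar>" using e by linarith
  have "kap * e\<^sup>2 * exp (- 1) * exp (- (2 * b)) = kap * (e / 2)\<^sup>2 * (4 * exp (- (2 * b + 1)))"
    by (simp add: power_divide exp_diff exp_minus exp_add field_simps)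
  also have "\<dots> \<le> kap * (w x)\<^sup>2 * (cosh x / sinh x ^ 3)"
  proof (intro mult_mono)
    show "(e / 2)\<^sup>2 \<le> (w x)\<^sup>2" using wx e by (metis abs_ge_zero half_gt_zero_iff less_eq_real_def power2_abs power_mono)
    have "sinh x \<le> exp x / 2" by (simp add: sinh_def field_simps)
    then have "1 / (exp x / 2)\<^sup>2 \<le> 1 / (sinh x)\<^sup>2"
      using sx by (intro frac_le power_mono) auto
    moreover have "1 / (exp x / 2)\<^sup>2 = 4 * exp (- (2 * x))"
      by (simp add: power_divide exp_minus field_simps exp_double[symmetric])
    moreover have "4 * exp (- (2 * b + 1)) \<le> 4 * exp (- (2 * x))" using x c by simp
    moreover have "1 / (sinh x)\<^sup>2 \<le> cosh x / sinh x ^ 3"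
      using sx sinh_le_cosh_real[of x] by (simp add: field_simps power2_eq_square power3_eq_cube)
    ultimately show "4 * exp (- (2 * b + 1)) \<le> cosh x / sinh x ^ 3" by linarith
  qed (use kap_pos in auto)
  finally have "kap * e\<^sup>2 * exp (- 1) * exp (- (2 * b)) \<le> kap * (w x)\<^sup>2 * cosh x / sinh x ^ 3"
    by simp
  moreover have "0 \<le> del * cosh x * sinh x powr (- del - 1) * \<bar>w x\<bar> powr p / p"
    using del_bounds p_gt by simp
  ultimately have "c * (kap * e\<^sup>2 * exp (- 1) * exp (- (2 * b))) \<le> P b - P (b + c)"
    unfolding Px dP_def using c by (intro mult_left_mono) auto
  then show ?thesis using P_nonneg[of "b + c"] b c
    by (simp add: c_def power2_eq_square power3_eq_cube mult_ac)
qed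

section \<open>Comparison with supersolutions, return times and the pigeonhole argument\<close>

lemma supersolution_bound:
  assumes ab: "1 \<le> a" "a \<le> b"
    and h: "\<And>t. a \<le> t \<Longrightarrow> t \<le> b \<Longrightarrow> (h has_real_derivative h1 t) (at t)"
      "\<And>t. a \<le> t \<Longrightarrow> t \<le> b \<Longrightarrow> (h1 has_real_derivative h2 t) (at t)"
      "\<And>t. a \<le> t \<Longrightarrow> t \<le> b \<Longrightarrow> h2 t \<le> (m\<^sup>2 - q t) * h t"
    and q: "\<And>t. a \<le> t \<Longrightarrow> t \<le> b \<Longrightarrow> q t < m\<^sup>2"
    and ends: "\<bar>w a\<bar> \<le> h a" "\<bar>w b\<bar> \<le> h b"
    and t: "a \<le> t" "t \<le> b"
  shows "\<bar>w t\<bar> \<le> h t"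
proof -
  \<comment> \<open>Both w - h and - w - h satisfy the maximum principle: where such a difference is
    positive, q < m^2 makes its second derivative positive.\<close>
  have gen: "c * w t - h t \<le> 0" if c: "c = 1 \<or> c = - 1" for c
  proof (rule nonpos_of_convex_where_pos[OF ab(2), where f = "\<lambda>t. c * w t - h t" and f' = "\<lambda>t. c * w1 t - h1 t"
        and f'' = "\<lambda>t. c * ((m\<^sup>2 - q t) * w t) - h2 t"])
    fix x assume x: "a \<le> x" "x \<le> b"
    then have x1: "1 \<le> x" using ab by simp
    show "((\<lambda>t. c * w t - h t) has_real_derivative c * w1 x - h1 x) (at x)"
      by (intro DERIV_diff DERIV_cmult w_deriv x1 h x)
    show "((\<lambda>t. c * w1 t - h1 t) has_real_derivative c * ((m\<^sup>2 - q x) * w x) - h2 x) (at x)"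
      by (intro DERIV_diff DERIV_cmult w1_deriv x1 h x)
    assume "0 < c * w x - h x"
    then have "0 < (m\<^sup>2 - q x) * (c * w x - h x)" using q[OF x] by (intro mult_pos_pos) auto
    then show "0 < c * ((m\<^sup>2 - q x) * w x) - h2 x" using h(3)[OF x] by (simp add: algebra_simps)
  qed (use c ends t in auto)
  show ?thesis using gen[of 1] gen[of "- 1"] by simp
qed


lemma exp_window_deriv:
  fixes a b c k t :: real
  shows "((\<lambda>t. c * exp (- k * (t - a)) + c * exp (- k * (b - t))) has_real_derivative
      c * (- k * exp (- k * (t - a))) + c * (k * exp (- k * (b - t)))) (at t)"
    and "((\<lambda>t. c * (- k * exp (- k * (t - a))) + c * (k * exp (- k * (b - t)))) has_real_derivative
      k\<^sup>2 * (c * exp (- k * (t - a)) + c * exp (- k * (b - t)))) (at t)"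
proof -
  show "((\<lambda>t. c * exp (- k * (t - a)) + c * exp (- k * (b - t))) has_real_derivative
      c * (- k * exp (- k * (t - a))) + c * (k * exp (- k * (b - t)))) (at t)"
    by (rule derivative_eq_intros refl | simp)+
  show "((\<lambda>t. c * (- k * exp (- k * (t - a))) + c * (k * exp (- k * (b - t)))) has_real_derivative
      k\<^sup>2 * (c * exp (- k * (t - a)) + c * exp (- k * (b - t)))) (at t)"
    by (rule derivative_eq_intros refl | simp add: power2_eq_square distrib_left)+
qed

text \<open>The rate 9/4 lies strictly between 2 (decay of the Pohozaev defect) and m \<ge> 5/2, which is
  where the hypothesis N \<ge> 7 enters.\<close>

lemma decay_in_window:
  assumes s0: "1 \<le> s0" "9 * (kap + 1) * exp (- (2 * s0)) \<le> 1"
    and ab: "s0 \<le> a" "a \<le> b"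
    and small: "\<And>t. a \<le> t \<Longrightarrow> t \<le> b \<Longrightarrow> \<bar>w t\<bar> \<le> exp (- (m * s0))"
    and t: "a \<le> t" "t \<le> b"
  shows "\<bar>w t\<bar> \<le> exp (- (m * s0)) * exp (- (9/4) * (t - a)) + exp (- (m * s0)) * exp (- (9/4) * (b - t))"
proof (rule supersolution_bound[OF _ ab(2) exp_window_deriv _ _ _ _ t])
  have m2: "(5/2)\<^sup>2 \<le> m\<^sup>2" using m_ge by (intro power_mono) auto
  \<comment> \<open>A potential of at most 1 leaves room for the rate 9/4, because 81/16 \<le> 25/4
    - 1.\<close>
  have q1: "q x \<le> 1" if x: "a \<le> x" "x \<le> b" for x
  proof -
    have "q x \<le> 9 * (kap + 1) * exp (- (2 * (m * s0) / m))"
      using s0 ab x m_ge small[OF x] by (intro q_small) auto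
    then show ?thesis using s0 m_ge by simp
  qed
  show "1 \<le> a" using s0 ab by simp
  fix x assume x: "a \<le> x" "x \<le> b"
  show "q x < m\<^sup>2" using q1[OF x] m2 by (simp add: power2_eq_square)
  show "(9/4)\<^sup>2 * (exp (- (m * s0)) * exp (- (9/4) * (x - a)) + exp (- (m * s0)) * exp (- (9/4) * (b - x)))
      \<le> (m\<^sup>2 - q x) * (exp (- (m * s0)) * exp (- (9/4) * (x - a)) + exp (- (m * s0)) * exp (- (9/4) * (b - x)))"
    using q1[OF x] m2 by (intro mult_right_mono) (auto simp: power2_eq_square)
next
  show "\<bar>w a\<bar> \<le> exp (- (m * s0)) * exp (- (9/4) * (a - a)) + exp (- (m * s0)) * exp (- (9/4) * (b - a))"
    using small[of a] ab by (simp add: add_increasing2)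
  show "\<bar>w b\<bar> \<le> exp (- (m * s0)) * exp (- (9/4) * (b - a)) + exp (- (m * s0)) * exp (- (9/4) * (b - b))"
    using small[of b] ab by (simp add: add_increasing)
qed

text \<open>\<open>P\<close> at \<open>b\<close> is bounded by its value near the midpoint of the
  window, which the two-sided decay makes tiny, while \<open>P_lower\<close> bounds it from below.
  Solving 9/4 (b - a) - 2 b \<le> ln (C1 / C2) for \<open>b\<close> produces the factors 9 and
  4.\<close>

lemma first_return:
  assumes s0: "1 \<le> s0" "9 * (kap + 1) * exp (- (2 * s0)) \<le> 1"
    and W: "1 \<le> W" "\<And>t. 1 \<le> t \<Longrightarrow> \<bar>w1 t\<bar> \<le> W"
    and ab: "s0 \<le> a" "a + 6 \<le> b"
    and small: "\<And>t. a \<le> t \<Longrightarrow> t \<le> b \<Longrightarrow> \<bar>w t\<bar> \<le> exp (- (m * s0))"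
    and wb: "exp (- (m * s0)) \<le> \<bar>w b\<bar>"
  shows "b \<le> 9 * a + 4 * ln ((kap + 3) * (2 * exp (9/4))\<^sup>2 / (kap * exp (- (m * s0)) ^ 3 / (2 * W) * exp (- 1)))"
proof -
  define e where "e = exp (- (m * s0))"
  define c where "c = (a + b) / 2"
  define d where "d = b - a"
  \<comment> \<open>Points of [c, c+1] have distance at least d/2 from \<open>a\<close> and at least
    d/2 - 1 from \<open>b\<close>; the missing 1 costs the factor \<open>exp (9/4)\<close>.\<close>
  define f where "f = 2 * exp (9/4) * exp (- (9/8) * d)"
  have e: "0 < e" "e \<le> 1" using s0 m_ge by (auto simp: e_def)
  have d6: "6 \<le> d" using ab by (simp add: d_def)
  have cb: "a \<le> c" "c + 1 \<le> b" using ab by (auto simp: c_def field_simps)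
  have wf: "\<bar>w t\<bar> \<le> f" if t: "c \<le> t" "t \<le> c + 1" for t
  proof -
    have "\<bar>w t\<bar> \<le> e * exp (- (9/4) * (t - a)) + e * exp (- (9/4) * (b - t))"
      unfolding e_def using t ab cb small by (intro decay_in_window s0) auto
    also have "\<dots> \<le> 1 * exp (9/4 + - (9/8) * d) + 1 * exp (9/4 + - (9/8) * d)"
      using e t by (intro add_mono mult_mono) (auto simp: c_def d_def field_simps)
    also have "\<dots> = f" unfolding exp_add by (simp add: f_def)
    finally show ?thesis .
  qed
  have f1: "f \<le> 1"
  proof -
    have "f = 2 * exp (9/4 + - (9/8) * d)" unfolding f_def exp_add by simp
    also have "\<dots> \<le> 2 * exp (- 1)" using d6 by simp
    also have "\<dots> \<le> 1" using exp_ge_add_one_self[of "1::real"] by (simp add: exp_minus field_simps)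
    finally show ?thesis .
  qed
  have c1: "1 \<le> c" using s0 ab by (simp add: c_def)
  \<comment> \<open>At this point w' is the difference of two values of w, each at most
    \<open>f\<close> in modulus, so |w'| \<le> 2 f.\<close>
  have "\<exists>x. c < x \<and> x < c + 1 \<and> w (c + 1) - w c = (c + 1 - c) * w1 x"
    using c1 by (intro MVT2 w_deriv) auto
  then obtain x where x: "c < x" "x < c + 1" "w (c + 1) - w c = w1 x" by auto
  have "P b \<le> P x" using x cb c1 by (intro P_antimono) auto
  also have "P x \<le> (kap + 3) * f\<^sup>2"
    using wf[of x] wf[of c] wf[of "c + 1"] x c1 f1 by (intro P_upper) (auto simp: x(3)[symmetric])
  also have "f\<^sup>2 = (2 * exp (9/4))\<^sup>2 * exp (- (9/4) * d)"
    unfolding f_def power_mult_distrib by (simp add: exp_double[symmetric])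
  finally have up: "P b \<le> (kap + 3) * (2 * exp (9/4))\<^sup>2 * exp (- (9/4) * d)" by simp
  define C1 where "C1 = (kap + 3) * (2 * exp (9/4::real))\<^sup>2"
  define C2 where "C2 = kap * e ^ 3 / (2 * W) * exp (- 1)"
  have C: "0 < C1" "0 < C2" using kap_pos e W by (auto simp: C1_def C2_def)
  have "C2 * exp (- (2 * b)) \<le> P b"
    unfolding C2_def using wb e W s0 ab by (intro P_lower) (auto simp: e_def)
  then have "C2 * exp (- (2 * b)) \<le> C1 * exp (- (9/4) * d)" using up by (simp add: C1_def)
  then have "exp (- (2 * b)) / exp (- (9/4) * d) \<le> C1 / C2" using C by (simp add: field_simps)
  moreover have "exp (- (2 * b)) / exp (- (9/4) * d) = exp (9/4 * d - 2 * b)" by (simp flip: exp_diff)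
  ultimately have "exp (9/4 * d - 2 * b) \<le> C1 / C2" by simp
  then have "9/4 * d - 2 * b \<le> ln (C1 / C2)" using C by (subst ln_ge_iff) auto
  then have "b \<le> 9 * a + 4 * ln (C1 / C2)" unfolding d_def by argo
  then show ?thesis unfolding C1_def C2_def e_def .
qed


text \<open>Every window [T i, T (i+1)] on which |w| reaches the threshold uses energy at least half
  its square, so one of the first \<open>n\<close> windows is free of it. The recursion makes that
  window longer than any return time allowed by \<open>first_return\<close>, so w never comes
  back.\<close>

lemma eventually_small:
  fixes T :: "nat \<Rightarrow> real" and n :: nat
  assumes s0: "1 \<le> s0" "9 * (kap + 1) * exp (- (2 * s0)) \<le> 1"
    and W: "1 \<le> W" "\<And>t. 1 \<le> t \<Longrightarrow> \<bar>w1 t\<bar> \<le> W"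
    and D: "6 \<le> D"
      "4 * ln ((kap + 3) * (2 * exp (9/4))\<^sup>2 / (kap * exp (- (m * s0)) ^ 3 / (2 * W) * exp (- 1))) < D"
    and T: "T 0 = s0" "\<And>i. T (Suc i) = 9 * T i + D"
    and n: "2 * M < real n * (exp (- (m * s0)))\<^sup>2"
    and t: "T n \<le> t"
  shows "\<bar>w t\<bar> \<le> exp (- (m * s0))"
proof -
  define e where "e = exp (- (m * s0))"
  have Ts: "s0 \<le> T i" for i by (induction i) (use T s0 D in auto)
  have Tinc: "T i + 6 \<le> T (Suc i)" for i using T(2)[of i] Ts[of i] s0 D by simp
  have Tmono: "T i \<le> T j" if "i \<le> j" for i j
    by (rule lift_Suc_mono_le[OF _ that]) (use Tinc in \<open>smt (verit)\<close>)
  \<comment> \<open>Otherwise the energies of the \<open>n\<close> disjoint windows add up to more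
    than \<open>M\<close>.\<close>
  have "\<exists>i<n. \<forall>t. T i \<le> t \<longrightarrow> t \<le> T (Suc i) \<longrightarrow> \<bar>w t\<bar> < e"
  proof (rule ccontr)
    assume "\<not> ?thesis"
    then have big: "\<exists>t\<ge>T i. t \<le> T (Suc i) \<and> e \<le> \<bar>w t\<bar>" if "i < n" for i
      using that by (meson not_le)
    have "real k * e\<^sup>2 \<le> 2 * (En (T k) - En (T 0))" if "k \<le> n" for k
      using that
    proof (induction k)
      case (Suc k)
      obtain x where x: "T k \<le> x" "x \<le> T (Suc k)" "e \<le> \<bar>w x\<bar>" using big[of k] Suc by auto
      have "e\<^sup>2 \<le> (w x)\<^sup>2" using x(3) by (metis abs_le_square_iff abs_of_pos e_def exp_gt_zero)
      also have "\<dots> \<le> 2 * (En (T (Suc k)) - En (T k))"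
        using x Ts[of k] Tinc[of k] s0 by (intro energy_window) auto
      finally show ?case using Suc by (simp add: algebra_simps)
    qed simp
    from this[of n] show False using n En_diff_le[of "T 0" "T n"] Ts[of 0] Ts[of n] s0
      by (simp add: e_def)
  qed
  then obtain i where i: "i < n" and free: "\<And>t. T i \<le> t \<Longrightarrow> t \<le> T (Suc i) \<Longrightarrow> \<bar>w t\<bar> < e" by blast
  show ?thesis
  proof (rule ccontr)
    assume "\<not> ?thesis"
    then have wt: "e \<le> \<bar>w t\<bar>" by (simp add: e_def)
    have Tit: "T i \<le> t" using Tmono[of i n] i t by simp
    have cont: "continuous_on {T i..t} (\<lambda>t. \<bar>w t\<bar>)"
      using Ts[of i] s0 by (intro continuous_on_rabs DERIV_continuous_on[of _ _ w1])
        (auto intro!: DERIV_subset[OF w_deriv])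
    have "closed {x \<in> {T i..t}. e \<le> \<bar>w x\<bar>}"
      using continuous_closed_preimage[OF cont, of "{e..}"] by (simp add: vimage_def Int_def)
    then have "compact {x \<in> {T i..t}. e \<le> \<bar>w x\<bar>}"
      unfolding compact_eq_bounded_closed by (auto intro: bounded_subset[OF bounded_closed_interval[of "T i" t]])
    moreover have "{x \<in> {T i..t}. e \<le> \<bar>w x\<bar>} \<noteq> {}" using wt Tit by auto
    \<comment> \<open>The first time at which |w| reaches the threshold; by continuity equality
      holds there, and |w| lies below it on all of [T i, b).\<close>
    ultimately obtain b where b: "T i \<le> b" "b \<le> t" "e \<le> \<bar>w b\<bar>"
      and least: "\<And>x. T i \<le> x \<Longrightarrow> x \<le> t \<Longrightarrow> e \<le> \<bar>w x\<bar> \<Longrightarrow> b \<le> x"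
      using compact_attains_inf[of "{x \<in> {T i..t}. e \<le> \<bar>w x\<bar>}"] by auto
    have wb: "\<bar>w b\<bar> \<le> e"
    proof (rule ccontr)
      assume gt: "\<not> \<bar>w b\<bar> \<le> e"
      have "\<exists>x. T i \<le> x \<and> x \<le> b \<and> \<bar>w x\<bar> = e"
        using free[of "T i"] Tinc[of i] b gt
        by (intro IVT' continuous_on_subset[OF cont]) auto
      then obtain x where "T i \<le> x" "x \<le> b" "\<bar>w x\<bar> = e" by blast
      then show False using least[of x] b gt by force
    qed
    have bT: "T (Suc i) < b" using free[of b] b by force
    have small: "\<bar>w x\<bar> \<le> e" if "T i \<le> x" "x \<le> b" for x
      using least[of x] that wb b by (cases "x = b") force+
    have "b \<le> 9 * T i + 4 * ln ((kap + 3) * (2 * exp (9/4))\<^sup>2 / (kap * exp (- (m * s0)) ^ 3 / (2 * W) * exp (- 1)))"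
      using bT Tinc[of i] b small by (intro first_return s0 W Ts) (auto simp: e_def)
    then show False using bT T(2)[of i] D by simp
  qed
qed

section \<open>From smallness to the decay rate m\<close>

lemma le_of_le_add_exp_tail:
  fixes x y k B t :: real
  assumes k: "0 < k" and le: "\<And>b. B \<le> b \<Longrightarrow> x \<le> y + exp (- k * (b - t))"
  shows "x \<le> y"
proof (rule field_le_epsilon)
  fix e :: real assume e: "0 < e"
  \<comment> \<open>Far enough to the right for the boundary term of the comparison interval to be
    at most \<open>e\<close>.\<close>
  define b where "b = max B (t - ln e / k)"
  have "- ln e / k \<le> b - t" by (simp add: b_def)
  then have "- k * (b - t) \<le> ln e" using k by (simp add: field_simps)
  then have "exp (- k * (b - t)) \<le> e" using e by (simp add: ln_ge_iff)
  then show "x \<le> y + e" using le[of b] by (simp add: b_def)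
qed

text \<open>Two rounds of comparison. Smallness gives the rough rate 9/4; this makes the potential
  itself decay exponentially, and an exponentially decaying perturbation of w'' = m^2 w keeps the
  exact rate m.\<close>

lemma decay_of_small:
  assumes s0: "1 \<le> s0" "9 * (kap + 1) * exp (- (2 * s0)) \<le> 1"
    and T: "s0 \<le> T" and small: "\<And>t. T \<le> t \<Longrightarrow> \<bar>w t\<bar> \<le> exp (- (m * s0))"
    and L: "0 \<le> L" "2 * (kap + 1) \<le> exp (9 / (2 * m) * L)"
    and t: "T + L \<le> t"
  shows "\<bar>w t\<bar> \<le> 2 * exp (m * (T + L)) * exp (- (m * t))"
proof -
  \<comment> \<open>The decay rate of the potential that \<open>q_small\<close> yields for the rough
    rate: 2/m times 9/4.\<close>
  define g where "g = 9 / (2 * m)"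
  define s where "s = T + L"
  define A where "A = exp (m * s)"
  have g: "0 < g" "2 * m * g = 9" using m_ge by (auto simp: g_def)
  have e1: "exp (- (m * s0)) \<le> 1" using s0 m_ge by simp
  have rough: "\<bar>w x\<bar> \<le> exp (- (9/4 * (x - T)))" if x: "T \<le> x" for x
  proof (rule le_of_le_add_exp_tail[of "9/4" x])
    fix b assume b: "x \<le> b"
    have "\<bar>w x\<bar> \<le> exp (- (m * s0)) * exp (- (9/4) * (x - T)) + exp (- (m * s0)) * exp (- (9/4) * (b - x))"
      using x b small by (intro decay_in_window s0 T) auto
    also have "\<dots> \<le> 1 * exp (- (9/4) * (x - T)) + 1 * exp (- (9/4) * (b - x))"
      using e1 by (intro add_mono mult_right_mono) auto
    finally show "\<bar>w x\<bar> \<le> exp (- (9/4 * (x - T))) + exp (- (9/4) * (b - x))" by simp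
  qed simp
  have q1: "q x \<le> 1" if "T \<le> x" for x
  proof -
    have "q x \<le> 9 * (kap + 1) * exp (- (2 * (m * s0) / m))"
      using s0 T that m_ge small by (intro q_small) auto
    then show ?thesis using s0 m_ge by simp
  qed
  have q2: "q x \<le> 9 * (kap + 1) * exp (- (g * (x - T)))" if "T \<le> x" for x
  proof -
    have "9/4 * (x - T) \<le> m * x"
      using that T s0 m_ge by (intro mult_mono) auto
    then have "q x \<le> 9 * (kap + 1) * exp (- (2 * (9/4 * (x - T)) / m))"
      using that T s0 by (intro q_small rough) auto
    moreover have "2 * (9/4 * (x - T)) / m = g * (x - T)" using m_ge by (simp add: g_def field_simps)
    ultimately show ?thesis by simp
  qed
  have m2: "(5/2)\<^sup>2 \<le> m\<^sup>2" using m_ge by (intro power_mono) auto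
  \<comment> \<open>The subtracted term of rate m + g produces the surplus (m+g)^2 - m^2 \<ge> 2 m g
    = 9 that pays for the potential; the shift \<open>L\<close> makes the potential small enough for
    it. From \<open>s\<close> on that term is at most e^(-m t), and \<open>A\<close> normalises the
    difference to 1 at \<open>s\<close>. The extra term of rate 9/4 covers the right end
    \<open>b\<close>.\<close>
  have "\<bar>w t\<bar> \<le> A * (2 * exp (- (m * t)) - exp (g * s) * exp (- ((m + g) * t)))"
  proof (rule le_of_le_add_exp_tail[of "9/4" t])
    fix b assume b: "t \<le> b"
    show "\<bar>w t\<bar> \<le> A * (2 * exp (- (m * t)) - exp (g * s) * exp (- ((m + g) * t))) + exp (- (9/4) * (b - t))"
    proof (rule supersolution_bound[where a = s and b = b and t = t
          and h = "\<lambda>t. A * (2 * exp (- (m * t)) - exp (g * s) * exp (- ((m + g) * t))) + exp (- (9/4) * (b - t))"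
          and ?h1.0 = "\<lambda>t. A * (- 2 * m * exp (- (m * t)) + (m + g) * exp (g * s) * exp (- ((m + g) * t)))
             + 9/4 * exp (- (9/4) * (b - t))"
          and ?h2.0 = "\<lambda>t. A * (2 * m\<^sup>2 * exp (- (m * t)) - (m + g)\<^sup>2 * exp (g * s) * exp (- ((m + g) * t)))
             + (9/4)\<^sup>2 * exp (- (9/4) * (b - t))"])
      show "1 \<le> s" "s \<le> b" "s \<le> t" "t \<le> b" using s0 T L t b by (auto simp: s_def)
      fix x assume x: "s \<le> x" "x \<le> b"
      then have Tx: "T \<le> x" using L by (simp add: s_def)
      show "q x < m\<^sup>2" using q1[OF Tx] m2 by (simp add: power2_eq_square)
      have E1: "((\<lambda>t. exp (- (m * t))) has_real_derivative - m * exp (- (m * x))) (at x)"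
        by (auto intro!: derivative_eq_intros)
      have E2: "((\<lambda>t. exp (- ((m + g) * t))) has_real_derivative - (m + g) * exp (- ((m + g) * x))) (at x)"
        by (auto intro!: derivative_eq_intros)
      have E3: "((\<lambda>t. exp (- (9/4) * (b - t))) has_real_derivative 9/4 * exp (- (9/4) * (b - x))) (at x)"
        by (auto intro!: derivative_eq_intros)
      show "((\<lambda>t. A * (2 * exp (- (m * t)) - exp (g * s) * exp (- ((m + g) * t))) + exp (- (9/4) * (b - t)))
        has_real_derivative A * (- 2 * m * exp (- (m * x)) + (m + g) * exp (g * s) * exp (- ((m + g) * x)))
             + 9/4 * exp (- (9/4) * (b - x))) (at x)"
        by (rule DERIV_cong[OF DERIV_add[OF DERIV_cmult[OF DERIV_diff[OF DERIV_cmult[OF E1] DERIV_cmult[OF E2]]] E3]])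
           (simp add: algebra_simps)
      show "((\<lambda>t. A * (- 2 * m * exp (- (m * t)) + (m + g) * exp (g * s) * exp (- ((m + g) * t)))
             + 9/4 * exp (- (9/4) * (b - t))) has_real_derivative
         A * (2 * m\<^sup>2 * exp (- (m * x)) - (m + g)\<^sup>2 * exp (g * s) * exp (- ((m + g) * x)))
             + (9/4)\<^sup>2 * exp (- (9/4) * (b - x))) (at x)"
        by (rule DERIV_cong[OF DERIV_add[OF DERIV_cmult[OF DERIV_add[OF DERIV_cmult[OF E1] DERIV_cmult[OF E2]]] DERIV_cmult[OF E3]]])
           (simp add: algebra_simps power2_eq_square)
      define X where "X = exp (- (m * x))"
      define Y where "Y = exp (g * s) * exp (- ((m + g) * x))"
      have Y: "Y = X * exp (- (g * (x - s)))" "0 < Y" "0 < X"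
        by (simp_all add: Y_def X_def exp_add[symmetric] algebra_simps)
      have "q x * (2 * X - Y) \<le> q x * (2 * X)" using Y q_nonneg by (intro mult_left_mono) auto
      also have "\<dots> \<le> 9 * (kap + 1) * exp (- (g * (x - T))) * (2 * X)"
        using q2[OF Tx] Y by (intro mult_right_mono) auto
      also have "\<dots> = 9 * (2 * (kap + 1) / exp (g * L)) * Y"
        unfolding Y(1) s_def by (simp add: exp_add exp_diff exp_minus field_simps)
      also have "\<dots> \<le> 9 * 1 * Y"
        using L Y by (intro mult_right_mono mult_left_mono) (auto simp: g_def)
      also have "\<dots> \<le> ((m + g)\<^sup>2 - m\<^sup>2) * Y"
        using g Y by (intro mult_right_mono) (auto simp: power2_eq_square algebra_simps)
      finally have XY: "2 * m\<^sup>2 * X - (m + g)\<^sup>2 * Y \<le> (m\<^sup>2 - q x) * (2 * X - Y)" by (simp add: algebra_simps)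
      have "A * (2 * m\<^sup>2 * X - (m + g)\<^sup>2 * Y) \<le> A * ((m\<^sup>2 - q x) * (2 * X - Y))"
        using XY by (intro mult_left_mono) (auto simp: A_def)
      moreover have "(9/4)\<^sup>2 * exp (- (9/4) * (b - x)) \<le> (m\<^sup>2 - q x) * exp (- (9/4) * (b - x))"
        using q1[OF Tx] m2 by (intro mult_right_mono) (auto simp: power2_eq_square)
      ultimately show "A * (2 * m\<^sup>2 * exp (- (m * x)) - (m + g)\<^sup>2 * exp (g * s) * exp (- ((m + g) * x)))
             + (9/4)\<^sup>2 * exp (- (9/4) * (b - x))
         \<le> (m\<^sup>2 - q x) * (A * (2 * exp (- (m * x)) - exp (g * s) * exp (- ((m + g) * x))) + exp (- (9/4) * (b - x)))"
        unfolding X_def Y_def by (simp add: algebra_simps)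
    next
      have "A * (2 * exp (- (m * s)) - exp (g * s) * exp (- ((m + g) * s))) = 1"
        by (simp add: A_def exp_add[symmetric] right_diff_distrib algebra_simps)
      moreover have "\<bar>w s\<bar> \<le> 1" using L by (intro order_trans[OF small e1]) (simp add: s_def)
      ultimately show "\<bar>w s\<bar> \<le> A * (2 * exp (- (m * s)) - exp (g * s) * exp (- ((m + g) * s))) + exp (- (9/4) * (b - s))"
        by (smt (verit) exp_gt_zero)
      have "exp (g * s) * exp (- ((m + g) * b)) \<le> 2 * exp (- (m * b))"
      proof -
        have "exp (g * s) * exp (- ((m + g) * b)) = exp (- (m * b)) * exp (- (g * (b - s)))"
          by (simp add: exp_add[symmetric] algebra_simps)
        also have "\<dots> \<le> exp (- (m * b)) * 2"
          using g t b by (intro mult_left_mono) (auto simp: s_def intro: order_trans[of _ 1])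
        finally show ?thesis by simp
      qed
      then have "0 \<le> A * (2 * exp (- (m * b)) - exp (g * s) * exp (- ((m + g) * b)))"
        by (simp add: A_def)
      moreover have "\<bar>w b\<bar> \<le> 1" using L t b by (intro order_trans[OF small e1]) simp
      ultimately show "\<bar>w b\<bar> \<le> A * (2 * exp (- (m * b)) - exp (g * s) * exp (- ((m + g) * b))) + exp (- (9/4) * (b - b))"
        by simp
    qed
  qed simp
  also have "\<dots> \<le> A * (2 * exp (- (m * t)))" by (intro mult_left_mono) (auto simp: A_def)
  finally show ?thesis by (simp add: A_def s_def)
qed

end

section \<open>Choice of constants independent of p and of the solution\<close>

theorem emden_fowler_uniform_decay:
  fixes m kap M :: real
  assumes m: "5/2 \<le> m" and kap: "0 < kap" and M: "0 \<le> M"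
  obtains s C where "1 \<le> s" "0 \<le> C"
    "\<And>p w w1 En t. emden_fowler m kap M p w w1 En \<Longrightarrow> s \<le> t \<Longrightarrow> \<bar>w t\<bar> \<le> C * exp (- (m * t))"
proof -
  \<comment> \<open>Chosen so that a solution below exp (- m s0) has potential at most 1 beyond
    \<open>s0\<close>.\<close>
  define s0 where "s0 = max 1 (ln (9 * (kap + 1)) / 2)"
  have s0: "1 \<le> s0" "9 * (kap + 1) * exp (- (2 * s0)) \<le> 1"
  proof -
    have "ln (9 * (kap + 1)) \<le> 2 * s0" by (simp add: s0_def)
    then have "exp (ln (9 * (kap + 1))) \<le> exp (2 * s0)" by simp
    then have "9 * (kap + 1) \<le> exp (2 * s0)" using kap by simp
    then show "9 * (kap + 1) * exp (- (2 * s0)) \<le> 1" by (simp add: exp_minus field_simps)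
  qed (simp add: s0_def)
  define e where "e = exp (- (m * s0))"
  define W where "W = 1 + (1 + m\<^sup>2 + kap + 1 + sqrt (2 * M)) * M"
  \<comment> \<open>6 is the window length required by \<open>first_return\<close>; adding 1 puts
    the return time strictly inside the next window.\<close>
  define D where "D = max 6 (4 * ln ((kap + 3) * (2 * exp (9/4))\<^sup>2 / (kap * e ^ 3 / (2 * W) * exp (- 1))) + 1)"
  define T where "T = rec_nat s0 (\<lambda>_ x. 9 * x + D)"
  have T: "T 0 = s0" "T (Suc i) = 9 * T i + D" for i by (auto simp: T_def)
  obtain n :: nat where n: "2 * M < real n * e\<^sup>2"
    using reals_Archimedean3[of "e\<^sup>2"] by (auto simp: e_def)
  have Ts: "s0 \<le> T i" for i by (induction i) (use T s0 in \<open>auto simp: D_def\<close>)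
  define L where "L = ln (2 * (kap + 1)) * (2 * m) / 9"
  have L: "0 \<le> L" "2 * (kap + 1) \<le> exp (9 / (2 * m) * L)"
    using kap m by (auto simp: L_def)
  have W1: "1 \<le> W" using M kap by (simp add: W_def)
  show ?thesis
  proof (rule that[of "T n + L" "2 * exp (m * (T n + L))"])
    show "1 \<le> T n + L" using Ts[of n] s0 L by simp
    fix p w w1 En t assume ef: "emden_fowler m kap M p w w1 En" and t: "T n + L \<le> t"
    interpret emden_fowler m kap M p w w1 En by (rule ef)
    have W2: "\<bar>w1 x\<bar> \<le> W" if "1 \<le> x" for x
    proof -
      have "\<bar>w1 x\<bar> \<le> 1 + (w1 x)\<^sup>2"
        using sum_squares_bound[of "\<bar>w1 x\<bar>" 1] by simp
      then show ?thesis using w1_sq_le[OF that] by (simp add: W_def)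
    qed
    have "\<bar>w x\<bar> \<le> exp (- (m * s0))" if "T n \<le> x" for x
      by (rule eventually_small[OF s0 W1 W2 _ _ T _ that]) (use n in \<open>auto simp: D_def e_def\<close>)
    then show "\<bar>w t\<bar> \<le> 2 * exp (m * (T n + L)) * exp (- (m * t))"
      by (intro decay_of_small[OF s0 Ts _ L t])
  qed simp
qed

section \<open>Radial solutions in the conformal coordinate\<close>

text \<open>In the coordinate t = - ln |x| the radial equation reads
  (sinh^{-2m} z')' = - sinh^{-2m-2} (\<lambda> z + |z|^{p-2} z) with 2m + 2 = N, and Ez is a primitive of
  the energy density.\<close>

locale radial_solution =
  fixes m lam M p :: real and z z1 Ez :: "real \<Rightarrow> real"
  assumes m_ge: "5/2 \<le> m" and lam_gt: "m * (m + 1) < lam"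
    and p_gt: "2 < p" and p_le: "p * m \<le> 2 * m + 2"
    and z_deriv: "\<And>t. 0 < t \<Longrightarrow> (z has_real_derivative z1 t) (at t)"
    and z1_deriv: "\<And>t. 0 < t \<Longrightarrow> ((\<lambda>t. sinh t powr (- (2 * m)) * z1 t) has_real_derivative
          - (sinh t powr (- (2 * m) - 2) * (lam * z t + \<bar>z t\<bar> powr (p - 2) * z t))) (at t)"
    and Ez_deriv: "\<And>t. 0 < t \<Longrightarrow> (Ez has_real_derivative
          sinh t powr (- (2 * m)) * (z1 t)\<^sup>2 + sinh t powr (- (2 * m) - 2) * (z t)\<^sup>2) (at t)"
    and Ez_le: "\<And>s t. 0 < s \<Longrightarrow> s \<le> t \<Longrightarrow> Ez t - Ez s \<le> M"
begin

text \<open>The square of \<open>S\<close> is the gradient part of the energy density; the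
  derivative of \<open>w\<close> differs from \<open>S\<close> by
  \<open>m * (cosh t / sinh t) * w t\<close>.\<close>

definition S :: "real \<Rightarrow> real" where "S t = sinh t powr (- m) * z1 t"

definition w :: "real \<Rightarrow> real" where "w t = sinh t powr (- m) * z t"

definition w1 :: "real \<Rightarrow> real" where "w1 t = S t - m * (cosh t / sinh t) * w t"

section \<open>Derivation of the Emden-Fowler equation\<close>

lemma w_deriv:
  assumes "0 < t"
  shows "(w has_real_derivative w1 t) (at t)"
proof -
  have s: "0 < sinh t" using assms by simp
  have a: "sinh t powr (- m - 1) = sinh t powr (- m) / sinh t"
    using s by (simp add: powr_diff)
  show ?thesis
    unfolding w_def w1_def S_def using s assms
    by (auto intro!: derivative_eq_intros z_deriv simp: a)
qed

text \<open>Differentiability is given only for the flux sinh^(-2m) z', so \<open>S\<close> is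
  rewritten as sinh^m times that flux.\<close>

lemma S_deriv:
  assumes "0 < t"
  shows "(S has_real_derivative m * (cosh t / sinh t) * S t
      - (lam / (sinh t)\<^sup>2 * w t + sinh t powr (- m - 2) * (\<bar>z t\<bar> powr (p - 2) * z t))) (at t)"
proof -
  have s: "0 < sinh t" using assms by simp
  have eq: "S t = sinh t powr m * (sinh t powr (- (2 * m)) * z1 t)" if "0 < t" for t
    using that unfolding S_def mult.assoc[symmetric] powr_add[symmetric] by simp
  have "((\<lambda>t. sinh t powr m * (sinh t powr (- (2 * m)) * z1 t)) has_real_derivative
      sinh t powr m * - (sinh t powr (- (2 * m) - 2) * (lam * z t + \<bar>z t\<bar> powr (p - 2) * z t))
      + (m * sinh t powr (m - 1) * cosh t) * (sinh t powr (- (2 * m)) * z1 t)) (at t)"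
    using s assms by (intro DERIV_mult' z1_deriv) (auto intro!: derivative_eq_intros)
  moreover have "sinh t powr m * sinh t powr (- (2 * m) - 2) = sinh t powr (- m - 2)"
    by (simp add: powr_add[symmetric])
  moreover have "sinh t powr (m - 1) * sinh t powr (- (2 * m)) = sinh t powr (- m) / sinh t"
    using s by (simp add: powr_add[symmetric] powr_diff powr_minus field_simps)
  moreover have "sinh t powr (- m - 2) * z t = w t / (sinh t)\<^sup>2"
    using s by (simp add: w_def powr_diff)
  ultimately have "((\<lambda>t. sinh t powr m * (sinh t powr (- (2 * m)) * z1 t)) has_real_derivative
     m * (cosh t / sinh t) * S t
      - (lam / (sinh t)\<^sup>2 * w t + sinh t powr (- m - 2) * (\<bar>z t\<bar> powr (p - 2) * z t))) (at t)"
    by (elim DERIV_cong) (simp add: S_def field_simps)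
  then show ?thesis
    by (rule has_field_derivative_transform_within_open[of _ _ _ "{0<..}"]) (use assms eq in auto)
qed

text \<open>With coth^2 = 1 + 1/sinh^2 the first-order terms turn into m^2 w plus m (m+1) w /
  sinh^2. This reduces \<open>lam\<close> to \<open>lam - m * (m + 1)\<close>, the excess over
  N(N-2)/4.\<close>

lemma w1_deriv:
  assumes "0 < t"
  shows "(w1 has_real_derivative (m\<^sup>2 - ef_potential m (lam - m * (m + 1)) p w t) * w t) (at t)"
proof -
  have s: "0 < sinh t" using assms by simp
  have c2: "(cosh t)\<^sup>2 = 1 + (sinh t)\<^sup>2" using hyperbolic_pythagoras[of t] by simp
  have coth: "((\<lambda>t. m * (cosh t / sinh t)) has_real_derivative - m / (sinh t)\<^sup>2) (at t)"
    using s c2 by (auto intro!: derivative_eq_intros simp: power2_eq_square field_simps)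
  have "(w1 has_real_derivative (m * (cosh t / sinh t) * S t
      - (lam / (sinh t)\<^sup>2 * w t + sinh t powr (- m - 2) * (\<bar>z t\<bar> powr (p - 2) * z t)))
      - (m * (cosh t / sinh t) * w1 t + - m / (sinh t)\<^sup>2 * w t)) (at t)"
    unfolding w1_def by (intro DERIV_diff S_deriv DERIV_mult' coth w_deriv[unfolded w1_def] assms)
  moreover have "sinh t powr (- m - 2) * (\<bar>z t\<bar> powr (p - 2) * z t)
      = \<bar>w t\<bar> powr (p - 2) * sinh t powr (- (2 * m + 2 - p * m)) * w t"
  proof -
    have "\<bar>w t\<bar> powr (p - 2) = (sinh t powr (- m)) powr (p - 2) * \<bar>z t\<bar> powr (p - 2)"
      by (simp add: w_def abs_mult powr_mult)
    then have "\<bar>w t\<bar> powr (p - 2) * sinh t powr (- (2 * m + 2 - p * m)) * w t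
       = (sinh t powr (- m * (p - 2)) * sinh t powr (- (2 * m + 2 - p * m)) * sinh t powr (- m))
          * (\<bar>z t\<bar> powr (p - 2) * z t)"
      by (simp add: w_def powr_powr mult_ac)
    also have "sinh t powr (- m * (p - 2)) * sinh t powr (- (2 * m + 2 - p * m)) * sinh t powr (- m)
        = sinh t powr (- m - 2)"
      by (simp add: powr_add[symmetric] algebra_simps)
    finally show ?thesis by simp
  qed
  moreover have "m * (cosh t / sinh t) * S t = m * (cosh t / sinh t) * w1 t + (m\<^sup>2 + m\<^sup>2 / (sinh t)\<^sup>2) * w t"
  proof -
    have "m * (cosh t / sinh t) * S t - m * (cosh t / sinh t) * w1 t = m\<^sup>2 * ((cosh t)\<^sup>2 / (sinh t)\<^sup>2) * w t"
      by (simp add: w1_def algebra_simps power2_eq_square)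
    moreover have "(cosh t)\<^sup>2 / (sinh t)\<^sup>2 = 1 / (sinh t)\<^sup>2 + 1" using s c2 by (simp add: field_simps)
    ultimately show ?thesis by (simp add: algebra_simps)
  qed
  ultimately show ?thesis
    by (elim DERIV_cong) (simp add: ef_potential_def power2_eq_square algebra_simps add_divide_distrib diff_divide_distrib)
qed

lemma density_eq:
  assumes "0 < t"
  shows "sinh t powr (- (2 * m)) * (z1 t)\<^sup>2 + sinh t powr (- (2 * m) - 2) * (z t)\<^sup>2
     = (S t)\<^sup>2 + (w t)\<^sup>2 / (sinh t)\<^sup>2"
proof -
  have s: "0 < sinh t" using assms by simp
  have "sinh t powr (- (2 * m)) = (sinh t powr (- m))\<^sup>2"
    using s by (simp add: powr_power)
  moreover have "sinh t powr (- (2 * m) - 2) = sinh t powr (- (2 * m)) / (sinh t)\<^sup>2"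
    using s by (simp add: powr_diff)
  ultimately show ?thesis by (simp add: S_def w_def power_mult_distrib)
qed

text \<open>The given energy controls w^2 only with the weight sinh^(-2), whereas here w^2 appears
  without weight; closing this gap is the task of Hardy's inequality.\<close>

lemma energy_density_le:
  assumes "1 \<le> t"
  shows "(w t)\<^sup>2 + (w1 t)\<^sup>2 \<le> 2 * (S t)\<^sup>2 + (1 + 4 * m\<^sup>2) * (w t)\<^sup>2"
proof -
  have s: "1 \<le> sinh t" using sinh_ge_one assms by simp
  have "(cosh t / sinh t)\<^sup>2 = 1 + 1 / (sinh t)\<^sup>2"
  proof -
    have "(cosh t)\<^sup>2 = (sinh t)\<^sup>2 + 1" using hyperbolic_pythagoras[of t] by simp
    moreover have "t \<noteq> 0" using assms by simp
    ultimately show ?thesis by (simp add: power_divide add_divide_distrib)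
  qed
  also have "\<dots> \<le> 2" using one_le_power[OF s, of 2] frac_le[of 1 1 1 "(sinh t)\<^sup>2"] by simp
  finally have "2 * (m\<^sup>2 * (cosh t / sinh t)\<^sup>2 * (w t)\<^sup>2) \<le> 2 * (m\<^sup>2 * 2 * (w t)\<^sup>2)"
    by (intro mult_left_mono mult_right_mono) auto
  moreover have "(w1 t)\<^sup>2 \<le> 2 * (S t)\<^sup>2 + 2 * (m * (cosh t / sinh t) * w t)\<^sup>2"
  proof -
    have "(x - y)\<^sup>2 \<le> 2 * x\<^sup>2 + 2 * y\<^sup>2" for x y :: real
      using zero_le_power2[of "x + y"] by (simp add: power2_eq_square algebra_simps)
    then show ?thesis unfolding w1_def by blast
  qed
  moreover have "(m * (cosh t / sinh t) * w t)\<^sup>2 = m\<^sup>2 * (cosh t / sinh t)\<^sup>2 * (w t)\<^sup>2"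
    by (simp only: power_mult_distrib)
  ultimately show ?thesis unfolding distrib_right by linarith
qed

text \<open>Hardy's inequality in differential form.\<close>

lemma w_sq_deriv_le:
  assumes "0 < t"
  shows "2 * w t * w1 t \<le> (S t)\<^sup>2 / m - m * (w t)\<^sup>2"
proof -
  have s: "0 < sinh t" using assms by simp
  define k where "k = cosh t / sinh t"
  have "1 \<le> k" using s sinh_le_cosh_real[of t] by (simp add: k_def)
  then have "m * 1 * (w t)\<^sup>2 \<le> m * k * (w t)\<^sup>2"
    using m_ge by (intro mult_right_mono mult_left_mono) auto
  moreover have "2 * w t * S t \<le> (S t)\<^sup>2 / m + m * (w t)\<^sup>2"
  proof -
    have "0 \<le> (S t - m * w t)\<^sup>2 / m" using m_ge by simp
    also have "\<dots> = (S t)\<^sup>2 / m + m * (w t)\<^sup>2 - 2 * w t * S t"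
      using m_ge by (simp add: power2_eq_square field_simps)
    finally show ?thesis by simp
  qed
  moreover have "2 * w t * w1 t = 2 * w t * S t - 2 * (m * k * (w t)\<^sup>2)"
    by (simp add: w1_def k_def power2_eq_square algebra_simps)
  ultimately show ?thesis by simp
qed

end

section \<open>Energy bounds for w and the bound near the boundary of the ball\<close>

lemma primitive_on_greaterThan:
  fixes f :: "real \<Rightarrow> real"
  assumes "continuous_on {a<..} f"
  obtains F where "\<And>t. a < t \<Longrightarrow> (F has_real_derivative f t) (at t)"
proof -
  \<comment> \<open>The base point lies inside the half line because \<open>f\<close> need not be
    integrable near \<open>a\<close>.\<close>
  define F where "F t = (if a + 1 \<le> t then integral {a + 1..t} f else - integral {t..a + 1} f)" for t
  have "(F has_real_derivative f t) (at t)" if t: "a < t" for t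
  proof -
    define c where "c = min (a + 1) ((a + t) / 2)"
    have c: "a < c" "c < t" "c \<le> a + 1" using t by (auto simp: c_def min_def field_simps)
    have sub: "{c..t + 1} \<subseteq> {a<..}" using c by auto
    have "((\<lambda>u. integral {c..u} f) has_real_derivative f t) (at t within {c..t + 1})"
      using c by (intro integral_has_real_derivative continuous_on_subset[OF assms sub]) auto
    then have "((\<lambda>u. integral {c..u} f) has_real_derivative f t) (at t)"
      using c by (simp add: at_within_Icc_at)
    then have d: "((\<lambda>u. integral {c..u} f - integral {c..a + 1} f) has_real_derivative f t) (at t)"
      by (auto intro!: derivative_eq_intros)
    show ?thesis
    proof (rule has_field_derivative_transform_within_open[OF d, of "{c<..}"])
      fix u assume u: "u \<in> {c<..}"
      have int: "f integrable_on {c..max u (a + 1)}"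
        using c by (intro integrable_continuous_real continuous_on_subset[OF assms]) auto
      show "integral {c..u} f - integral {c..a + 1} f = F u"
      proof (cases "a + 1 \<le> u")
        case True
        then show ?thesis using Henstock_Kurzweil_Integration.integral_combine[of c "a + 1" u f] int c
          by (simp add: F_def max_def split: if_splits)
      next
        case False
        then show ?thesis using Henstock_Kurzweil_Integration.integral_combine[of c u "a + 1" f] int c u
          by (simp add: F_def max_def)
      qed
    qed (use c in auto)
  qed
  then show ?thesis using that by blast
qed

text \<open>\<open>H\<close> is chosen with H m = 1 + 4 m^2, so subtracting H w^2 lets Hardy's
  inequality absorb the unweighted w^2 of \<open>energy_density_le\<close>. The price is the
  boundary term H w(1)^2, estimated on [1,2].\<close>

lemma (in radial_solution) emden_fowler_energy:
  defines "H \<equiv> (1 + 4 * m\<^sup>2) / m"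
  defines "M' \<equiv> (2 + H / m) * M + H * (2 * (2 + (1 + 4 * m\<^sup>2) * (sinh 2)\<^sup>2) * M)"
  shows "\<exists>En. emden_fowler m (lam - m * (m + 1)) M' p w w1 En"
proof -
  have H: "0 \<le> H" using m_ge by (simp add: H_def)
  have "continuous_on {0<..} w1"
    by (rule DERIV_continuous_on, rule has_field_derivative_at_within, rule w1_deriv) simp
  moreover have "continuous_on {0<..} w"
    by (rule DERIV_continuous_on, rule has_field_derivative_at_within, rule w_deriv) simp
  ultimately have "continuous_on {0<..} (\<lambda>t. (w t)\<^sup>2 + (w1 t)\<^sup>2)" by (intro continuous_intros)
  then obtain En where En: "\<And>t. 0 < t \<Longrightarrow> (En has_real_derivative (w t)\<^sup>2 + (w1 t)\<^sup>2) (at t)"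
    using primitive_on_greaterThan by blast
  define B where "B = 2 * (2 + (1 + 4 * m\<^sup>2) * (sinh 2)\<^sup>2) * M"
  \<comment> \<open>On [1,2] the factor sinh^2 is bounded, so the weighted energy controls the
    unweighted one directly.\<close>
  have En2: "En 2 - En 1 \<le> B / 2"
  proof -
    define c where "c = 2 + (1 + 4 * m\<^sup>2) * (sinh (2::real))\<^sup>2"
    have "c * Ez 1 - En 1 \<le> c * Ez 2 - En 2"
    proof (rule DERIV_nonneg_imp_nondecreasing[where f = "\<lambda>t. c * Ez t - En t"])
      fix x :: real assume x: "1 \<le> x" "x \<le> 2"
      then have x0: "0 < x" by simp
      have s: "0 < sinh x" using x0 by simp
      define Y where "Y = (w x)\<^sup>2 / (sinh x)\<^sup>2"
      define k where "k = (1 + 4 * m\<^sup>2) * (sinh (2::real))\<^sup>2"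
      have Y: "0 \<le> Y" "0 \<le> k" by (auto simp: Y_def k_def)
      have "(w x)\<^sup>2 = (sinh x)\<^sup>2 * Y" using s by (simp add: Y_def)
      also have "\<dots> \<le> (sinh 2)\<^sup>2 * Y"
        using x s Y by (intro mult_right_mono power_mono) auto
      finally have "(1 + 4 * m\<^sup>2) * (w x)\<^sup>2 \<le> (1 + 4 * m\<^sup>2) * ((sinh 2)\<^sup>2 * Y)"
        by (intro mult_left_mono) auto
      then have "(w x)\<^sup>2 + (w1 x)\<^sup>2 \<le> 2 * (S x)\<^sup>2 + k * Y"
        using energy_density_le[OF x(1)] by (simp add: k_def mult.assoc)
      also have "\<dots> \<le> c * ((S x)\<^sup>2 + Y)"
      proof -
        have "c = 2 + k" by (simp add: c_def k_def)
        moreover have "0 \<le> k * (S x)\<^sup>2" using Y by simp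
        ultimately show ?thesis using Y by (simp add: distrib_left distrib_right)
      qed
      finally have "0 \<le> c * ((S x)\<^sup>2 + (w x)\<^sup>2 / (sinh x)\<^sup>2) - ((w x)\<^sup>2 + (w1 x)\<^sup>2)"
        by (simp add: Y_def)
      moreover have "((\<lambda>t. c * Ez t - En t) has_real_derivative
          c * ((S x)\<^sup>2 + (w x)\<^sup>2 / (sinh x)\<^sup>2) - ((w x)\<^sup>2 + (w1 x)\<^sup>2)) (at x)"
        using Ez_deriv[OF x0] En[OF x0] unfolding density_eq[OF x0] by (intro DERIV_diff DERIV_cmult)
      ultimately show "\<exists>y. ((\<lambda>t. c * Ez t - En t) has_real_derivative y) (at x) \<and> 0 \<le> y" by blast
    qed simp
    then have "En 2 - En 1 \<le> c * (Ez 2 - Ez 1)" by (simp add: algebra_simps)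
    also have "\<dots> \<le> c * M" using Ez_le[of 1 2] by (intro mult_left_mono) (auto simp: c_def)
    also have "\<dots> = B / 2" by (simp add: B_def c_def)
    finally show ?thesis .
  qed
  have w_one: "(w 1)\<^sup>2 \<le> B"
  proof -
    have "\<exists>s>1. s < 2 \<and> En 2 - En 1 = (2 - 1) * ((w s)\<^sup>2 + (w1 s)\<^sup>2)"
      by (rule MVT2) (auto intro!: En)
    then obtain s where s: "1 < s" "s < 2" "En 2 - En 1 = (w s)\<^sup>2 + (w1 s)\<^sup>2" by auto
    have "(w 1)\<^sup>2 + En 1 \<le> (w s)\<^sup>2 + En s"
    proof (rule DERIV_nonneg_imp_nondecreasing[where f = "\<lambda>t. (w t)\<^sup>2 + En t"])
      fix x :: real assume "1 \<le> x"
      then have "((\<lambda>x. (w x)\<^sup>2 + En x) has_real_derivative (w x + w1 x)\<^sup>2) (at x)"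
        by (auto intro!: derivative_eq_intros w_deriv En simp: power2_eq_square algebra_simps)
      then show "\<exists>y. ((\<lambda>x. (w x)\<^sup>2 + En x) has_real_derivative y) (at x) \<and> 0 \<le> y"
        by (intro exI conjI) auto
    qed (use s in simp)
    moreover have "En s \<le> En 2"
      by (rule DERIV_nonneg_imp_nondecreasing)
         (use s in \<open>auto intro!: exI[of _ "(w x)\<^sup>2 + (w1 x)\<^sup>2" for x] En\<close>)
    ultimately show ?thesis using En2 s(3) by (smt (verit) field_sum_of_halves zero_le_power2)
  qed
  have "En t - En 1 \<le> M'" if t: "1 \<le> t" for t
  proof -
    \<comment> \<open>The coefficient \<open>H / m\<close> of \<open>Ez\<close> pays for the S^2 / m
      that Hardy's inequality leaves over.\<close>
    have "(2 + H / m) * Ez 1 - En 1 - H * (w 1)\<^sup>2 \<le> (2 + H / m) * Ez t - En t - H * (w t)\<^sup>2"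
    proof (rule DERIV_nonneg_imp_nondecreasing[where f = "\<lambda>t. (2 + H / m) * Ez t - En t - H * (w t)\<^sup>2"])
      fix x :: real assume x: "1 \<le> x"
      then have x0: "0 < x" by simp
      have d: "((\<lambda>t. (2 + H / m) * Ez t - En t - H * (w t)\<^sup>2) has_real_derivative
         (2 + H / m) * ((S x)\<^sup>2 + (w x)\<^sup>2 / (sinh x)\<^sup>2) - ((w x)\<^sup>2 + (w1 x)\<^sup>2) - H * (2 * w x * w1 x)) (at x)"
        using Ez_deriv[OF x0] En[OF x0] w_deriv[OF x0] unfolding density_eq[OF x0]
        by (auto intro!: derivative_eq_intros)
      have "H * (2 * w x * w1 x) \<le> H * ((S x)\<^sup>2 / m - m * (w x)\<^sup>2)"
        using H w_sq_deriv_le[OF x0] by (intro mult_left_mono)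
      moreover have "H * (m * (w x)\<^sup>2) = (1 + 4 * m\<^sup>2) * (w x)\<^sup>2" using m_ge by (simp add: H_def)
      moreover have "0 \<le> (2 + H / m) * ((w x)\<^sup>2 / (sinh x)\<^sup>2)" using H m_ge by simp
      ultimately have "0 \<le> (2 + H / m) * ((S x)\<^sup>2 + (w x)\<^sup>2 / (sinh x)\<^sup>2) - ((w x)\<^sup>2 + (w1 x)\<^sup>2) - H * (2 * w x * w1 x)"
        using energy_density_le[OF x] by (simp add: algebra_simps)
      with d show "\<exists>y. ((\<lambda>t. (2 + H / m) * Ez t - En t - H * (w t)\<^sup>2) has_real_derivative y) (at x) \<and> 0 \<le> y"
        by blast
    qed (use t in simp)
    then have "En t - En 1 \<le> (2 + H / m) * (Ez t - Ez 1) + H * (w 1)\<^sup>2 - H * (w t)\<^sup>2"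
      by (simp add: algebra_simps)
    also have "\<dots> \<le> (2 + H / m) * M + H * B - 0"
      using H m_ge t Ez_le[of 1 t] w_one by (intro diff_mono add_mono mult_left_mono) auto
    finally show ?thesis by (simp add: M'_def B_def)
  qed
  then show ?thesis
    by (intro exI[of _ En], unfold_locales)
       (use m_ge lam_gt p_gt p_le in \<open>auto intro!: w_deriv w1_deriv En\<close>)
qed

text \<open>Strauss' radial lemma: sinh^{-2m-1} z^2 has variation controlled by the energy.\<close>

lemma (in radial_solution) radial_bound:
  assumes t: "0 < t" "t \<le> T"
  shows "(z t)\<^sup>2 \<le> (1 + (2 * m + 1) * cosh (T + 1) + sinh (T + 1)) * M * sinh t powr (2 * m + 1)"
proof -
  define c where "c = 1 + (2 * m + 1) * cosh (T + 1)"
  have c0: "0 \<le> c" using m_ge by (simp add: c_def)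
  have T: "0 < T" using t by simp
  \<comment> \<open>A reference point at which the energy density, and with it z, is
    controlled.\<close>
  have "\<exists>s>T. s < T + 1 \<and> Ez (T + 1) - Ez T = (T + 1 - T) *
      (sinh s powr (- (2 * m)) * (z1 s)\<^sup>2 + sinh s powr (- (2 * m) - 2) * (z s)\<^sup>2)"
    using T by (intro MVT2 Ez_deriv) auto
  then obtain s where s: "T < s" "s < T + 1" and Es: "Ez (T + 1) - Ez T =
      sinh s powr (- (2 * m)) * (z1 s)\<^sup>2 + sinh s powr (- (2 * m) - 2) * (z s)\<^sup>2" by auto
  \<comment> \<open>If a^2 and b^2 denote the two parts of the energy density, then V' = -(2m+1)
    cosh b^2 + 2 a b, so a multiple \<open>c\<close> of \<open>Ez\<close> dominates V' on the
    interval.\<close>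
  define V where "V t = sinh t powr (- (2 * m + 1)) * (z t)\<^sup>2" for t
  have "V t + c * Ez t \<le> V s + c * Ez s"
  proof (rule DERIV_nonneg_imp_nondecreasing[where f = "\<lambda>t. V t + c * Ez t"])
    fix x assume x: "t \<le> x" "x \<le> s"
    then have x0: "0 < x" using t by simp
    have sx: "0 < sinh x" using x0 by simp
    define a where "a = sinh x powr (- m) * z1 x"
    define b where "b = sinh x powr (- m - 1) * z x"
    have e1: "sinh x powr (- (2 * m)) * (z1 x)\<^sup>2 = a\<^sup>2"
      using sx by (simp add: a_def power_mult_distrib powr_power)
    have e2: "sinh x powr (- (2 * m) - 2) * (z x)\<^sup>2 = b\<^sup>2"
      using sx by (simp add: b_def power_mult_distrib powr_power algebra_simps)
    have e3: "sinh x powr (- (2 * m + 1)) * (z x * z1 x) = a * b"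
    proof -
      have "sinh x powr (- m) * sinh x powr (- m - 1) = sinh x powr (- (2 * m + 1))"
        by (simp add: powr_add[symmetric])
      then show ?thesis by (simp add: a_def b_def mult_ac)
    qed
    have "(V has_real_derivative - (2 * m + 1) * sinh x powr (- (2 * m + 1) - 1) * cosh x * (z x)\<^sup>2
       + sinh x powr (- (2 * m + 1)) * (2 * z x * z1 x)) (at x)"
      unfolding V_def using sx x0 by (auto intro!: derivative_eq_intros z_deriv)
    moreover have "- (2 * m + 1) - 1 = - (2 * m) - (2::real)" by simp
    ultimately have "(V has_real_derivative - (2 * m + 1) * cosh x * b\<^sup>2 + 2 * (a * b)) (at x)"
      unfolding e2[symmetric] e3[symmetric] by (elim DERIV_cong) (simp only: mult_ac)
    then have d: "((\<lambda>t. V t + c * Ez t) has_real_derivative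
        - (2 * m + 1) * cosh x * b\<^sup>2 + 2 * (a * b) + c * (a\<^sup>2 + b\<^sup>2)) (at x)"
      using Ez_deriv[OF x0] unfolding e1 e2 by (intro DERIV_add DERIV_cmult)
    have "(2 * m + 1) * cosh x * b\<^sup>2 \<le> (2 * m + 1) * cosh (T + 1) * b\<^sup>2"
      using x s x0 m_ge by (intro mult_right_mono mult_left_mono) (auto simp: cosh_real_nonneg_le_iff)
    moreover have "0 \<le> (2 * m + 1) * cosh (T + 1) * a\<^sup>2" using m_ge by simp
    moreover have "0 \<le> (a + b)\<^sup>2" by simp
    ultimately have "0 \<le> - (2 * m + 1) * cosh x * b\<^sup>2 + 2 * (a * b) + c * (a\<^sup>2 + b\<^sup>2)"
      by (simp add: c_def power2_sum algebra_simps)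
    with d show "\<exists>y. ((\<lambda>t. V t + c * Ez t) has_real_derivative y) (at x) \<and> 0 \<le> y" by blast
  qed (use s t in simp)
  then have "V t \<le> V s + c * (Ez s - Ez t)" by (simp add: algebra_simps)
  also have "\<dots> \<le> sinh (T + 1) * M + c * M"
  proof (intro add_mono mult_left_mono c0)
    have ss: "0 < sinh s" using s T by simp
    have "V s = sinh s * (sinh s powr (- (2 * m) - 2) * (z s)\<^sup>2)"
    proof -
      have "sinh s powr (- (2 * m + 1)) = sinh s powr 1 * sinh s powr (- (2 * m) - 2)"
        unfolding powr_add[symmetric] by (rule arg_cong) simp
      then show ?thesis using ss by (simp add: V_def)
    qed
    also have "\<dots> \<le> sinh (T + 1) * M"
    proof (intro mult_mono)
      show "sinh s powr (- (2 * m) - 2) * (z s)\<^sup>2 \<le> M"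
        using Es Ez_le[of T "T + 1"] T
        by (smt (verit) mult_nonneg_nonneg powr_ge_zero zero_le_power2)
    qed (use s T ss in auto)
    finally show "V s \<le> sinh (T + 1) * M" .
    show "Ez s - Ez t \<le> M" using Ez_le s t by simp
  qed
  finally have "V t \<le> (1 + (2 * m + 1) * cosh (T + 1) + sinh (T + 1)) * M"
    by (simp add: c_def algebra_simps)
  then have "V t * sinh t powr (2 * m + 1)
     \<le> (1 + (2 * m + 1) * cosh (T + 1) + sinh (T + 1)) * M * sinh t powr (2 * m + 1)"
    by (intro mult_right_mono) auto
  moreover have "V t * sinh t powr (2 * m + 1) = (z t)\<^sup>2"
  proof -
    have "sinh t powr (- (2 * m + 1)) * sinh t powr (2 * m + 1) = 1"
      using t by (simp add: powr_add[symmetric])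
    then show ?thesis by (simp add: V_def mult_ac)
  qed
  ultimately show ?thesis by simp
qed

text \<open>For t = - ln |x| the factor \<open>1 - exp (- (2 * t))\<close> is 1 - |x|^2, and m + 1/2
  = (N-1)/2. For t up to \<open>s\<close>, near the boundary, \<open>radial_bound\<close> suffices;
  beyond \<open>s\<close> the decay of w bounds z, while the factor is at least 1/2.\<close>

theorem radial_solution_uniform_bound:
  fixes m lam M :: real
  assumes m: "5/2 \<le> m" and lam: "m * (m + 1) < lam" and M: "0 \<le> M"
  obtains C where "\<And>p z z1 Ez t. radial_solution m lam M p z z1 Ez \<Longrightarrow> 0 < t \<Longrightarrow>
    \<bar>z t\<bar> \<le> C * (1 - exp (- (2 * t))) powr (m + 1/2)"
proof -
  define H where "H = (1 + 4 * m\<^sup>2) / m"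
  define M' where "M' = (2 + H / m) * M + H * (2 * (2 + (1 + 4 * m\<^sup>2) * (sinh 2)\<^sup>2) * M)"
  have "0 \<le> H" using m by (simp add: H_def)
  then have "0 \<le> M'" unfolding M'_def using M m
    by (intro add_nonneg_nonneg mult_nonneg_nonneg divide_nonneg_nonneg) auto
  then obtain s C where s: "1 \<le> s" and C: "0 \<le> C" and
    dec: "\<And>p w w1 En t. emden_fowler m (lam - m * (m + 1)) M' p w w1 En \<Longrightarrow> s \<le> t \<Longrightarrow> \<bar>w t\<bar> \<le> C * exp (- (m * t))"
    using emden_fowler_uniform_decay[of m "lam - m * (m + 1)" M'] m lam by auto
  define K where "K = (1 + (2 * m + 1) * cosh (s + 1) + sinh (s + 1)) * M"
  have K: "0 \<le> K" using m M s by (auto simp: K_def intro!: mult_nonneg_nonneg add_nonneg_nonneg)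
  define C1 where "C1 = sqrt K * exp s powr (m + 1/2)"
  define C2 where "C2 = C * 2 powr (m + 1/2)"
  have C12: "0 \<le> C1" "0 \<le> C2" using K C by (auto simp: C1_def C2_def)
  show ?thesis
  proof (rule that[of "C1 + C2"])
    fix p z z1 Ez and t :: real
    assume rs: "radial_solution m lam M p z z1 Ez" and t: "0 < t"
    interpret radial_solution m lam M p z z1 Ez by (rule rs)
    define r where "r = 1 - exp (- (2 * t))"
    have r: "0 < r" using t by (simp add: r_def)
    \<comment> \<open>Since r = 1 - |x|^2, powers of sinh become powers of r up to exponentials that
      are bounded for t \<le> s.\<close>
    have sinh: "sinh t = exp t * r / 2"
    proof -
      have "exp (- t) = exp t * exp (- (2 * t))" by (simp flip: exp_add)
      then show ?thesis by (simp add: sinh_def r_def algebra_simps)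
    qed
    show "\<bar>z t\<bar> \<le> (C1 + C2) * (1 - exp (- (2 * t))) powr (m + 1/2)"
    proof (cases "t \<le> s")
      case True
      have "(z t)\<^sup>2 \<le> K * sinh t powr (2 * m + 1)"
        using radial_bound[OF t True] by (simp add: K_def)
      also have "\<dots> \<le> K * (exp s * r) powr (2 * m + 1)"
      proof (intro mult_left_mono powr_mono2 K)
        have "exp t * r \<le> exp s * r" using True r by simp
        moreover have "0 < exp t * r" using r by simp
        ultimately show "sinh t \<le> exp s * r" unfolding sinh by linarith
      qed (use m t in auto)
      also have "(exp s * r) powr (2 * m + 1) = (exp s powr (m + 1/2) * r powr (m + 1/2))\<^sup>2"
        using r by (simp add: powr_mult[symmetric] powr_power algebra_simps)
      finally have "\<bar>z t\<bar> \<le> sqrt (K * (exp s powr (m + 1/2) * r powr (m + 1/2))\<^sup>2)"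
        using real_le_rsqrt[of "\<bar>z t\<bar>"] by simp
      also have "\<dots> = C1 * r powr (m + 1/2)" by (simp add: real_sqrt_mult C1_def)
      also have "\<dots> \<le> (C1 + C2) * r powr (m + 1/2)" using C12 by (intro mult_right_mono) auto
      finally show ?thesis by (simp add: r_def)
    next
      case False
      obtain En where "emden_fowler m (lam - m * (m + 1)) M' p w w1 En"
        using emden_fowler_energy by (auto simp: M'_def H_def)
      then have "\<bar>w t\<bar> \<le> C * exp (- (m * t))" using False by (intro dec) auto
      moreover have "\<bar>z t\<bar> = sinh t powr m * \<bar>w t\<bar>"
        using t by (simp add: w_def abs_mult powr_minus)
      ultimately have "\<bar>z t\<bar> \<le> sinh t powr m * (C * exp (- (m * t)))"
        by (simp add: mult_left_mono)
      also have "\<dots> \<le> exp t powr m * (C * exp (- (m * t)))"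
      proof (intro mult_right_mono powr_mono2)
        have "exp (- t) > 0" "exp t > 0" by simp_all
        then show "sinh t \<le> exp t" unfolding sinh_def by (simp add: field_simps)
      qed (use t m C in auto)
      also have "\<dots> = C" by (simp add: powr_def exp_minus)
      also have "\<dots> \<le> C * (2 * r) powr (m + 1/2)"
      proof -
        have "exp (- (2 * t)) \<le> exp (- 1)" using False s by simp
        also have "\<dots> \<le> (1/2::real)" using exp_ge_add_one_self[of "1::real"] by (simp add: exp_minus field_simps)
        finally have "1 \<le> 2 * r" by (simp add: r_def)
        then have "1 \<le> (2 * r) powr (m + 1/2)" using m by (intro ge_one_powr_ge_zero) auto
        then show ?thesis using C by (simp add: mult_le_cancel_left1)
      qed
      also have "\<dots> = C2 * r powr (m + 1/2)" using r by (simp add: powr_mult C2_def)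
      also have "\<dots> \<le> (C1 + C2) * r powr (m + 1/2)" using C12 by (intro mult_right_mono) auto
      finally show ?thesis by (simp add: r_def)
    qed
  qed
qed

section \<open>Smooth functions and weak equations on an interval\<close>

text \<open>Level 0 asks nothing because differentiability at the next level already gives
  continuity. The derivative is quantified, so any formula for it may be exhibited.\<close>

primrec diff_k :: "nat \<Rightarrow> (real \<Rightarrow> real) \<Rightarrow> bool" where
  "diff_k 0 f \<longleftrightarrow> True"
| "diff_k (Suc k) f \<longleftrightarrow> (\<exists>f'. (\<forall>t. (f has_real_derivative f' t) (at t)) \<and> diff_k k f')"

definition smooth1 :: "(real \<Rightarrow> real) \<Rightarrow> bool" where
  "smooth1 f \<longleftrightarrow> (\<forall>k. diff_k k f)"

lemma diff_k_SucI:
  "(\<And>t. (f has_real_derivative f' t) (at t)) \<Longrightarrow> diff_k k f' \<Longrightarrow> diff_k (Suc k) f"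
  by auto

lemma diff_k_Suc_imp: "diff_k (Suc k) f \<Longrightarrow> diff_k k f"
proof (induction k arbitrary: f)
  case (Suc k)
  then obtain f' where "\<And>t. (f has_real_derivative f' t) (at t)" "diff_k (Suc k) f'" by auto
  then show ?case using Suc.IH[of f'] by auto
qed simp

text \<open>Joint induction, since the derivative of a product is a sum of products.\<close>

lemma diff_k_mult: "diff_k k f \<Longrightarrow> diff_k k g \<Longrightarrow> diff_k k (\<lambda>t. f t * g t)"
  and diff_k_add: "diff_k k f \<Longrightarrow> diff_k k g \<Longrightarrow> diff_k k (\<lambda>t. f t + g t)"
proof (induction k arbitrary: f g)
  case (Suc k)
  { case 1
    then obtain f' g' where d: "\<And>t. (f has_real_derivative f' t) (at t)" "\<And>t. (g has_real_derivative g' t) (at t)"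
      and k: "diff_k k f'" "diff_k k g'" by auto
    show ?case
    proof (rule diff_k_SucI)
      show "((\<lambda>t. f t * g t) has_real_derivative f t * g' t + f' t * g t) (at t)" for t
        by (intro DERIV_mult' d)
      show "diff_k k (\<lambda>t. f t * g' t + f' t * g t)"
        by (rule Suc.IH(2)[OF Suc.IH(1)[OF diff_k_Suc_imp[OF 1(1)] k(2)] Suc.IH(1)[OF k(1) diff_k_Suc_imp[OF 1(2)]]])
    qed }
  { case 2
    then obtain f' g' where d: "\<And>t. (f has_real_derivative f' t) (at t)" "\<And>t. (g has_real_derivative g' t) (at t)"
      and k: "diff_k k f'" "diff_k k g'" by auto
    show ?case
      by (rule diff_k_SucI[OF DERIV_add[OF d] Suc.IH(2)[OF k]]) }
qed auto

lemma diff_k_const: "diff_k k (\<lambda>t. c)"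
  by (induction k arbitrary: c) (auto intro!: exI[of _ "\<lambda>t. 0"] derivative_eq_intros)

lemma diff_k_affine: "diff_k k f \<Longrightarrow> diff_k k (\<lambda>t. f (a * t + b))"
proof (induction k arbitrary: f)
  case (Suc k)
  then obtain f' where d: "\<And>t. (f has_real_derivative f' t) (at t)" and k: "diff_k k f'" by auto
  show ?case
  proof (rule diff_k_SucI)
    show "((\<lambda>t. f (a * t + b)) has_real_derivative f' (a * t + b) * a) (at t)" for t
      by (rule DERIV_chain2[OF d]) (auto intro!: derivative_eq_intros)
    show "diff_k k (\<lambda>t. f' (a * t + b) * a)"
      by (intro diff_k_mult diff_k_const Suc.IH k)
  qed
qed simp

lemma smooth1_mult: "smooth1 f \<Longrightarrow> smooth1 g \<Longrightarrow> smooth1 (\<lambda>t. f t * g t)"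
  and smooth1_add: "smooth1 f \<Longrightarrow> smooth1 g \<Longrightarrow> smooth1 (\<lambda>t. f t + g t)"
  and smooth1_const: "smooth1 (\<lambda>t. c)"
  and smooth1_affine: "smooth1 f \<Longrightarrow> smooth1 (\<lambda>t. f (a * t + b))"
  by (auto simp: smooth1_def intro!: diff_k_mult diff_k_add diff_k_const diff_k_affine)

lemma smooth1_has_derivative: "smooth1 f \<Longrightarrow> (f has_real_derivative deriv f t) (at t)"
  unfolding smooth1_def by (metis DERIV_imp_deriv diff_k.simps(2))

lemma smooth1_deriv: "smooth1 f \<Longrightarrow> smooth1 (deriv f)"
proof -
  assume f: "smooth1 f"
  show "smooth1 (deriv f)" unfolding smooth1_def
  proof
    fix k
    have "diff_k (Suc k) f" using f by (simp add: smooth1_def)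
    then obtain f' where d: "\<And>t. (f has_real_derivative f' t) (at t)" and k: "diff_k k f'" by auto
    have "f' = deriv f" using DERIV_imp_deriv[OF d] by auto
    then show "diff_k k (deriv f)" using k by simp
  qed
qed

lemma smooth1_I_deriv:
  assumes "\<And>t. (f has_real_derivative f' t) (at t)" "smooth1 f'"
  shows "smooth1 f"
  unfolding smooth1_def
proof
  fix k show "diff_k k f"
    using assms by (cases k) (auto simp: smooth1_def)
qed

lemma smooth1_continuous_on: "smooth1 f \<Longrightarrow> continuous_on S f"
  by (meson DERIV_isCont continuous_at_imp_continuous_on smooth1_has_derivative)

section \<open>Smooth cutoff and bump functions\<close>

lemma poly_exp_minus_tendsto_0:
  fixes p :: "real poly"
  shows "((\<lambda>x. poly p x * exp (- x)) \<longlongrightarrow> 0) at_top"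
proof -
  have "((\<lambda>x. \<Sum>i\<le>degree p. coeff p i * (x ^ i / exp x)) \<longlongrightarrow> (\<Sum>i\<le>degree p. coeff p i * 0)) at_top"
    by (intro tendsto_sum tendsto_mult tendsto_const tendsto_power_div_exp_0)
  moreover have "(\<Sum>i\<le>degree p. coeff p i * (x ^ i / exp x)) = poly p x * exp (- x)" for x
    by (simp add: poly_altdef sum_distrib_right exp_minus divide_inverse mult.assoc)
  ultimately show ?thesis by simp
qed

text \<open>The functions p(1/x) e^(-1/x), extended by 0, are closed under differentiation: the new
  polynomial is X^2 (p - p'). Smoothness of the cutoff then follows by induction on the
  order.\<close>

lemma poly_exp_inverse_has_derivative:
  fixes p :: "real poly"
  defines "f \<equiv> \<lambda>p x. if 0 < x then poly p (1 / x) * exp (- 1 / x) else (0::real)"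
  shows "(f p has_real_derivative f ([:0, 0, 1:] * (p - pderiv p)) x) (at x)"
proof -
  consider "x > 0" | "x < 0" | "x = 0" by linarith
  then show ?thesis
  proof cases
    case 1
    have "((\<lambda>x. poly p (1 / x) * exp (- 1 / x)) has_real_derivative
       poly (pderiv p) (1 / x) * (- 1 / x\<^sup>2) * exp (- 1 / x) + poly p (1 / x) * (exp (- 1 / x) * (1 / x\<^sup>2))) (at x)"
      using 1 by (auto intro!: derivative_eq_intros simp: power2_eq_square)
    then have "((\<lambda>x. poly p (1 / x) * exp (- 1 / x)) has_real_derivative f ([:0, 0, 1:] * (p - pderiv p)) x) (at x)"
      by (rule DERIV_cong) (use 1 in \<open>simp add: f_def power2_eq_square field_simps\<close>)
    then show ?thesis
      by (rule has_field_derivative_transform_within_open[of _ _ _ "{0<..}"]) (use 1 in \<open>auto simp: f_def\<close>)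
  next
    case 2
    have "((\<lambda>x. 0) has_real_derivative f ([:0, 0, 1:] * (p - pderiv p)) x) (at x)"
      using 2 by (simp add: f_def)
    then show ?thesis
      by (rule has_field_derivative_transform_within_open[of _ _ _ "{..<0}"]) (use 2 in \<open>auto simp: f_def\<close>)
  next
    case 3
    have "((\<lambda>h. f p h / h) \<longlongrightarrow> 0) (at 0)"
    proof (rule filterlim_split_at)
      show "((\<lambda>h. f p h / h) \<longlongrightarrow> 0) (at_left 0)"
        by (rule tendsto_eventually) (auto simp: f_def eventually_at_filter)
      have "((\<lambda>h. poly ([:0, 1:] * p) (inverse h) * exp (- inverse h)) \<longlongrightarrow> 0) (at_right (0::real))"
        by (rule filterlim_compose[OF poly_exp_minus_tendsto_0 filterlim_inverse_at_top_right])
      moreover have "\<forall>\<^sub>F h in at_right 0. poly ([:0, 1:] * p) (inverse h) * exp (- inverse h) = f p h / h"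
        by (auto simp: eventually_at_filter f_def field_simps inverse_eq_divide)
      ultimately show "((\<lambda>h. f p h / h) \<longlongrightarrow> 0) (at_right 0)"
        by (simp cong: filterlim_cong add: tendsto_cong)
    qed
    then show ?thesis using 3 by (simp add: DERIV_def) (simp add: f_def)
  qed
qed

definition cutoff :: "real \<Rightarrow> real" where
  "cutoff x = (if 0 < x then exp (- 1 / x) else 0)"

lemma smooth1_cutoff: "smooth1 cutoff"
proof -
  have "diff_k k (\<lambda>x. if 0 < x then poly p (1 / x) * exp (- 1 / x) else 0)" for k and p :: "real poly"
  proof (induction k arbitrary: p)
    case (Suc k)
    show ?case by (rule diff_k_SucI[OF poly_exp_inverse_has_derivative Suc.IH])
  qed simp
  from this[of _ 1] show ?thesis unfolding smooth1_def cutoff_def[abs_def] by (simp cong: if_cong)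
qed

lemma cutoff_bounds: "0 \<le> cutoff x" "cutoff x \<le> 1" "0 < x \<Longrightarrow> 0 < cutoff x" "x \<le> 0 \<Longrightarrow> cutoff x = 0"
  by (auto simp: cutoff_def)

text \<open>As \<open>n\<close> grows these functions tend pointwise to the indicator of the open
  interval and stay between 0 and 1, as dominated convergence requires.\<close>

definition bump :: "real \<Rightarrow> real \<Rightarrow> nat \<Rightarrow> real \<Rightarrow> real" where
  "bump c d n t = cutoff (real n * (t - c)) * cutoff (real n * (d - t))"

lemma smooth1_bump: "smooth1 (bump c d n)"
proof -
  have "smooth1 (\<lambda>t. cutoff (real n * t + - (real n * c)) * cutoff (- real n * t + real n * d))"
    by (intro smooth1_mult smooth1_affine smooth1_cutoff)
  then show ?thesis unfolding bump_def[abs_def] by (simp add: algebra_simps)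
qed

lemma bump_bounds: "0 \<le> bump c d n t" "bump c d n t \<le> 1" "t \<notin> {c<..<d} \<Longrightarrow> bump c d n t = 0"
  "0 < n \<Longrightarrow> t \<in> {c<..<d} \<Longrightarrow> 0 < bump c d n t"
proof -
  show "0 \<le> bump c d n t" "bump c d n t \<le> 1"
    unfolding bump_def by (auto intro!: mult_le_one mult_nonneg_nonneg cutoff_bounds)
  show "t \<notin> {c<..<d} \<Longrightarrow> bump c d n t = 0"
    unfolding bump_def by (auto simp: cutoff_bounds(4) mult_le_0_iff)
  show "0 < n \<Longrightarrow> t \<in> {c<..<d} \<Longrightarrow> 0 < bump c d n t"
    unfolding bump_def by (auto intro!: mult_pos_pos cutoff_bounds(3))
qed

lemma cutoff_tendsto:
  assumes "0 < x"
  shows "(\<lambda>n. cutoff (real n * x)) \<longlonglongrightarrow> 1"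
proof -
  have "(\<lambda>n. exp (- (1 / x) * (1 / real n))) \<longlonglongrightarrow> exp (- (1 / x) * 0)"
    by (intro tendsto_intros lim_1_over_n)
  moreover have "\<forall>\<^sub>F n in sequentially. exp (- (1 / x) * (1 / real n)) = cutoff (real n * x)"
    using eventually_gt_at_top[of 0] by eventually_elim (use assms in \<open>auto simp: cutoff_def mult.commute\<close>)
  ultimately show ?thesis by (simp add: tendsto_cong)
qed

lemma bump_tendsto: "(\<lambda>n. bump c d n t) \<longlonglongrightarrow> indicat_real {c<..<d} t"
proof (cases "t \<in> {c<..<d}")
  case True
  then have "(\<lambda>n. bump c d n t) \<longlonglongrightarrow> 1 * 1"
    unfolding bump_def by (intro tendsto_mult cutoff_tendsto) auto
  then show ?thesis using True by simp
qed (simp add: bump_bounds)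

section \<open>Test functions on (0,1) and the fundamental lemma of the calculus of
  variations\<close>

lemma AE_zero_if_tail_integrals_zero:
  fixes f :: "real \<Rightarrow> real"
  assumes f: "integrable lborel f" and zero: "\<And>x. (\<integral>t. indicator {x<..} t * f t \<partial>lborel) = 0"
  shows "AE t in lborel. f t = 0"
proof -
  have [measurable]: "f \<in> borel_measurable borel" using f by auto
  have int: "integrable lborel (\<lambda>t. indicator {x<..} t * g t)" if "integrable lborel g" for x and g :: "real \<Rightarrow> real"
    using integrable_mult_indicator[OF _ that, of "{x<..}"] by simp
  have em: "emeasure (density lborel (\<lambda>t. ennreal (g t))) {x<..} = ennreal (\<integral>t. indicator {x<..} t * g t \<partial>lborel)"
    if "integrable lborel g" "\<And>t. 0 \<le> g t" for x and g :: "real \<Rightarrow> real"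
  proof -
    have [measurable]: "g \<in> borel_measurable borel" using that by auto
    have "emeasure (density lborel (\<lambda>t. ennreal (g t))) {x<..} = (\<integral>\<^sup>+t. ennreal (indicator {x<..} t * g t) \<partial>lborel)"
      by (subst emeasure_density) (auto intro!: nn_integral_cong simp: indicator_def)
    also have "\<dots> = ennreal (\<integral>t. indicator {x<..} t * g t \<partial>lborel)"
      using that by (intro nn_integral_eq_integral int) auto
    finally show ?thesis .
  qed
  define fp where "fp t = max 0 (f t)" for t
  define fm where "fm t = max 0 (- f t)" for t
  have fp_nn: "0 \<le> fp t" and fm_nn: "0 \<le> fm t" for t by (auto simp: fp_def fm_def)
  have ints: "integrable lborel fp" "integrable lborel fm"
    unfolding fp_def fm_def using f by auto
  \<comment> \<open>The positive and negative parts of \<open>f\<close> define finite measures that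
    agree on all half lines, hence are equal.\<close>
  have "density lborel (\<lambda>t. ennreal (fp t)) = density lborel (\<lambda>t. ennreal (fm t))"
  proof (rule measure_eqI_lessThan)
    fix x
    have "(\<integral>t. indicator {x<..} t * fp t \<partial>lborel) - (\<integral>t. indicator {x<..} t * fm t \<partial>lborel)
      = (\<integral>t. indicator {x<..} t * fp t - indicator {x<..} t * fm t \<partial>lborel)"
      by (rule Bochner_Integration.integral_diff[symmetric]) (intro int ints)+
    also have "\<dots> = (\<integral>t. indicator {x<..} t * f t \<partial>lborel)"
      by (rule Bochner_Integration.integral_cong) (auto simp: fp_def fm_def indicator_def)
    finally have "(\<integral>t. indicator {x<..} t * fp t \<partial>lborel) = (\<integral>t. indicator {x<..} t * fm t \<partial>lborel)"
      using zero by simp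
    then show "emeasure (density lborel (\<lambda>t. ennreal (fp t))) {x<..} = emeasure (density lborel (\<lambda>t. ennreal (fm t))) {x<..}"
      using em[OF ints(1), of x] em[OF ints(2), of x] by (simp add: fp_nn fm_nn)
    show "emeasure (density lborel (\<lambda>t. ennreal (fp t))) {x<..} < \<infinity>"
      using em[OF ints(1), of x] by (simp add: fp_nn)
  qed simp_all
  moreover have "(\<lambda>t. ennreal (fp t)) \<in> borel_measurable lborel" "(\<lambda>t. ennreal (fm t)) \<in> borel_measurable lborel"
    unfolding fp_def fm_def by measurable
  ultimately have "AE t in lborel. ennreal (fp t) = ennreal (fm t)"
    using sigma_finite_measure.density_unique[OF sigma_finite_lborel] by blast
  then show ?thesis
    by eventually_elim (auto simp: fp_def fm_def max_def split: if_splits)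
qed

definition loc_int :: "(real \<Rightarrow> real) \<Rightarrow> bool" where
  "loc_int h \<longleftrightarrow> (\<forall>c d. 0 < c \<longrightarrow> d < 1 \<longrightarrow> set_integrable lborel {c..d} h)"

text \<open>Functions of s = |x|^2. The support avoids \<open>0\<close> as well as \<open>1\<close>,
  so neither the origin, where the radial equation is singular, nor the boundary sphere ever
  enters.\<close>

definition test1 :: "(real \<Rightarrow> real) \<Rightarrow> bool" where
  "test1 f \<longleftrightarrow> smooth1 f \<and> (\<exists>c d. 0 < c \<and> c < d \<and> d < 1 \<and> (\<forall>t. t \<notin> {c..d} \<longrightarrow> f t = 0))"

lemma set_integrable_mult_continuous:
  fixes h g :: "real \<Rightarrow> real"
  assumes h: "set_integrable lborel {c..d} h" and g: "continuous_on {c..d} g"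
  shows "set_integrable lborel {c..d} (\<lambda>t. h t * g t)"
proof -
  have "bounded (g ` {c..d})" using compact_continuous_image[OF g] compact_imp_bounded by auto
  then obtain K where K: "\<And>t. t \<in> {c..d} \<Longrightarrow> \<bar>g t\<bar> \<le> K" unfolding bounded_iff by (metis image_eqI real_norm_def)
  have m1: "(\<lambda>t. indicat_real {c..d} t *\<^sub>R g t) \<in> borel_measurable borel"
    by (rule borel_measurable_continuous_on_indicator[OF _ g]) simp
  have m2: "(\<lambda>t. indicat_real {c..d} t *\<^sub>R h t) \<in> borel_measurable borel"
    using h unfolding set_integrable_def by auto
  have "integrable lborel (\<lambda>t. K * (indicat_real {c..d} t *\<^sub>R h t))"
    using h unfolding set_integrable_def by (rule integrable_mult_right)
  moreover have "(\<lambda>t. indicat_real {c..d} t *\<^sub>R (h t * g t)) \<in> borel_measurable lborel"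
  proof -
    have "(\<lambda>t. (indicat_real {c..d} t *\<^sub>R h t) * (indicat_real {c..d} t *\<^sub>R g t)) \<in> borel_measurable borel"
      using m1 m2 by (rule borel_measurable_times[rotated])
    also have "(\<lambda>t. (indicat_real {c..d} t *\<^sub>R h t) * (indicat_real {c..d} t *\<^sub>R g t)) = (\<lambda>t. indicat_real {c..d} t *\<^sub>R (h t * g t))"
      by (auto simp: indicator_def)
    finally show ?thesis by simp
  qed
  ultimately show ?thesis unfolding set_integrable_def
  proof (rule Bochner_Integration.integrable_bound, intro AE_I2)
    fix t show "norm (indicat_real {c..d} t *\<^sub>R (h t * g t)) \<le> norm (K * (indicat_real {c..d} t *\<^sub>R h t))"
    proof (cases "t \<in> {c..d}")
      case True
      then have "\<bar>g t\<bar> * \<bar>h t\<bar> \<le> \<bar>K\<bar> * \<bar>h t\<bar>" using K[OF True] by (intro mult_right_mono) auto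
      then show ?thesis using True by (simp add: abs_mult mult.commute)
    qed simp
  qed
qed

lemma loc_int_mult:
  assumes "loc_int h" "continuous_on {0<..<1} g"
  shows "loc_int (\<lambda>t. h t * g t)"
  unfolding loc_int_def
proof (intro allI impI)
  fix c d :: real assume "0 < c" "d < 1"
  then show "set_integrable lborel {c..d} (\<lambda>t. h t * g t)"
    using assms by (intro set_integrable_mult_continuous continuous_on_subset[OF assms(2)]) (auto simp: loc_int_def)
qed

lemma loc_int_continuous: "continuous_on {0<..<1} g \<Longrightarrow> loc_int g"
  unfolding loc_int_def
  by (auto intro!: borel_integrable_atLeastAtMost' continuous_on_subset[of "{0<..<1}" g])

lemma loc_int_add: "loc_int f \<Longrightarrow> loc_int g \<Longrightarrow> loc_int (\<lambda>t. f t + g t)"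
  and loc_int_diff: "loc_int f \<Longrightarrow> loc_int g \<Longrightarrow> loc_int (\<lambda>t. f t - g t)"
  by (auto simp: loc_int_def intro!: set_integral_add set_integral_diff)

lemma integrable_mult_supported:
  fixes h g :: "real \<Rightarrow> real"
  assumes h: "loc_int h" and g: "continuous_on UNIV g" "0 < c" "d < 1" "\<And>t. t \<notin> {c..d} \<Longrightarrow> g t = 0"
  shows "integrable lborel (\<lambda>t. h t * g t)"
proof -
  have "set_integrable lborel {c..d} (\<lambda>t. h t * g t)"
    using h g by (intro set_integrable_mult_continuous continuous_on_subset[OF g(1)]) (auto simp: loc_int_def)
  moreover have "(\<lambda>t. indicat_real {c..d} t *\<^sub>R (h t * g t)) = (\<lambda>t. h t * g t)"
    using g(4) by (auto simp: indicator_def fun_eq_iff)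
  ultimately show ?thesis by (simp add: set_integrable_def)
qed

lemma deriv_zero_outside:
  assumes "\<And>t. t \<notin> {c..d} \<Longrightarrow> f t = 0" and t: "t \<notin> {c..d}" and d: "(f has_real_derivative D) (at t)"
  shows "D = (0::real)"
proof -
  have "((\<lambda>t. 0) has_real_derivative D) (at t)"
    by (rule has_field_derivative_transform_within_open[OF d, of "- {c..d}"]) (use assms in auto)
  then show ?thesis using DERIV_const DERIV_unique by blast
qed

lemma test1_deriv: "test1 f \<Longrightarrow> test1 (deriv f)"
  unfolding test1_def using smooth1_deriv deriv_zero_outside smooth1_has_derivative by metis

lemma test1_integrable: "loc_int h \<Longrightarrow> test1 f \<Longrightarrow> integrable lborel (\<lambda>t. h t * f t)"
  unfolding test1_def by (auto intro!: integrable_mult_supported smooth1_continuous_on)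

lemma test1_bump: "0 < c \<Longrightarrow> c < d \<Longrightarrow> d < 1 \<Longrightarrow> test1 (bump c d n)"
  unfolding test1_def using smooth1_bump bump_bounds(3) by (metis atLeastAtMost_iff greaterThanLessThan_iff less_eq_real_def)

text \<open>This combination serves to subtract a multiple of a reference function and so make the
  integral of a test function vanish.\<close>

lemma test1_lincomb:
  assumes "test1 f" "test1 g"
  shows "test1 (\<lambda>t. f t - a * g t)"
proof -
  obtain c d where f: "smooth1 f" "0 < c" "c < d" "d < 1" "\<And>t. t \<notin> {c..d} \<Longrightarrow> f t = 0"
    using assms by (auto simp: test1_def)
  obtain c' d' where g: "smooth1 g" "0 < c'" "c' < d'" "d' < 1" "\<And>t. t \<notin> {c'..d'} \<Longrightarrow> g t = 0"
    using assms by (auto simp: test1_def)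
  have "smooth1 (\<lambda>t. f t + (- a) * g t)" by (intro smooth1_add smooth1_mult smooth1_const f g)
  then have "smooth1 (\<lambda>t. f t - a * g t)" by simp
  moreover have "f t - a * g t = 0" if "t \<notin> {min c c'..max d d'}" for t
  proof -
    have "t \<notin> {c..d}" "t \<notin> {c'..d'}" using that by auto
    then show ?thesis using f(5) g(5) by simp
  qed
  ultimately show ?thesis unfolding test1_def using f g
    by (intro conjI exI[of _ "min c c'"] exI[of _ "max d d'"]) auto
qed

text \<open>Integral zero is exactly what makes the primitive vanish again to the right of the
  support.\<close>

lemma test1_primitive:
  assumes f: "test1 f" and zero: "(\<integral>t. f t \<partial>lborel) = 0"
  obtains F where "test1 F" "deriv F = f" "\<And>t. (F has_real_derivative f t) (at t)"
proof -
  obtain c d where fs: "smooth1 f" "0 < c" "c < d" "d < 1" "\<And>t. t \<notin> {c..d} \<Longrightarrow> f t = 0"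
    using f by (auto simp: test1_def)
  define F where "F t = integral {0..t} f" for t
  have int: "f integrable_on {a..b}" for a b
    by (intro integrable_continuous_real smooth1_continuous_on fs)
  have Fc: "F t = 0" if "t < c" for t
    unfolding F_def using that fs(5) by (subst integral_cong[of _ _ "\<lambda>_. 0"]) auto
  have Fd: "F t = 0" if "d < t" for t
  proof -
    have "f x = indicat_real {0..t} x *\<^sub>R f x" for x
      using that fs(2-4) fs(5)[of x] by (cases "x \<in> {c..d}") auto
    then have "(\<integral>x. f x \<partial>lborel) = (LINT x:{0..t}|lborel. f x)"
      unfolding set_lebesgue_integral_def by presburger
    also have "\<dots> = F t" unfolding F_def
      by (intro set_borel_integral_eq_integral(2) borel_integrable_atLeastAtMost' smooth1_continuous_on fs)
    finally show ?thesis using zero by simp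
  qed
  have F: "(F has_real_derivative f t) (at t)" for t
  proof (cases "t < c")
    case True
    have "((\<lambda>_. 0) has_real_derivative f t) (at t)" using True fs(5)[of t] by simp
    then show ?thesis
      by (rule has_field_derivative_transform_within_open[of _ _ _ "{..<c}"]) (use True Fc in auto)
  next
    case False
    have "(F has_real_derivative f t) (at t within {0..t + 1})"
      unfolding F_def using False fs by (intro integral_has_real_derivative smooth1_continuous_on) auto
    then show ?thesis using False fs by (simp add: at_within_Icc_at)
  qed
  have "smooth1 F" by (rule smooth1_I_deriv[OF F fs(1)])
  moreover have "F t = 0" if "t \<notin> {c..d}" for t using that Fc[of t] Fd[of t] by auto
  ultimately have "test1 F" unfolding test1_def using fs by blast
  then show ?thesis using that F DERIV_imp_deriv[OF F] by auto
qed

lemma AE_interval_of_compact: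
  assumes "\<And>c d::real. 0 < c \<Longrightarrow> c < d \<Longrightarrow> d < 1 \<Longrightarrow> AE t in lborel. t \<in> {c..d} \<longrightarrow> P t"
  shows "AE t in lborel. t \<in> {0<..<1} \<longrightarrow> P t"
proof -
  \<comment> \<open>Exhaustion by countably many compact intervals; \<open>n + 3\<close> keeps each
    of them nondegenerate.\<close>
  have "AE t in lborel. \<forall>n::nat. t \<in> {1 / (real n + 3)..1 - 1 / (real n + 3)} \<longrightarrow> P t"
    unfolding AE_all_countable
  proof
    fix n :: nat
    have "1 / (real n + 3) \<le> 1 / 3" by (intro frac_le) auto
    then show "AE t in lborel. t \<in> {1 / (real n + 3)..1 - 1 / (real n + 3)} \<longrightarrow> P t"
      by (intro assms) auto
  qed
  then show ?thesis
  proof eventually_elim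
    case (elim t)
    show ?case
    proof
      assume t: "t \<in> {0<..<1}"
      define e where "e = min t (1 - t)"
      have e: "0 < e" using t by (simp add: e_def)
      then obtain n :: nat where n: "0 < n" "1 / real n < e" by (metis nat_approx_posE of_nat_0_less_iff zero_less_Suc)
      have "1 / (real n + 3) \<le> 1 / real n" using n by (intro frac_le) auto
      then have "1 / (real n + 3) \<le> e" using n by simp
      then have "t \<in> {1 / (real n + 3)..1 - 1 / (real n + 3)}" by (simp add: e_def)
      then show "P t" using elim by blast
    qed
  qed
qed

text \<open>Bumps converge to indicators of open intervals, so the integrals of \<open>h\<close>
  over these vanish; on a fixed compact interval this gives vanishing tail integrals.\<close>

lemma AE_zero_if_test_integrals_zero:
  assumes h: "loc_int h" and zero: "\<And>f. test1 f \<Longrightarrow> (\<integral>t. h t * f t \<partial>lborel) = 0"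
  shows "AE t in lborel. t \<in> {0<..<1} \<longrightarrow> h t = 0"
proof (rule AE_interval_of_compact)
  fix c d :: real assume cd: "0 < c" "c < d" "d < 1"
  have int: "integrable lborel (\<lambda>t. indicat_real {c..d} t * h t)"
    using h cd by (auto simp: loc_int_def set_integrable_def)
  have mh[measurable]: "(\<lambda>t. indicat_real {c..d} t * h t) \<in> borel_measurable borel" using int by auto
  have open0: "(\<integral>t. indicat_real {a<..<d} t * h t \<partial>lborel) = 0" if a: "c \<le> a" "a < d" for a
  proof -
    have eq: "bump a d n t * (indicat_real {c..d} t * h t) = h t * bump a d n t" for n t
      using bump_bounds(3)[of t a d n] a by (cases "t \<in> {a<..<d}") auto
    have eq2: "indicat_real {a<..<d} t * (indicat_real {c..d} t * h t) = indicat_real {a<..<d} t * h t" for t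
      using a by (auto simp: indicator_def)
    have [measurable]: "bump a d n \<in> borel_measurable borel" for n
      by (intro borel_measurable_continuous_onI smooth1_continuous_on smooth1_bump)
    have "(\<lambda>n. \<integral>t. bump a d n t * (indicat_real {c..d} t * h t) \<partial>lborel)
        \<longlonglongrightarrow> (\<integral>t. indicat_real {a<..<d} t * (indicat_real {c..d} t * h t) \<partial>lborel)"
    proof (rule integral_dominated_convergence[where w = "\<lambda>t. \<bar>indicat_real {c..d} t * h t\<bar>"])
      show "AE t in lborel. (\<lambda>n. bump a d n t * (indicat_real {c..d} t * h t))
          \<longlonglongrightarrow> indicat_real {a<..<d} t * (indicat_real {c..d} t * h t)"
        by (intro AE_I2 tendsto_mult bump_tendsto tendsto_const)
      show "AE t in lborel. norm (bump a d n t * (indicat_real {c..d} t * h t)) \<le> \<bar>indicat_real {c..d} t * h t\<bar>" for n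
        by (intro AE_I2) (auto simp: abs_mult bump_bounds mult_left_le_one_le)
    qed (use int in auto)
    moreover have "(\<integral>t. bump a d n t * (indicat_real {c..d} t * h t) \<partial>lborel) = 0" for n
      unfolding eq using a cd by (intro zero test1_bump) auto
    ultimately have "(\<lambda>n::nat. 0::real) \<longlonglongrightarrow> (\<integral>t. indicat_real {a<..<d} t * h t \<partial>lborel)"
      unfolding eq2 by simp
    then show ?thesis using LIMSEQ_unique tendsto_const by blast
  qed
  have "AE t in lborel. indicat_real {c..d} t * h t = 0"
  proof (rule AE_zero_if_tail_integrals_zero[OF int])
    fix x
    have ae: "AE t in lborel. t \<noteq> d" "AE t in lborel. t \<noteq> c" by (auto intro: AE_lborel_singleton)
    show "(\<integral>t. indicat_real {x<..} t * (indicat_real {c..d} t * h t) \<partial>lborel) = 0"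
    proof (cases "x < d")
      case True
      have "(\<integral>t. indicat_real {x<..} t * (indicat_real {c..d} t * h t) \<partial>lborel)
         = (\<integral>t. indicat_real {max c x<..<d} t * (indicat_real {c..d} t * h t) \<partial>lborel)"
      proof (rule integral_cong_AE)
        show "AE t in lborel. indicat_real {x<..} t * (indicat_real {c..d} t * h t)
            = indicat_real {max c x<..<d} t * (indicat_real {c..d} t * h t)"
          using ae by eventually_elim (auto simp: indicator_def)
      qed measurable
      also have "\<dots> = (\<integral>t. indicat_real {max c x<..<d} t * h t \<partial>lborel)"
        by (rule Bochner_Integration.integral_cong) (auto simp: indicator_def)
      also have "\<dots> = 0" using True cd by (intro open0) auto
      finally show ?thesis .
    next
      case False
      then have "indicat_real {x<..} t * (indicat_real {c..d} t * h t) = 0" for t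
        by (auto simp: indicator_def)
      then show ?thesis by (simp only: Bochner_Integration.integral_zero)
    qed
  qed
  then show "AE t in lborel. t \<in> {c..d} \<longrightarrow> h t = 0"
    by eventually_elim (auto simp: indicator_def split: if_splits)
qed

section \<open>The du Bois-Reymond lemma, primitives and regularity of weak solutions\<close>

lemma test1_reference:
  obtains f where "test1 f" "(\<integral>t. f t \<partial>lborel) = 1"
proof -
  define b where "b = bump (1/3) (2/3) 1"
  have b: "test1 b" unfolding b_def by (rule test1_bump) auto
  have "loc_int (\<lambda>_. 1)" by (intro loc_int_continuous continuous_intros)
  from test1_integrable[OF this b] have int: "integrable lborel b" by simp
  have "(\<integral>t. b t \<partial>lborel) \<noteq> 0"
  proof
    assume "(\<integral>t. b t \<partial>lborel) = 0"
    then have ae: "AE t in lborel. b t = 0"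
      using integral_nonneg_eq_0_iff_AE[OF int] bump_bounds(1) by (simp add: b_def)
    have "AE t::real in lborel. t \<notin> {1/3<..<2/3}"
      using ae by eventually_elim (use bump_bounds(4)[of 1 _ "1/3" "2/3"] in \<open>force simp: b_def\<close>)
    then have "emeasure lborel {1/3<..<2/3::real} = 0"
      using emeasure_eq_0_AE[of "\<lambda>t. t \<in> {1/3<..<2/3::real}" lborel] by (simp del: greaterThanLessThan_iff)
    then show False by simp
  qed
  \<comment> \<open>Division of \<open>b\<close> by its integral, written in the form that
    \<open>test1_lincomb\<close> covers.\<close>
  moreover have "test1 (\<lambda>t. b t - (1 - 1 / (\<integral>t. b t \<partial>lborel)) * b t)" by (intro test1_lincomb b)
  moreover have "(\<integral>t. b t - (1 - 1 / (\<integral>t. b t \<partial>lborel)) * b t \<partial>lborel) = (\<integral>t. (1 / (\<integral>t. b t \<partial>lborel)) * b t \<partial>lborel)"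
    by (rule Bochner_Integration.integral_cong) (auto simp: algebra_simps)
  ultimately show ?thesis using that by auto
qed

text \<open>After subtraction of a multiple of a reference function a test function has integral
  zero, so it is the derivative of a test function and is annihilated by \<open>L\<close>. The form
  for abstract functionals permits two different applications.\<close>

lemma du_bois_reymond_functional:
  fixes L :: "(real \<Rightarrow> real) \<Rightarrow> real"
  assumes lin: "\<And>f g a. test1 f \<Longrightarrow> test1 g \<Longrightarrow> L (\<lambda>t. f t - a * g t) = L f - a * L g"
    and zero: "\<And>f. test1 f \<Longrightarrow> L (deriv f) = 0"
  obtains a where "\<And>f. test1 f \<Longrightarrow> L f = a * (\<integral>t. f t \<partial>lborel)"
proof -
  obtain r where r: "test1 r" "(\<integral>t. r t \<partial>lborel) = 1" by (rule test1_reference)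
  have one: "loc_int (\<lambda>_. 1)" by (intro loc_int_continuous continuous_intros)
  have int: "integrable lborel f" if "test1 f" for f using test1_integrable[OF one that] by simp
  show ?thesis
  proof (rule that[of "L r"])
    fix f assume f: "test1 f"
    define a where "a = (\<integral>t. f t \<partial>lborel)"
    have "(\<integral>t. f t - a * r t \<partial>lborel) = 0"
      using int[OF f] int[OF r(1)] r(2) by (simp add: a_def)
    then obtain F where "test1 F" "deriv F = (\<lambda>t. f t - a * r t)"
      using test1_primitive[OF test1_lincomb[OF f r(1)]] by blast
    then have "L (\<lambda>t. f t - a * r t) = 0" using zero by metis
    then show "L f = L r * (\<integral>t. f t \<partial>lborel)" using lin[OF f r(1)] by (simp add: a_def)
  qed
qed

text \<open>The base point 1/2 is interior because \<open>j\<close> is only locally integrable on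
  (0,1); the sign in the second branch makes this an oriented integral.\<close>

definition prim :: "(real \<Rightarrow> real) \<Rightarrow> real \<Rightarrow> real" where
  "prim j t = (if 1/2 \<le> t then integral {1/2..t} j else - integral {t..1/2} j)"

lemma loc_int_integrable_on: "loc_int j \<Longrightarrow> 0 < c \<Longrightarrow> d < 1 \<Longrightarrow> j integrable_on {c..d}"
  by (rule set_borel_integral_eq_integral(1)) (auto simp: loc_int_def)

lemma prim_eq:
  assumes j: "loc_int j" and c: "0 < c" "c \<le> 1/2" "c \<le> t" "t < 1"
  shows "prim j t = integral {c..t} j - integral {c..1/2} j"
proof (cases "1/2 \<le> t")
  case True
  then show ?thesis
    using Henstock_Kurzweil_Integration.integral_combine[of c "1/2" t j] loc_int_integrable_on[OF j c(1) c(4)] c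
    by (simp add: prim_def)
next
  case False
  then show ?thesis
    using Henstock_Kurzweil_Integration.integral_combine[of c t "1/2" j] loc_int_integrable_on[OF j c(1), of "1/2"] c
    by (simp add: prim_def)
qed

lemma prim_continuous:
  assumes j: "loc_int j"
  shows "continuous_on {0<..<1} (prim j)"
proof (rule continuous_at_imp_continuous_on, rule ballI)
  fix t :: real assume t: "t \<in> {0<..<1}"
  define c where "c = min (1/2) (t / 2)"
  define d where "d = (t + 1) / 2"
  have c: "0 < c" "c \<le> 1/2" "c < t" "t < d" "d < 1" using t by (auto simp: c_def d_def min_def)
  have "continuous_on {c..d} (\<lambda>t. integral {c..t} j - integral {c..1/2} j)"
    using c by (intro continuous_intros indefinite_integral_continuous_1 loc_int_integrable_on j) auto
  then have "continuous_on {c..d} (prim j)"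
    by (rule continuous_on_eq) (use c prim_eq[OF j] in auto)
  then show "isCont (prim j) t" using c by (intro continuous_on_interior[of "{c..d}"]) auto
qed

lemma prim_has_derivative:
  assumes j: "continuous_on {0<..<1} j" and t: "t \<in> {0<..<1}"
  shows "(prim j has_real_derivative j t) (at t)"
proof -
  define c where "c = min (1/2) (t / 2)"
  define d where "d = (t + 1) / 2"
  have c: "0 < c" "c \<le> 1/2" "c < t" "t < d" "d < 1" using t by (auto simp: c_def d_def min_def)
  have "((\<lambda>u. integral {c..u} j) has_real_derivative j t) (at t within {c..d})"
    using c by (intro integral_has_real_derivative continuous_on_subset[OF j]) auto
  then have "((\<lambda>u. integral {c..u} j - integral {c..1/2} j) has_real_derivative j t) (at t)"
    using c by (auto intro!: derivative_eq_intros simp: at_within_Icc_at)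
  then show ?thesis
    by (rule has_field_derivative_transform_within_open[of _ _ _ "{c<..<d}"])
       (use c prim_eq[OF loc_int_continuous[OF j] c(1,2)] in auto)
qed

lemma prim_cong_AE:
  assumes j: "loc_int j" "loc_int k" and ae: "AE t in lborel. t \<in> {0<..<1} \<longrightarrow> j t = k t"
    and t: "t \<in> {0<..<1}"
  shows "prim j t = prim k t"
proof -
  have "integral {a..b} j = integral {a..b} k" if "0 < a" "b < 1" for a b
  proof -
    have si: "set_integrable lborel {a..b} j" "set_integrable lborel {a..b} k"
      using j that by (auto simp: loc_int_def)
    have "(LINT x:{a..b}|lborel. j x) = (LINT x:{a..b}|lborel. k x)"
      unfolding set_lebesgue_integral_def
    proof (rule integral_cong_AE)
      show "AE x in lborel. indicat_real {a..b} x *\<^sub>R j x = indicat_real {a..b} x *\<^sub>R k x"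
        using ae by eventually_elim (use that in \<open>auto simp: indicator_def\<close>)
    qed (use si in \<open>auto simp: set_integrable_def\<close>)
    then show ?thesis using set_borel_integral_eq_integral(2)[OF si(1)] set_borel_integral_eq_integral(2)[OF si(2)]
      by simp
  qed
  then show ?thesis using t by (simp add: prim_def)
qed

text \<open>As \<open>j\<close> is merely integrable, its primitive need not be differentiable
  everywhere. Instead Fubini is applied to j(s) f'(t) on the triangle s \<le> t \<le> d.\<close>

lemma integral_by_parts_indefinite:
  fixes j f f' :: "real \<Rightarrow> real"
  assumes j: "set_integrable lborel {c..d} j" and cd: "c \<le> d"
    and f: "\<And>t. (f has_real_derivative f' t) (at t)" "continuous_on UNIV f'" "f d = 0"
  shows "(\<integral>t. indicat_real {c..d} t * (integral {c..t} j * f' t) \<partial>lborel)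
       = - (\<integral>t. indicat_real {c..d} t * (j t * f t) \<partial>lborel)"
proof -
  define h where "h s = indicat_real {c..d} s * j s" for s
  have h: "integrable lborel h" using j by (simp add: set_integrable_def h_def[abs_def])
  have [measurable]: "h \<in> borel_measurable borel" using h by auto
  have [measurable]: "f' \<in> borel_measurable borel" using f(2) by (rule borel_measurable_continuous_onI)
  define F where "F s t = (if s \<le> t \<and> t \<le> d then h s * f' t else 0)" for s t
  have [measurable]: "(\<lambda>(s, t). F s t) \<in> borel_measurable (lborel \<Otimes>\<^sub>M lborel)"
    unfolding F_def by measurable
  have bnd: "bounded (f' ` {c..d})"
    by (intro compact_imp_bounded compact_continuous_image continuous_on_subset[OF f(2)]) auto
  obtain K where K: "0 < K" "\<And>t. t \<in> {c..d} \<Longrightarrow> \<bar>f' t\<bar> \<le> K"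
    using bnd unfolding bounded_pos by (metis image_eqI real_norm_def)
  have Fint: "integrable lborel (F s)" for s
  proof (rule Bochner_Integration.integrable_bound)
    show "integrable lborel (\<lambda>t. h s * K * indicat_real {c..d} t)"
      by (intro integrable_mult_right integrable_real_indicator) (auto simp: emeasure_lborel_Icc_eq)
    show "AE t in lborel. norm (F s t) \<le> norm (h s * K * indicat_real {c..d} t)"
    proof (rule AE_I2)
      fix t show "norm (F s t) \<le> norm (h s * K * indicat_real {c..d} t)"
        using K(2)[of t] K(1) by (auto simp: F_def h_def abs_mult indicator_def intro!: mult_left_mono)
    qed
  qed (unfold F_def, measurable)
  have Fbound: "(\<integral>t. norm (F s t) \<partial>lborel) \<le> K * (d - c) * norm (h s)" for s
  proof -
    have "(\<integral>t. norm (F s t) \<partial>lborel) \<le> (\<integral>t. \<bar>h s\<bar> * K * indicat_real {c..d} t \<partial>lborel)"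
    proof (rule integral_mono)
      show "norm (F s t) \<le> \<bar>h s\<bar> * K * indicat_real {c..d} t" for t
        using K(2)[of t] K(1) by (auto simp: F_def h_def abs_mult indicator_def intro!: mult_left_mono)
      show "integrable lborel (\<lambda>t. \<bar>h s\<bar> * K * indicat_real {c..d} t)"
        by (intro integrable_mult_right integrable_real_indicator) (auto simp: emeasure_lborel_Icc_eq)
    qed (use Fint in auto)
    then show ?thesis using cd by (simp add: mult_ac)
  qed
  have Fpair: "integrable (lborel \<Otimes>\<^sub>M lborel) (\<lambda>(s, t). F s t)"
  proof (rule lborel_pair.Fubini_integrable)
    show "integrable lborel (\<lambda>s. \<integral>t. norm (case (s, t) of (s, t) \<Rightarrow> F s t) \<partial>lborel)"
    proof (rule Bochner_Integration.integrable_bound[where f = "\<lambda>s. K * (d - c) * norm (h s)"])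
      show "integrable lborel (\<lambda>s. K * (d - c) * norm (h s))" using h by simp
      show "(\<lambda>s. \<integral>t. norm (case (s, t) of (s, t) \<Rightarrow> F s t) \<partial>lborel) \<in> borel_measurable lborel"
        by measurable
      show "AE s in lborel. norm (\<integral>t. norm (case (s, t) of (s, t) \<Rightarrow> F s t) \<partial>lborel) \<le> norm (K * (d - c) * norm (h s))"
      proof (rule AE_I2)
        fix s
        have "0 \<le> (\<integral>t. norm (F s t) \<partial>lborel)" by (rule integral_nonneg_AE) simp
        then show "norm (\<integral>t. norm (case (s, t) of (s, t) \<Rightarrow> F s t) \<partial>lborel) \<le> norm (K * (d - c) * norm (h s))"
          using Fbound[of s] by simp
      qed
    qed
  qed (use Fint in auto)
  have inner_t: "(\<integral>t. F s t \<partial>lborel) = - (indicat_real {c..d} s * (j s * f s))" for s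
  proof (cases "s \<in> {c..d}")
    case True
    have "(\<integral>t. F s t \<partial>lborel) = (\<integral>t. h s * (f' t * indicat_real {s..d} t) \<partial>lborel)"
      by (rule Bochner_Integration.integral_cong) (auto simp: F_def indicator_def)
    also have "\<dots> = h s * (\<integral>t. f' t * indicat_real {s..d} t \<partial>lborel)" by simp
    also have "(\<integral>t. f' t * indicat_real {s..d} t \<partial>lborel) = f d - f s"
      using True f by (intro integral_FTC_Icc_real) (auto simp: continuous_on_eq_continuous_at)
    finally show ?thesis using f(3) by (simp add: h_def)
  next
    case False
    then have "F s = (\<lambda>t. 0)" by (auto simp: F_def h_def fun_eq_iff)
    then show ?thesis using False by simp
  qed
  have inner_s: "(\<integral>s. F s t \<partial>lborel) = indicat_real {c..d} t * (integral {c..t} j * f' t)" for t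
  proof (cases "t \<in> {c..d}")
    case True
    have si: "set_integrable lborel {c..t} j" by (rule set_integrable_subset[OF j]) (use True in auto)
    have "(\<integral>s. F s t \<partial>lborel) = (\<integral>s. (indicat_real {c..t} s *\<^sub>R j s) * f' t \<partial>lborel)"
      by (rule Bochner_Integration.integral_cong) (use True in \<open>auto simp: F_def h_def indicator_def\<close>)
    also have "\<dots> = (LINT s:{c..t}|lborel. j s) * f' t" by (simp add: set_lebesgue_integral_def)
    also have "\<dots> = integral {c..t} j * f' t" using set_borel_integral_eq_integral(2)[OF si] by simp
    finally show ?thesis using True by simp
  next
    case False
    then have "F s t = 0" for s by (auto simp: F_def h_def)
    then show ?thesis using False by simp
  qed
  show ?thesis using lborel_pair.Fubini_integral[OF Fpair] unfolding inner_t inner_s by simp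
qed

text \<open>Moving the base point from 1/2 to the left of the support changes \<open>prim j\<close>
  by a constant, which disappears because the integral of f' is 0.\<close>

lemma prim_by_parts:
  assumes j: "loc_int j" and f: "test1 f"
  shows "(\<integral>t. prim j t * deriv f t \<partial>lborel) = - (\<integral>t. j t * f t \<partial>lborel)"
proof -
  obtain c0 d0 where f0: "smooth1 f" "0 < c0" "c0 < d0" "d0 < 1" "\<And>t. t \<notin> {c0..d0} \<Longrightarrow> f t = 0"
    using f by (auto simp: test1_def)
  define c where "c = min c0 (1/2)"
  define d where "d = (1 + max d0 (1/2)) / 2"
  have cd: "0 < c" "c \<le> 1/2" "c \<le> c0" "d0 < d" "1/2 \<le> d" "d < 1" using f0 by (auto simp: c_def d_def max_def)
  have out: "f t = 0" if "t \<notin> {c..d}" for t using f0(5)[of t] that cd by auto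
  have fder: "\<And>t. (f has_real_derivative deriv f t) (at t)" using smooth1_has_derivative[OF f0(1)] .
  have cont: "continuous_on UNIV (deriv f)" by (intro smooth1_continuous_on smooth1_deriv f0)
  have d0: "deriv f t = 0" if "t \<notin> {c..d}" for t using deriv_zero_outside[OF out that fder] .
  have fd: "f d = 0" using f0(5)[of d] cd by auto
  have one: "loc_int (\<lambda>_. k)" for k by (intro loc_int_continuous continuous_intros)
  have int0: "(\<integral>t. deriv f t \<partial>lborel) = 0"
  proof -
    have "(\<integral>t. deriv f t \<partial>lborel) = (\<integral>t. deriv f t * indicat_real {c..d} t \<partial>lborel)"
      by (rule Bochner_Integration.integral_cong) (use d0 in \<open>auto simp: indicator_def\<close>)
    also have "\<dots> = f d - f c"
      using fder cont cd by (intro integral_FTC_Icc_real) (auto simp: continuous_on_eq_continuous_at)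
    \<comment> \<open>\<open>c\<close> may be the left end of the support interval, where the value
      0 comes only from continuity.\<close>
    also have "f c = 0"
    proof -
      have "isCont f c" using fder DERIV_isCont by blast
      then have "(f \<longlongrightarrow> f c) (at_left c)" by (simp add: isCont_def filterlim_at_split)
      moreover have "\<forall>\<^sub>F t in at_left c. f t = 0"
        using out by (auto simp: eventually_at_filter)
      ultimately show ?thesis by (metis tendsto_eventually tendsto_unique trivial_limit_at_left_real)
    qed
    finally show ?thesis using fd by simp
  qed
  have si: "set_integrable lborel {c..d} j" using j cd by (auto simp: loc_int_def)
  have td: "test1 (deriv f)" by (rule test1_deriv[OF f])
  have "prim j t * deriv f t = indicat_real {c..d} t * (integral {c..t} j * deriv f t)
      - integral {c..1/2} j * deriv f t" for t
  proof (cases "t \<in> {c..d}")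
    case True
    then have "prim j t = integral {c..t} j - integral {c..1/2} j" using prim_eq[OF j cd(1,2), of t] cd by simp
    then show ?thesis using True by (simp add: left_diff_distrib)
  qed (simp add: d0)
  then have "(\<integral>t. prim j t * deriv f t \<partial>lborel)
     = (\<integral>t. indicat_real {c..d} t * (integral {c..t} j * deriv f t) - integral {c..1/2} j * deriv f t \<partial>lborel)"
    by presburger
  also have "\<dots> = (\<integral>t. indicat_real {c..d} t * (integral {c..t} j * deriv f t) \<partial>lborel) - (\<integral>t. integral {c..1/2} j * deriv f t \<partial>lborel)"
  proof (rule Bochner_Integration.integral_diff)
    have "continuous_on {c..d} (\<lambda>t. integral {c..t} j * deriv f t)"
      using cd by (intro continuous_intros indefinite_integral_continuous_1 loc_int_integrable_on j continuous_on_subset[OF cont]) auto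
    from borel_integrable_atLeastAtMost'[OF this]
    show "integrable lborel (\<lambda>t. indicat_real {c..d} t * (integral {c..t} j * deriv f t))"
      by (simp add: set_integrable_def)
    show "integrable lborel (\<lambda>t. integral {c..1/2} j * deriv f t)"
      by (rule test1_integrable[OF one td])
  qed
  also have "(\<integral>t. integral {c..1/2} j * deriv f t \<partial>lborel) = 0" using int0 by simp
  also have "(\<integral>t. indicat_real {c..d} t * (integral {c..t} j * deriv f t) \<partial>lborel)
      = - (\<integral>t. indicat_real {c..d} t * (j t * f t) \<partial>lborel)"
    using cd by (intro integral_by_parts_indefinite si fder cont fd) auto
  also have "(\<integral>t. indicat_real {c..d} t * (j t * f t) \<partial>lborel) = (\<integral>t. j t * f t \<partial>lborel)"
    by (rule Bochner_Integration.integral_cong) (use out in \<open>auto simp: indicator_def\<close>)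
  finally show ?thesis by simp
qed

lemma deriv_lincomb:
  assumes "test1 f" "test1 g"
  shows "deriv (\<lambda>t. f t - a * g t) = (\<lambda>t. deriv f t - a * deriv g t)"
proof
  fix t
  have "smooth1 f" "smooth1 g" using assms by (auto simp: test1_def)
  then have "((\<lambda>t. f t - a * g t) has_real_derivative deriv f t - a * deriv g t) (at t)"
    by (intro DERIV_diff DERIV_cmult smooth1_has_derivative)
  then show "deriv (\<lambda>t. f t - a * g t) t = deriv f t - a * deriv g t" by (rule DERIV_imp_deriv)
qed

text \<open>The weak form of (B z')' = - K. One use of du Bois-Reymond integrates the equation once,
  a second one represents z B as a primitive; inserting the resulting continuous representative back
  makes that primitive differentiable.\<close>

lemma weak_ode_regularity:
  fixes z K B B' :: "real \<Rightarrow> real"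
  assumes z: "loc_int z" and K: "loc_int K"
    and B: "\<And>t. t \<in> {0<..<1} \<Longrightarrow> (B has_real_derivative B' t) (at t)" "continuous_on {0<..<1} B'"
      "\<And>t. t \<in> {0<..<1} \<Longrightarrow> B t \<noteq> 0"
    and weak: "\<And>f. test1 f \<Longrightarrow> (\<integral>t. z t * (B t * deriv (deriv f) t + B' t * deriv f t) \<partial>lborel)
        + (\<integral>t. K t * f t \<partial>lborel) = 0"
  obtains z0 a where "\<And>t. t \<in> {0<..<1} \<Longrightarrow> (z0 has_real_derivative (a - prim K t) / B t) (at t)"
    "AE t in lborel. t \<in> {0<..<1} \<longrightarrow> z t = z0 t"
proof -
  have cB: "continuous_on {0<..<1} B"
    by (rule DERIV_continuous_on, rule has_field_derivative_at_within, rule B)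
  have cI: "continuous_on {0<..<1} (prim K)" by (rule prim_continuous[OF K])
  have lzB: "loc_int (\<lambda>t. z t * B t)" "loc_int (\<lambda>t. z t * B' t)" by (intro loc_int_mult z cB B)+
  have lI: "loc_int (prim K)" by (rule loc_int_continuous[OF cI])
  have one: "loc_int (\<lambda>_. k)" for k by (intro loc_int_continuous continuous_intros)
  note ints = test1_integrable[OF lzB(1)] test1_integrable[OF lzB(2)] test1_integrable[OF lI] test1_integrable[OF one]
  \<comment> \<open>Moving the derivative from the test function onto \<open>prim K\<close> turns
    the weak equation into the statement that \<open>L\<close> annihilates derivatives.\<close>
  define L where "L f = (\<integral>t. z t * B t * deriv f t \<partial>lborel) + (\<integral>t. z t * B' t * f t \<partial>lborel)
      - (\<integral>t. prim K t * f t \<partial>lborel)" for f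
  have lin: "L (\<lambda>t. f t - a * g t) = L f - a * L g" if fg: "test1 f" "test1 g" for f g a
  proof -
    have *: "(\<integral>t. h t * (f t - a * g t) \<partial>lborel) = (\<integral>t. h t * f t \<partial>lborel) - a * (\<integral>t. h t * g t \<partial>lborel)"
      if "loc_int h" "test1 f" "test1 g" for h f g
    proof -
      have "(\<integral>t. h t * (f t - a * g t) \<partial>lborel) = (\<integral>t. h t * f t - a * (h t * g t) \<partial>lborel)"
        by (rule Bochner_Integration.integral_cong) (auto simp: algebra_simps)
      also have "\<dots> = (\<integral>t. h t * f t \<partial>lborel) - (\<integral>t. a * (h t * g t) \<partial>lborel)"
        using test1_integrable that by (intro Bochner_Integration.integral_diff) auto
      finally show ?thesis by simp
    qed
    show ?thesis
      unfolding L_def deriv_lincomb[OF fg] *[OF lzB(1) test1_deriv[OF fg(1)] test1_deriv[OF fg(2)]]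
        *[OF lzB(2) fg] *[OF lI fg]
      by (simp add: algebra_simps)
  qed
  have zero: "L (deriv f) = 0" if f: "test1 f" for f
  proof -
    have "(\<integral>t. z t * (B t * deriv (deriv f) t + B' t * deriv f t) \<partial>lborel)
       = (\<integral>t. z t * B t * deriv (deriv f) t + z t * B' t * deriv f t \<partial>lborel)"
      by (rule Bochner_Integration.integral_cong) (auto simp: algebra_simps)
    also have "\<dots> = (\<integral>t. z t * B t * deriv (deriv f) t \<partial>lborel) + (\<integral>t. z t * B' t * deriv f t \<partial>lborel)"
      by (intro Bochner_Integration.integral_add ints test1_deriv f)
    finally show ?thesis using weak[OF f] prim_by_parts[OF K f] by (simp add: L_def)
  qed
  obtain a0 where a0: "\<And>f. test1 f \<Longrightarrow> L f = a0 * (\<integral>t. f t \<partial>lborel)"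
    using du_bois_reymond_functional[of L] lin zero by blast
  \<comment> \<open>By the first integration \<open>j\<close> is the distributional derivative of z
    B.\<close>
  define j where "j t = z t * B' t - prim K t - a0" for t
  have lj: "loc_int j" unfolding j_def by (intro loc_int_diff lzB lI one)
  have jf: "(\<integral>t. j t * f t \<partial>lborel) = - (\<integral>t. z t * B t * deriv f t \<partial>lborel)" if f: "test1 f" for f
  proof -
    have "(\<integral>t. j t * f t \<partial>lborel) = (\<integral>t. z t * B' t * f t - prim K t * f t - a0 * f t \<partial>lborel)"
      by (rule Bochner_Integration.integral_cong) (auto simp: j_def algebra_simps)
    also have "\<dots> = (\<integral>t. z t * B' t * f t \<partial>lborel) - (\<integral>t. prim K t * f t \<partial>lborel) - (\<integral>t. a0 * f t \<partial>lborel)"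
      by (intro Bochner_Integration.integral_diff[THEN trans] arg_cong2[where f = "(-)"] refl
          Bochner_Integration.integrable_diff ints f)
    finally show ?thesis using a0[OF f] by (simp add: L_def)
  qed
  have lJ: "loc_int (prim j)" by (intro loc_int_continuous prim_continuous lj)
  have lh: "loc_int (\<lambda>t. z t * B t - prim j t)" by (intro loc_int_diff lzB lJ)
  have split: "(\<integral>t. (h t - k t) * f t \<partial>lborel) = (\<integral>t. h t * f t \<partial>lborel) - (\<integral>t. k t * f t \<partial>lborel)"
    if "loc_int h" "loc_int k" "test1 f" for h k f
    unfolding left_diff_distrib using that by (intro Bochner_Integration.integral_diff test1_integrable)
  obtain b where b: "\<And>f. test1 f \<Longrightarrow> (\<integral>t. (z t * B t - prim j t) * f t \<partial>lborel) = b * (\<integral>t. f t \<partial>lborel)"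
  proof (rule du_bois_reymond_functional[of "\<lambda>f. \<integral>t. (z t * B t - prim j t) * f t \<partial>lborel"])
    fix f g a assume fg: "test1 f" "test1 g"
    have "(\<integral>t. (z t * B t - prim j t) * (f t - a * g t) \<partial>lborel)
       = (\<integral>t. (z t * B t - prim j t) * f t - a * ((z t * B t - prim j t) * g t) \<partial>lborel)"
      by (rule Bochner_Integration.integral_cong) (auto simp: algebra_simps)
    also have "\<dots> = (\<integral>t. (z t * B t - prim j t) * f t \<partial>lborel) - (\<integral>t. a * ((z t * B t - prim j t) * g t) \<partial>lborel)"
      by (intro Bochner_Integration.integral_diff integrable_mult_right test1_integrable lh fg)
    finally show "(\<integral>t. (z t * B t - prim j t) * (f t - a * g t) \<partial>lborel) =
        (\<integral>t. (z t * B t - prim j t) * f t \<partial>lborel) - a * (\<integral>t. (z t * B t - prim j t) * g t \<partial>lborel)" by simp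
  next
    fix f assume f: "test1 f"
    show "(\<integral>t. (z t * B t - prim j t) * deriv f t \<partial>lborel) = 0"
      unfolding split[OF lzB(1) lJ test1_deriv[OF f]] using jf[OF f] prim_by_parts[OF lj f] by simp
  qed (rule that)
  have ae: "AE t in lborel. t \<in> {0<..<1} \<longrightarrow> z t * B t - prim j t - b = 0"
  proof (rule AE_zero_if_test_integrals_zero)
    show "loc_int (\<lambda>t. z t * B t - prim j t - b)" by (intro loc_int_diff[OF lh] one)
    fix f assume f: "test1 f"
    show "(\<integral>t. (z t * B t - prim j t - b) * f t \<partial>lborel) = 0"
      unfolding split[OF lh one f] using b[OF f] by simp
  qed
  define z0 where "z0 t = (prim j t + b) / B t" for t
  have zz0: "AE t in lborel. t \<in> {0<..<1} \<longrightarrow> z t = z0 t"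
    using ae by eventually_elim (use B(3) in \<open>auto simp: z0_def field_simps\<close>)
  have cz0: "continuous_on {0<..<1} z0"
    unfolding z0_def using B(3) by (intro continuous_intros prim_continuous lj cB) auto
  \<comment> \<open>Replacing z by \<open>z0\<close> changes \<open>j\<close> only on a null set,
    hence not its primitive; as \<open>j0\<close> is continuous, that primitive is classically
    differentiable.\<close>
  define j0 where "j0 t = z0 t * B' t - prim K t - a0" for t
  have cj0: "continuous_on {0<..<1} j0" unfolding j0_def by (intro continuous_intros cz0 B(2) cI)
  have "AE t in lborel. t \<in> {0<..<1} \<longrightarrow> j t = j0 t"
    using zz0 by eventually_elim (auto simp: j_def j0_def)
  then have pj: "prim j t = prim j0 t" if "t \<in> {0<..<1}" for t
    using prim_cong_AE[OF lj loc_int_continuous[OF cj0] _ that] by blast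
  have "(z0 has_real_derivative (- a0 - prim K t) / B t) (at t)" if t: "t \<in> {0<..<1}" for t
  proof -
    have "(prim j has_real_derivative j0 t) (at t)"
      by (rule has_field_derivative_transform_within_open[OF prim_has_derivative[OF cj0 t], of "{0<..<1}"])
         (use t pj in auto)
    then have "(z0 has_real_derivative (j0 t * B t - (prim j t + b) * B' t) / (B t * B t)) (at t)"
      unfolding z0_def using B(1)[OF t] B(3)[OF t] by (auto intro!: derivative_eq_intros)
    moreover have "(j0 t * B t - (prim j t + b) * B' t) / (B t * B t) = (j0 t - z0 t * B' t) / B t"
      using B(3)[OF t] by (simp add: z0_def field_simps)
    moreover have "j0 t - z0 t * B' t = - a0 - prim K t" by (simp add: j0_def)
    ultimately show ?thesis by simp
  qed
  then show ?thesis using that zz0 by blast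
qed

section \<open>Radial test functions and weak gradients\<close>

lemma smooth_k_continuous: "smooth_k k f \<Longrightarrow> continuous_on UNIV f"
  by (cases k) auto

lemma smooth_k_Suc_imp: "smooth_k (Suc k) f \<Longrightarrow> smooth_k k f"
proof (induction k arbitrary: f)
  case (Suc k)
  then have "f differentiable_on UNIV" "continuous_on UNIV f"
    "\<And>i. smooth_k (Suc k) (\<lambda>x. frechet_derivative f (at x) (axis i 1))" by (auto simp del: smooth_k.simps simp: smooth_k.simps(2)[of "Suc k"])
  then show ?case using Suc.IH by simp
qed simp

lemma smooth_k_SucI:
  fixes f :: "real^'n \<Rightarrow> real"
  assumes d: "\<And>x. (f has_derivative D x) (at x)" and D: "\<And>i. smooth_k k (\<lambda>x. D x (axis i 1))"
  shows "smooth_k (Suc k) f"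
proof -
  have "frechet_derivative f (at x) = D x" for x using frechet_derivative_at[OF d] by simp
  moreover have "f differentiable_on UNIV"
    using d by (auto simp: differentiable_on_def differentiable_def)
  moreover have "continuous_on UNIV f"
    by (rule differentiable_imp_continuous_on) fact
  ultimately show ?thesis using D by simp
qed

lemma smooth_k_SucD:
  assumes "smooth_k (Suc k) f"
  shows "(f has_derivative frechet_derivative f (at x)) (at x)"
    "smooth_k k (\<lambda>x. frechet_derivative f (at x) (axis i 1))"
  using assms by (auto simp: differentiable_on_def frechet_derivative_works)

lemma smooth_k_add: "smooth_k k f \<Longrightarrow> smooth_k k g \<Longrightarrow> smooth_k k (\<lambda>x. f x + g x)"
proof (induction k arbitrary: f g)
  case (Suc k)
  show ?case
    by (rule smooth_k_SucI[OF has_derivative_add[OF smooth_k_SucD(1)[OF Suc.prems(1)] smooth_k_SucD(1)[OF Suc.prems(2)]]])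
       (rule Suc.IH[OF smooth_k_SucD(2)[OF Suc.prems(1)] smooth_k_SucD(2)[OF Suc.prems(2)]])
qed (auto intro: continuous_intros)

lemma smooth_k_mult: "smooth_k k f \<Longrightarrow> smooth_k k g \<Longrightarrow> smooth_k k (\<lambda>x. f x * g x)"
proof (induction k arbitrary: f g)
  case (Suc k)
  show ?case
    by (rule smooth_k_SucI[OF has_derivative_mult[OF smooth_k_SucD(1)[OF Suc.prems(1)] smooth_k_SucD(1)[OF Suc.prems(2)]]])
       (rule smooth_k_add[OF Suc.IH[OF smooth_k_Suc_imp[OF Suc.prems(1)] smooth_k_SucD(2)[OF Suc.prems(2)]]
           Suc.IH[OF smooth_k_SucD(2)[OF Suc.prems(1)] smooth_k_Suc_imp[OF Suc.prems(2)]]])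
qed (auto intro: continuous_intros)

lemma smooth_k_const: "smooth_k k (\<lambda>x. c)"
proof (induction k arbitrary: c)
  case (Suc k)
  show ?case by (rule smooth_k_SucI[OF has_derivative_const]) (rule Suc.IH)
qed auto

lemma smooth_k_inner:
  fixes v :: "real^'n"
  shows "smooth_k k (\<lambda>x. x \<bullet> v)"
proof (cases k)
  case (Suc k')
  have "((\<lambda>x. x \<bullet> v) has_derivative (\<lambda>h. h \<bullet> v)) (at x)" for x :: "real^'n"
    by (auto intro!: derivative_eq_intros)
  then show ?thesis unfolding Suc by (rule smooth_k_SucI) (rule smooth_k_const)
qed (auto intro!: continuous_intros)

lemma radial_has_derivative:
  fixes x :: "'a::euclidean_space"
  assumes "(f has_real_derivative D) (at ((norm x)\<^sup>2))"
  shows "((\<lambda>x. f ((norm x)\<^sup>2)) has_derivative (\<lambda>h. D * (2 * (x \<bullet> h)))) (at x)"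
proof -
  have "((\<lambda>x::'a. x \<bullet> x) has_derivative (\<lambda>h. 2 * (x \<bullet> h))) (at x)"
    by (auto intro!: derivative_eq_intros simp: inner_commute)
  then have "((\<lambda>x::'a. (norm x)\<^sup>2) has_derivative (\<lambda>h. 2 * (x \<bullet> h))) (at x)"
    by (simp add: power2_norm_eq_inner)
  from has_derivative_compose[OF this] assms
  show ?thesis by (simp add: has_field_derivative_def)
qed

text \<open>An advantage of s = |x|^2 over |x|: it is a polynomial, so derivatives of radial
  functions obey the same formula at the origin.\<close>

lemma smooth_k_radial: "smooth1 f \<Longrightarrow> smooth_k k (\<lambda>x::real^'n. f ((norm x)\<^sup>2))"
proof (induction k arbitrary: f)
  case 0
  show ?case
    by (auto intro!: continuous_on_compose2[OF smooth1_continuous_on[OF 0, of UNIV]] continuous_intros)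
next
  case (Suc k)
  show ?case
  proof (rule smooth_k_SucI)
    fix x :: "real^'n"
    show "((\<lambda>x. f ((norm x)\<^sup>2)) has_derivative (\<lambda>h. deriv f ((norm x)\<^sup>2) * (2 * (x \<bullet> h)))) (at x)"
      by (rule radial_has_derivative[OF smooth1_has_derivative[OF Suc.prems]])
  next
    fix i
    show "smooth_k k (\<lambda>x::real^'n. deriv f ((norm x)\<^sup>2) * (2 * (x \<bullet> axis i 1)))"
      by (intro smooth_k_mult Suc.IH smooth1_deriv Suc.prems smooth_k_const smooth_k_inner)
  qed
qed

lemma pgrad_radial:
  fixes x :: "real^'n"
  assumes "smooth1 f"
  shows "pgrad (\<lambda>x. f ((norm x)\<^sup>2)) x = (2 * deriv f ((norm x)\<^sup>2)) *\<^sub>R x"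
proof -
  have "frechet_derivative (\<lambda>x::real^'n. f ((norm x)\<^sup>2)) (at x) = (\<lambda>h. deriv f ((norm x)\<^sup>2) * (2 * (x \<bullet> h)))"
    by (rule frechet_derivative_at[OF radial_has_derivative[OF smooth1_has_derivative[OF assms]], symmetric])
  then show ?thesis by (simp add: pgrad_def vec_eq_iff inner_axis)
qed

lemma test_fun_radial:
  assumes "test1 f"
  shows "test_fun (\<lambda>x::real^'n. f ((norm x)\<^sup>2))"
proof -
  obtain c d where f: "smooth1 f" "0 < c" "c < d" "d < 1" "\<And>t. t \<notin> {c..d} \<Longrightarrow> f t = 0"
    using assms by (auto simp: test1_def)
  have "{x::real^'n. f ((norm x)\<^sup>2) \<noteq> 0} \<subseteq> cball 0 (sqrt d)"
  proof
    fix x :: "real^'n" assume "x \<in> {x. f ((norm x)\<^sup>2) \<noteq> 0}"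
    then have "(norm x)\<^sup>2 \<in> {c..d}" using f(5) by blast
    then show "x \<in> cball 0 (sqrt d)" using real_le_rsqrt by auto
  qed
  then have sub: "closure {x::real^'n. f ((norm x)\<^sup>2) \<noteq> 0} \<subseteq> cball 0 (sqrt d)"
    by (rule closure_minimal) simp
  moreover have "cball 0 (sqrt d) \<subseteq> ball (0::real^'n) 1"
  proof -
    have "sqrt d < 1" using f by simp
    then show ?thesis unfolding cball_def ball_def by (auto simp del: real_sqrt_lt_1_iff)
  qed
  moreover have "compact (closure {x::real^'n. f ((norm x)\<^sup>2) \<noteq> 0})"
    unfolding compact_eq_bounded_closed using bounded_subset[OF bounded_cball sub] by simp
  ultimately show ?thesis using smooth_k_radial[OF f(1)] unfolding test_fun_def by auto
qed

text \<open>Difference quotients have integral zero by translation invariance of Lebesgue measure.\<close>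

lemma integral_directional_derivative:
  fixes F D :: "'a::euclidean_space \<Rightarrow> real"
  assumes d: "\<And>x. ((\<lambda>s. F (x + s *\<^sub>R v)) has_real_derivative D x) (at 0)"
    and cont: "continuous_on UNIV F" "continuous_on UNIV D"
    and supp: "\<And>x. R \<le> norm x \<Longrightarrow> F x = 0" "\<And>x. R \<le> norm x \<Longrightarrow> D x = 0"
  shows "(\<integral>x. D x \<partial>lborel) = 0"
proof -
  have [measurable]: "F \<in> borel_measurable borel" "D \<in> borel_measurable borel"
    using cont by (auto intro: borel_measurable_continuous_onI)
  have int: "integrable lborel F"
  proof -
    have "integrable lborel (\<lambda>x. indicat_real (cball 0 R) x *\<^sub>R F x)"
      by (rule borel_integrable_compact) (auto intro: continuous_on_subset[OF cont(1)])
    moreover have "(\<lambda>x. indicat_real (cball 0 R) x *\<^sub>R F x) = F"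
      using supp(1) by (auto simp: fun_eq_iff indicator_def)
    ultimately show ?thesis by simp
  qed
  have dd: "((\<lambda>s. F (x + s *\<^sub>R v)) has_real_derivative D (x + s *\<^sub>R v)) (at s)" for x s
    using DERIV_shift[of "\<lambda>r. F (x + r *\<^sub>R v)" "D (x + s *\<^sub>R v)" 0 s] d[of "x + s *\<^sub>R v"]
    by (simp add: algebra_simps)
  have "bounded (D ` cball 0 R)"
    by (intro compact_imp_bounded compact_continuous_image continuous_on_subset[OF cont(2)]) auto
  then obtain K where K: "0 < K" "\<And>x. x \<in> cball 0 R \<Longrightarrow> \<bar>D x\<bar> \<le> K"
    unfolding bounded_pos by (metis image_eqI real_norm_def)
  have DK: "\<bar>D x\<bar> \<le> K" for x using K(2)[of x] K(1) supp(2)[of x] by (cases "norm x \<le> R") auto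
  \<comment> \<open>Steps of length at most 1 keep all shifted supports inside the ball of radius R
    + |v|, which gives an integrable majorant.\<close>
  define h where "h n = 1 / real (Suc n)" for n
  have h: "0 < h n" "h n \<le> 1" "h n \<noteq> 0" for n by (auto simp: h_def)
  have h0: "h \<longlonglongrightarrow> 0" unfolding h_def by (rule LIMSEQ_Suc[OF lim_1_over_n])
  define q where "q n x = (F (x + h n *\<^sub>R v) - F x) / h n" for n x
  have "(\<lambda>n. \<integral>x. q n x \<partial>lborel) \<longlonglongrightarrow> (\<integral>x. D x \<partial>lborel)"
  proof (rule integral_dominated_convergence[where w = "\<lambda>x. K * indicat_real (cball 0 (R + norm v)) x"])
    show "integrable lborel (\<lambda>x::'a. K * indicat_real (cball 0 (R + norm v)) x)"
      by (intro integrable_mult_right integrable_real_indicator) (use emeasure_lborel_cball_finite in auto)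
    show "AE x in lborel. (\<lambda>n. q n x) \<longlonglongrightarrow> D x"
    proof (rule AE_I2)
      fix x
      have "((\<lambda>s. (F (x + s *\<^sub>R v) - F x) / s) \<longlongrightarrow> D x) (at 0)"
        using d[of x] by (simp add: DERIV_def)
      moreover have "filterlim h (at 0) sequentially" using h h0 by (auto simp: filterlim_at)
      ultimately show "(\<lambda>n. q n x) \<longlonglongrightarrow> D x" unfolding q_def by (rule filterlim_compose)
    qed
    show "AE x in lborel. norm (q n x) \<le> K * indicat_real (cball 0 (R + norm v)) x" for n
    proof (rule AE_I2)
      fix x
      have "\<exists>s>0. s < h n \<and> F (x + h n *\<^sub>R v) - F (x + 0 *\<^sub>R v) = (h n - 0) * D (x + s *\<^sub>R v)"
        by (rule MVT2[of 0 "h n" "\<lambda>s. F (x + s *\<^sub>R v)"]) (use h dd in auto)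
      then obtain s where s: "0 < s" "s < h n" "F (x + h n *\<^sub>R v) - F x = h n * D (x + s *\<^sub>R v)" by auto
      then have q: "q n x = D (x + s *\<^sub>R v)" using h[of n] by (simp add: q_def)
      show "norm (q n x) \<le> K * indicat_real (cball 0 (R + norm v)) x"
      proof (cases "x \<in> cball 0 (R + norm v)")
        case True
        then show ?thesis using q DK by simp
      next
        case False
        have "norm (s *\<^sub>R v) \<le> norm v" using s h(2)[of n] by (simp add: mult_left_le_one_le)
        moreover have "norm x \<le> norm (x + s *\<^sub>R v) + norm (s *\<^sub>R v)"
          using norm_triangle_ineq4[of "x + s *\<^sub>R v" "s *\<^sub>R v"] by simp
        ultimately have "R \<le> norm (x + s *\<^sub>R v)" using False by simp
        then show ?thesis using q supp(2) False by simp
      qed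
    qed
  qed (unfold q_def, measurable)
  moreover have "(\<integral>x. q n x \<partial>lborel) = 0" for n
  proof -
    have F: "integrable (distr lborel borel ((+) (h n *\<^sub>R v))) F"
      using int unfolding lborel_distr_plus .
    have i2: "integrable lborel (\<lambda>x. F (x + h n *\<^sub>R v))"
      using integrable_distr[OF _ F] by (simp add: add.commute)
    have "(\<integral>x. F (x + h n *\<^sub>R v) \<partial>lborel) = (\<integral>x. F x \<partial>distr lborel borel ((+) (h n *\<^sub>R v)))"
      by (subst integral_distr) (auto simp: add.commute)
    also have "\<dots> = (\<integral>x. F x \<partial>lborel)" unfolding lborel_distr_plus ..
    finally have "(\<integral>x. F (x + h n *\<^sub>R v) - F x \<partial>lborel) = 0"
      using i2 int by simp
    then show ?thesis by (simp add: q_def)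
  qed
  ultimately have "(\<lambda>n::nat. 0::real) \<longlonglongrightarrow> (\<integral>x. D x \<partial>lborel)" by simp
  then show ?thesis using LIMSEQ_unique[OF tendsto_const] by metis
qed

section \<open>The divergence theorem for radial vector fields\<close>

lemma has_derivative_along_line:
  fixes F :: "'a::real_normed_vector \<Rightarrow> real"
  assumes "(F has_derivative F') (at x)"
  shows "((\<lambda>s. F (x + s *\<^sub>R v)) has_real_derivative F' v) (at 0)"
proof -
  interpret bounded_linear F' using assms by (rule has_derivative_bounded_linear)
  have "((\<lambda>s. x + s *\<^sub>R v) has_derivative (\<lambda>h. h *\<^sub>R v)) (at 0)"
    by (auto intro!: derivative_eq_intros)
  moreover have "(F has_derivative F') (at (x + 0 *\<^sub>R v))" using assms by simp
  ultimately have "((\<lambda>s. F (x + s *\<^sub>R v)) has_derivative (\<lambda>h. F' (h *\<^sub>R v))) (at 0)"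
    by (rule has_derivative_compose)
  then show ?thesis by (simp add: has_field_derivative_def scaleR mult_commute_abs)
qed

lemma integrable_continuous_ball:
  fixes f :: "'a::euclidean_space \<Rightarrow> real"
  assumes "continuous_on UNIV f" "\<And>x. 1 \<le> norm x \<Longrightarrow> f x = 0"
  shows "integrable lborel f"
proof -
  have "integrable lborel (\<lambda>x. indicat_real (cball 0 1) x *\<^sub>R f x)"
    by (rule borel_integrable_compact) (auto intro: continuous_on_subset[OF assms(1)])
  moreover have "(\<lambda>x. indicat_real (cball 0 1) x *\<^sub>R f x) = f"
    using assms(2) by (auto simp: fun_eq_iff indicator_def)
  ultimately show ?thesis by simp
qed

text \<open>The coefficient of the vector field \<theta>(|x|^2) x. It is asked to be only C^1,
  because in \<open>gradient_energy_bump\<close> it is built from the solution itself.\<close>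

locale radial_field =
  fixes \<theta> \<theta>' :: "real \<Rightarrow> real" and c d :: real
  assumes theta_deriv: "\<And>s. (\<theta> has_real_derivative \<theta>' s) (at s)"
    and theta'_cont: "continuous_on UNIV \<theta>'"
    and cd: "0 < c" "c < d" "d < 1"
    and theta_out: "\<And>s. s \<notin> {c..d} \<Longrightarrow> \<theta> s = 0"
begin

lemma theta'_out: "s \<notin> {c..d} \<Longrightarrow> \<theta>' s = 0"
  using deriv_zero_outside[OF theta_out _ theta_deriv] .

lemma theta_cont: "continuous_on UNIV \<theta>"
  by (rule DERIV_continuous_on[where D = \<theta>']) (use theta_deriv in simp)

lemma out_of_ball: "1 \<le> norm x \<Longrightarrow> (norm x)\<^sup>2 \<notin> {c..d}"
  using cd one_le_power[of "norm x" 2] by (auto simp del: one_le_power)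

lemma cont_comp:
  "continuous_on UNIV (\<lambda>x::'a::euclidean_space. \<theta> ((norm x)\<^sup>2))"
  "continuous_on UNIV (\<lambda>x::'a::euclidean_space. \<theta>' ((norm x)\<^sup>2))"
  by (rule continuous_on_compose2[OF theta_cont], intro continuous_intros, simp,
      rule continuous_on_compose2[OF theta'_cont], intro continuous_intros, simp)

text \<open>The divergence of \<theta>(|x|^2) x in dimension \<open>n\<close>, as a function of s =
  |x|^2.\<close>

definition div_coeff :: "nat \<Rightarrow> real \<Rightarrow> real" where
  "div_coeff n s = real n * \<theta> s + 2 * s * \<theta>' s"

lemma div_coeff_out: "s \<notin> {c..d} \<Longrightarrow> div_coeff n s = 0"
  using theta_out theta'_out by (simp add: div_coeff_def)

lemma div_coeff_cont: "continuous_on UNIV (\<lambda>x::'a::euclidean_space. div_coeff n ((norm x)\<^sup>2))"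
  unfolding div_coeff_def by (intro continuous_intros cont_comp)

text \<open>\<open>D i\<close> is the i-th partial derivative of the i-th component of \<phi> times
  the field; each has integral zero, and their sum is the product rule for the divergence.\<close>

lemma divergence_radial:
  fixes \<phi> :: "real^'n \<Rightarrow> real"
  assumes phi: "smooth_k (Suc 0) \<phi>"
  shows "(\<integral>x. \<theta> ((norm x)\<^sup>2) * (pgrad \<phi> x \<bullet> x) \<partial>lborel)
     = - (\<integral>x. \<phi> x * div_coeff CARD('n) ((norm x)\<^sup>2) \<partial>lborel)"
proof -
  have pd: "(\<phi> has_derivative frechet_derivative \<phi> (at x)) (at x)" for x
    by (rule smooth_k_SucD(1)[OF phi])
  have polar_const: "continuous_on UNIV (\<lambda>x. frechet_derivative \<phi> (at x) (axis i 1))" for i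
    using smooth_k_SucD(2)[OF phi, of i] by simp
  have c\<phi>: "continuous_on UNIV \<phi>" using smooth_k_continuous[OF phi] .
  define D where "D i x = \<phi> x * (\<theta> ((norm x)\<^sup>2) * (axis i 1 \<bullet> (axis i 1 :: real^'n)) + \<theta>' ((norm x)\<^sup>2) * (2 * (x \<bullet> axis i 1)) * (x \<bullet> axis i 1))
     + frechet_derivative \<phi> (at x) (axis i 1) * (\<theta> ((norm x)\<^sup>2) * (x \<bullet> axis i 1))" for i and x :: "real^'n"
  have cD: "continuous_on UNIV (D i)" for i
    unfolding D_def by (intro continuous_intros c\<phi> polar_const cont_comp)
  have D0: "D i x = 0" if "1 \<le> norm x" for i x
    using theta_out[OF out_of_ball[OF that]] theta'_out[OF out_of_ball[OF that]] by (simp add: D_def)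
  have Dint: "(\<integral>x. D i x \<partial>lborel) = 0" for i
  proof (rule integral_directional_derivative[where v = "axis i 1" and R = 1
        and F = "\<lambda>x. \<phi> x * (\<theta> ((norm x)\<^sup>2) * (x \<bullet> axis i 1))"])
    fix x :: "real^'n"
    have t1: "((\<lambda>x. \<theta> ((norm x)\<^sup>2)) has_derivative (\<lambda>h. \<theta>' ((norm x)\<^sup>2) * (2 * (x \<bullet> h)))) (at x)"
      by (rule radial_has_derivative[OF theta_deriv])
    have t2: "((\<lambda>x::real^'n. x \<bullet> axis i 1) has_derivative (\<lambda>h. h \<bullet> axis i 1)) (at x)"
      by (auto intro!: derivative_eq_intros)
    have "((\<lambda>x. \<phi> x * (\<theta> ((norm x)\<^sup>2) * (x \<bullet> axis i 1))) has_derivative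
        (\<lambda>h. \<phi> x * (\<theta> ((norm x)\<^sup>2) * (h \<bullet> axis i 1) + \<theta>' ((norm x)\<^sup>2) * (2 * (x \<bullet> h)) * (x \<bullet> axis i 1))
          + frechet_derivative \<phi> (at x) h * (\<theta> ((norm x)\<^sup>2) * (x \<bullet> axis i 1)))) (at x)"
      by (intro has_derivative_mult t1 t2 pd)
    from has_derivative_along_line[OF this, of "axis i 1"]
    show "((\<lambda>s. \<phi> (x + s *\<^sub>R axis i 1) * (\<theta> ((norm (x + s *\<^sub>R axis i 1))\<^sup>2) * ((x + s *\<^sub>R axis i 1) \<bullet> axis i 1)))
        has_real_derivative D i x) (at 0)" unfolding D_def .
  next
    show "continuous_on UNIV (\<lambda>x. \<phi> x * (\<theta> ((norm x)\<^sup>2) * (x \<bullet> axis i 1)))"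
      by (intro continuous_intros c\<phi> cont_comp)
  qed (use cD D0 theta_out[OF out_of_ball] in auto)
  have sumD: "(\<Sum>i\<in>UNIV. D i x) = \<theta> ((norm x)\<^sup>2) * (pgrad \<phi> x \<bullet> x) + \<phi> x * div_coeff CARD('n) ((norm x)\<^sup>2)" for x
  proof -
    have n: "(norm x)\<^sup>2 = (\<Sum>i\<in>UNIV. (x $ i)\<^sup>2)"
      unfolding power2_norm_eq_inner inner_vec_def by (simp add: power2_eq_square)
    have "(\<Sum>i\<in>UNIV. D i x) = (\<Sum>i\<in>UNIV. \<phi> x * \<theta> ((norm x)\<^sup>2) + \<phi> x * \<theta>' ((norm x)\<^sup>2) * 2 * (x $ i)\<^sup>2
        + \<theta> ((norm x)\<^sup>2) * (frechet_derivative \<phi> (at x) (axis i 1) * x $ i))"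
      by (rule sum.cong) (auto simp: D_def inner_axis inner_axis_axis distrib_left power2_eq_square mult_ac)
    also have "\<dots> = real CARD('n) * (\<phi> x * \<theta> ((norm x)\<^sup>2)) + \<phi> x * \<theta>' ((norm x)\<^sup>2) * 2 * (norm x)\<^sup>2
        + \<theta> ((norm x)\<^sup>2) * (pgrad \<phi> x \<bullet> x)"
      unfolding sum.distrib n by (simp add: sum_distrib_left[symmetric] pgrad_def inner_vec_def)
    finally show ?thesis by (simp add: div_coeff_def algebra_simps)
  qed
  have cpg: "continuous_on UNIV (pgrad \<phi>)"
    unfolding pgrad_def by (intro continuous_on_vec_lambda polar_const)
  have i1: "integrable lborel (\<lambda>x. \<theta> ((norm x)\<^sup>2) * (pgrad \<phi> x \<bullet> x))"
    by (rule integrable_continuous_ball)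
       (use theta_out[OF out_of_ball] in \<open>auto intro!: continuous_intros cont_comp cpg\<close>)
  have i2: "integrable lborel (\<lambda>x. \<phi> x * div_coeff CARD('n) ((norm x)\<^sup>2))"
    by (rule integrable_continuous_ball)
       (use div_coeff_out[OF out_of_ball] in \<open>auto intro!: continuous_intros div_coeff_cont c\<phi>\<close>)
  have "(\<integral>x. (\<Sum>i\<in>UNIV. D i x) \<partial>lborel) = (\<Sum>i\<in>UNIV. \<integral>x. D i x \<partial>lborel)"
    by (intro Bochner_Integration.integral_sum integrable_continuous_ball cD D0)
  also have "\<dots> = 0" by (simp add: Dint)
  finally show ?thesis using i1 i2 unfolding sumD by simp
qed

end

section \<open>L^2 pairings and weak gradients of H^1 functions\<close>

lemma integrable_inner_L2:
  fixes f g :: "'a \<Rightarrow> 'b::euclidean_space"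
  assumes [measurable]: "f \<in> borel_measurable M" "g \<in> borel_measurable M"
    and f: "integrable M (\<lambda>x. (norm (f x))\<^sup>2)" and g: "integrable M (\<lambda>x. (norm (g x))\<^sup>2)"
    and e: "0 < e"
  shows "integrable M (\<lambda>x. f x \<bullet> g x)"
    and "\<bar>\<integral>x. f x \<bullet> g x \<partial>M\<bar> \<le> (\<integral>x. (norm (f x))\<^sup>2 \<partial>M) / e + e * (\<integral>x. (norm (g x))\<^sup>2 \<partial>M)"
proof -
  \<comment> \<open>Young's inequality with a free parameter \<open>e\<close> replaces
    Cauchy-Schwarz for integrals; \<open>e\<close> is tuned when a limit is taken.\<close>
  have b: "\<bar>f x \<bullet> g x\<bar> \<le> (norm (f x))\<^sup>2 / e + e * (norm (g x))\<^sup>2" for x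
  proof -
    define a b where "a = norm (f x)" and "b = norm (g x)"
    have "\<bar>f x \<bullet> g x\<bar> \<le> a * b" unfolding a_def b_def by (rule Cauchy_Schwarz_ineq2)
    also have "a * b \<le> a\<^sup>2 / e + e * b\<^sup>2"
    proof -
      have "0 \<le> (a - e * b)\<^sup>2 / e" using e by simp
      also have "\<dots> = a\<^sup>2 / e + e * b\<^sup>2 - 2 * (a * b)" using e by (simp add: power2_eq_square field_simps)
      finally have "2 * (a * b) \<le> a\<^sup>2 / e + e * b\<^sup>2" by simp
      moreover have "0 \<le> a * b" by (simp add: a_def b_def)
      ultimately show ?thesis by linarith
    qed
    finally show ?thesis by (simp add: a_def b_def)
  qed
  have i: "integrable M (\<lambda>x. (norm (f x))\<^sup>2 / e + e * (norm (g x))\<^sup>2)" using f g by simp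
  show int: "integrable M (\<lambda>x. f x \<bullet> g x)"
    by (rule Bochner_Integration.integrable_bound[OF i])
       (auto intro!: AE_I2 order_trans[OF b] simp del: abs_of_nonneg)
  have "\<bar>\<integral>x. f x \<bullet> g x \<partial>M\<bar> \<le> (\<integral>x. \<bar>f x \<bullet> g x\<bar> \<partial>M)" by (rule integral_abs_bound)
  also have "\<dots> \<le> (\<integral>x. (norm (f x))\<^sup>2 / e + e * (norm (g x))\<^sup>2 \<partial>M)"
    using int i b by (intro integral_mono) auto
  also have "\<dots> = (\<integral>x. (norm (f x))\<^sup>2 \<partial>M) / e + e * (\<integral>x. (norm (g x))\<^sup>2 \<partial>M)"
    using f g by simp
  finally show "\<bar>\<integral>x. f x \<bullet> g x \<partial>M\<bar> \<le> (\<integral>x. (norm (f x))\<^sup>2 \<partial>M) / e + e * (\<integral>x. (norm (g x))\<^sup>2 \<partial>M)" .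
qed

lemma L2_pairing_tendsto_0:
  fixes v :: "nat \<Rightarrow> 'a \<Rightarrow> 'b::euclidean_space"
  assumes [measurable]: "\<And>k. v k \<in> borel_measurable M" "X \<in> borel_measurable M"
    and X: "integrable M (\<lambda>x. (norm (X x))\<^sup>2)"
    and lim: "((\<lambda>k. \<integral>\<^sup>+x. ennreal ((norm (v k x))\<^sup>2) \<partial>M) \<longlongrightarrow> 0) sequentially"
  shows "eventually (\<lambda>k. integrable M (\<lambda>x. v k x \<bullet> X x)) sequentially"
    and "(\<lambda>k. \<integral>x. v k x \<bullet> X x \<partial>M) \<longlonglongrightarrow> 0"
proof -
  have small: "\<forall>\<^sub>F k in sequentially. integrable M (\<lambda>x. (norm (v k x))\<^sup>2) \<and> (\<integral>x. (norm (v k x))\<^sup>2 \<partial>M) < r"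
    if r: "0 < r" for r :: real
  proof -
    have "\<forall>\<^sub>F k in sequentially. (\<integral>\<^sup>+x. ennreal ((norm (v k x))\<^sup>2) \<partial>M) < ennreal r"
      using order_tendstoD(2)[OF lim, of "ennreal r"] r by simp
    then show ?thesis
    proof eventually_elim
      case (elim k)
      have i: "integrable M (\<lambda>x. (norm (v k x))\<^sup>2)"
        using elim by (intro integrableI_nonneg) (auto intro: less_trans)
      moreover have "ennreal (\<integral>x. (norm (v k x))\<^sup>2 \<partial>M) < ennreal r"
        using elim nn_integral_eq_integral[OF i] by simp
      ultimately show ?case using r by (simp add: ennreal_less_iff integral_nonneg_AE)
    qed
  qed
  show "eventually (\<lambda>k. integrable M (\<lambda>x. v k x \<bullet> X x)) sequentially"
    using small[OF zero_less_one] by eventually_elim (use X integrable_inner_L2(1)[of _ M X 1] in auto)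
  define b where "b = (\<integral>x. (norm (X x))\<^sup>2 \<partial>M)"
  have b: "0 \<le> b" unfolding b_def by (rule integral_nonneg_AE) simp
  show "(\<lambda>k. \<integral>x. v k x \<bullet> X x \<partial>M) \<longlonglongrightarrow> 0"
  proof (rule tendstoI)
    fix r :: real assume r: "0 < r"
    \<comment> \<open>Makes the fixed part e b at most r/2; the remaining part is then below r/2 for
      all large \<open>k\<close>.\<close>
    define e where "e = r / (2 * (b + 1))"
    have e: "0 < e" using r b by (simp add: e_def)
    have "e * b \<le> e * (b + 1)" using e by simp
    also have "\<dots> = r / 2" using b by (simp add: e_def field_simps)
    finally have eb: "e * b \<le> r / 2" .
    have "0 < e * (r / 2)" using e r by simp
    from small[OF this] show "\<forall>\<^sub>F k in sequentially. dist (\<integral>x. v k x \<bullet> X x \<partial>M) 0 < r"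
    proof eventually_elim
      case (elim k)
      have "\<bar>\<integral>x. v k x \<bullet> X x \<partial>M\<bar> \<le> (\<integral>x. (norm (v k x))\<^sup>2 \<partial>M) / e + e * b"
        unfolding b_def using elim X e by (intro integrable_inner_L2(2)) auto
      also have "(\<integral>x. (norm (v k x))\<^sup>2 \<partial>M) / e < r / 2" using elim e by (simp add: field_simps)
      finally show ?case using eb by (simp add: dist_real_def)
    qed
  qed
qed

definition vol_weight :: "real^'n \<Rightarrow> real" where
  "vol_weight x = indicat_real (ball 0 1) x * (2 / (1 - (norm x)\<^sup>2)) ^ CARD('n)"

lemma vol_weight_nonneg: "0 \<le> vol_weight x"
proof (cases "x \<in> ball 0 1")
  case True
  then have "(norm x)\<^sup>2 < 1" by (simp add: power_less_one_iff)
  then show ?thesis by (simp add: vol_weight_def)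
qed (simp add: vol_weight_def)

lemma vol_weight_measurable[measurable]: "vol_weight \<in> borel_measurable borel"
  unfolding vol_weight_def[abs_def]
  by (intro borel_measurable_times borel_measurable_indicator borel_measurable_power borel_measurable_divide
      borel_measurable_diff borel_measurable_const borel_measurable_norm measurable_ident_sets) auto

lemma hypvol_eq: "(hypvol :: (real^'n) measure) = density lborel (\<lambda>x. ennreal (vol_weight x))"
proof -
  have "(\<lambda>x::real^'n. indicator (ball 0 1) x * ennreal ((2 / (1 - (norm x)\<^sup>2)) ^ CARD('n))) = (\<lambda>x. ennreal (vol_weight x))"
    by (auto simp: fun_eq_iff vol_weight_def indicator_def)
  then show ?thesis unfolding hypvol_def by simp
qed

text \<open>The conformal factor is at least 1 in the ball, so for N \<ge> 2 the hyperbolic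
  Dirichlet integrand dominates the Euclidean one. Convergence in H^1 therefore entails Euclidean
  L^2 convergence of gradients.\<close>

lemma vol_weight_hgrad_sq:
  fixes x v :: "real^'n"
  assumes N: "2 \<le> CARD('n)" and x: "x \<in> ball 0 1"
  shows "vol_weight x * hgrad_sq x v = (2 / (1 - (norm x)\<^sup>2)) ^ (CARD('n) - 2) * (norm v)\<^sup>2"
    and "(norm v)\<^sup>2 \<le> vol_weight x * hgrad_sq x v"
    and "1 \<le> 2 / (1 - (norm x)\<^sup>2)"
proof -
  define a where "a = 2 / (1 - (norm x)\<^sup>2)"
  have r: "(norm x)\<^sup>2 < 1" using x by (simp add: power_less_one_iff)
  have a: "1 \<le> a" using r by (simp add: a_def field_simps)
  then show "1 \<le> 2 / (1 - (norm x)\<^sup>2)" by (simp add: a_def)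
  have "hgrad_sq x v = (1 / a)\<^sup>2 * (norm v)\<^sup>2" by (simp add: hgrad_sq_def a_def)
  moreover have "vol_weight x = a ^ CARD('n)" using x by (simp add: vol_weight_def a_def)
  moreover have "a ^ CARD('n) = a ^ (CARD('n) - 2) * a\<^sup>2" 
    by (metis N le_add_diff_inverse2 power_add)
  ultimately have eq: "vol_weight x * hgrad_sq x v = a ^ (CARD('n) - 2) * (norm v)\<^sup>2"
    using a by (simp add: power_divide)
  then show "vol_weight x * hgrad_sq x v = (2 / (1 - (norm x)\<^sup>2)) ^ (CARD('n) - 2) * (norm v)\<^sup>2"
    by (simp add: a_def)
  have "1 * (norm v)\<^sup>2 \<le> a ^ (CARD('n) - 2) * (norm v)\<^sup>2"
    using a by (intro mult_right_mono one_le_power) auto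
  then show "(norm v)\<^sup>2 \<le> vol_weight x * hgrad_sq x v" using eq by simp
qed

lemma continuous_pgrad:
  assumes "test_fun \<phi>"
  shows "continuous_on UNIV (pgrad \<phi>)"
proof -
  have "smooth_k (Suc 0) \<phi>" using assms unfolding test_fun_def by blast
  then show ?thesis unfolding pgrad_def by (intro continuous_on_vec_lambda) simp
qed

text \<open>Limit of \<open>divergence_radial\<close> along the approximating test functions: both
  sides are L^2 pairings with a fixed continuous field that vanishes outside the ball.\<close>

lemma (in radial_field) H1_weak_gradient:
  fixes u :: "real^'n \<Rightarrow> real"
  assumes N: "2 \<le> CARD('n)" and H: "H1 u G"
  shows "integrable lborel (\<lambda>x. \<theta> ((norm x)\<^sup>2) * (G x \<bullet> x))"
    and "integrable lborel (\<lambda>x. u x * div_coeff CARD('n) ((norm x)\<^sup>2))"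
    and "(\<integral>x. \<theta> ((norm x)\<^sup>2) * (G x \<bullet> x) \<partial>lborel) = - (\<integral>x. u x * div_coeff CARD('n) ((norm x)\<^sup>2) \<partial>lborel)"
proof -
  have um[measurable]: "u \<in> borel_measurable borel" and Gm[measurable]: "G \<in> borel_measurable borel"
    using H by (auto simp: H1_def)
  obtain \<phi> where \<phi>: "\<And>k. test_fun (\<phi> k)"
    and l1: "((\<lambda>k. \<integral>\<^sup>+ x. ennreal ((\<phi> k x - u x)\<^sup>2) \<partial>hypvol) \<longlongrightarrow> 0) sequentially"
    and l2: "((\<lambda>k. \<integral>\<^sup>+ x. ennreal (hgrad_sq x (pgrad (\<phi> k) x - G x)) \<partial>hypvol) \<longlongrightarrow> 0) sequentially"
    using H by (auto simp: H1_def)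
  have s1: "smooth_k (Suc 0) (\<phi> k)" for k using \<phi>[of k] unfolding test_fun_def by blast
  have c1: "continuous_on UNIV (\<phi> k)" for k by (rule smooth_k_continuous[OF s1])
  have c2: "continuous_on UNIV (pgrad (\<phi> k))" for k by (rule continuous_pgrad[OF \<phi>])
  have [measurable]: "\<phi> k \<in> borel_measurable borel" "pgrad (\<phi> k) \<in> borel_measurable borel" for k
    using c1 c2 by (auto intro: borel_measurable_continuous_onI)
  have hm[measurable]: "(\<lambda>x. hgrad_sq x (pgrad (\<phi> k) x - G x)) \<in> borel_measurable borel" for k
    unfolding hgrad_sq_def by measurable
  define X where "X x = \<theta> ((norm x)\<^sup>2) *\<^sub>R x" for x :: "real^'n"
  define Y where "Y x = div_coeff CARD('n) ((norm x)\<^sup>2)" for x :: "real^'n"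
  have cX: "continuous_on UNIV X" unfolding X_def by (intro continuous_intros cont_comp)
  have cY: "continuous_on UNIV Y" unfolding Y_def by (rule div_coeff_cont)
  have X0: "X x = 0" if "1 \<le> norm x" for x using theta_out[OF out_of_ball[OF that]] by (simp add: X_def)
  have Y0: "Y x = 0" if "1 \<le> norm x" for x using div_coeff_out[OF out_of_ball[OF that]] by (simp add: Y_def)
  have [measurable]: "X \<in> borel_measurable borel" "Y \<in> borel_measurable borel"
    using cX cY by (auto intro: borel_measurable_continuous_onI)
  have X2: "integrable lborel (\<lambda>x. (norm (X x))\<^sup>2)"
    by (rule integrable_continuous_ball) (auto simp: X0 intro!: continuous_intros cX)
  have Y2: "integrable lborel (\<lambda>x. (norm (Y x))\<^sup>2)"
    by (rule integrable_continuous_ball) (auto simp: Y0 intro!: continuous_intros cY)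
  \<comment> \<open>Outside the ball \<open>u\<close> and \<open>G\<close> are arbitrary, as
    \<open>hypvol\<close> does not see them; the indicator removes these values.\<close>
  define v where "v k x = indicat_real (ball 0 1) x *\<^sub>R (pgrad (\<phi> k) x - G x)" for k x
  define w where "w k x = indicat_real (ball 0 1) x *\<^sub>R (\<phi> k x - u x)" for k x
  have [measurable]: "v k \<in> borel_measurable borel" "w k \<in> borel_measurable borel" for k
    unfolding v_def[abs_def] w_def[abs_def]
    by (intro borel_measurable_scaleR borel_measurable_indicator borel_measurable_diff; simp)+
  have lv: "((\<lambda>k. \<integral>\<^sup>+ x. ennreal ((norm (v k x))\<^sup>2) \<partial>lborel) \<longlongrightarrow> 0) sequentially"
  proof (rule tendsto_sandwich[OF _ _ tendsto_const l2])
    show "\<forall>\<^sub>F k in sequentially. (\<integral>\<^sup>+ x. ennreal ((norm (v k x))\<^sup>2) \<partial>lborel)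
        \<le> (\<integral>\<^sup>+ x. ennreal (hgrad_sq x (pgrad (\<phi> k) x - G x)) \<partial>hypvol)"
    proof (rule always_eventually, rule allI)
      fix k
      have "(\<integral>\<^sup>+ x. ennreal ((norm (v k x))\<^sup>2) \<partial>lborel)
          \<le> (\<integral>\<^sup>+ x. ennreal (vol_weight x) * ennreal (hgrad_sq x (pgrad (\<phi> k) x - G x)) \<partial>lborel)"
      proof (rule nn_integral_mono)
        fix x
        show "ennreal ((norm (v k x))\<^sup>2) \<le> ennreal (vol_weight x) * ennreal (hgrad_sq x (pgrad (\<phi> k) x - G x))"
          using vol_weight_hgrad_sq(2)[OF N, of x "pgrad (\<phi> k) x - G x"]
          by (cases "x \<in> ball 0 1") (auto simp: v_def ennreal_mult'[symmetric] vol_weight_nonneg intro!: ennreal_leI)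
      qed
      then show "(\<integral>\<^sup>+ x. ennreal ((norm (v k x))\<^sup>2) \<partial>lborel)
        \<le> (\<integral>\<^sup>+ x. ennreal (hgrad_sq x (pgrad (\<phi> k) x - G x)) \<partial>hypvol)"
        unfolding hypvol_eq by (subst nn_integral_density) auto
    qed
  qed simp
  have lw: "((\<lambda>k. \<integral>\<^sup>+ x. ennreal ((norm (w k x))\<^sup>2) \<partial>lborel) \<longlongrightarrow> 0) sequentially"
  proof (rule tendsto_sandwich[OF _ _ tendsto_const l1])
    show "\<forall>\<^sub>F k in sequentially. (\<integral>\<^sup>+ x. ennreal ((norm (w k x))\<^sup>2) \<partial>lborel)
        \<le> (\<integral>\<^sup>+ x. ennreal ((\<phi> k x - u x)\<^sup>2) \<partial>hypvol)"
    proof (rule always_eventually, rule allI)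
      fix k
      have "(\<integral>\<^sup>+ x. ennreal ((norm (w k x))\<^sup>2) \<partial>lborel)
          \<le> (\<integral>\<^sup>+ x. ennreal (vol_weight x) * ennreal ((\<phi> k x - u x)\<^sup>2) \<partial>lborel)"
      proof (rule nn_integral_mono)
        fix x
        show "ennreal ((norm (w k x))\<^sup>2) \<le> ennreal (vol_weight x) * ennreal ((\<phi> k x - u x)\<^sup>2)"
        proof (cases "x \<in> ball 0 1")
          case True
          have "1 \<le> vol_weight x" using True vol_weight_hgrad_sq(3)[OF N True] by (simp add: vol_weight_def)
          then have "1 * (\<phi> k x - u x)\<^sup>2 \<le> vol_weight x * (\<phi> k x - u x)\<^sup>2" by (intro mult_right_mono) auto
          then show ?thesis using True by (auto simp: w_def ennreal_mult'[symmetric] vol_weight_nonneg intro!: ennreal_leI)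
        qed (simp add: w_def)
      qed
      then show "(\<integral>\<^sup>+ x. ennreal ((norm (w k x))\<^sup>2) \<partial>lborel) \<le> (\<integral>\<^sup>+ x. ennreal ((\<phi> k x - u x)\<^sup>2) \<partial>hypvol)"
        unfolding hypvol_eq by (subst nn_integral_density) auto
    qed
  qed simp
  have pv: "eventually (\<lambda>k. integrable lborel (\<lambda>x. v k x \<bullet> X x)) sequentially"
    "(\<lambda>k. \<integral>x. v k x \<bullet> X x \<partial>lborel) \<longlonglongrightarrow> 0"
    using L2_pairing_tendsto_0[OF _ _ X2 lv] by auto
  have pw: "eventually (\<lambda>k. integrable lborel (\<lambda>x. w k x \<bullet> Y x)) sequentially"
    "(\<lambda>k. \<integral>x. w k x \<bullet> Y x \<partial>lborel) \<longlonglongrightarrow> 0"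
    using L2_pairing_tendsto_0[OF _ _ Y2 lw] by auto
  have vX: "v k x \<bullet> X x = pgrad (\<phi> k) x \<bullet> X x - G x \<bullet> X x" for k x
    using X0[of x] by (cases "norm x < 1") (auto simp: v_def inner_diff_left)
  have wY: "w k x \<bullet> Y x = \<phi> k x * Y x - u x * Y x" for k x
    using Y0[of x] by (cases "norm x < 1") (auto simp: w_def left_diff_distrib)
  have ip: "integrable lborel (\<lambda>x. pgrad (\<phi> k) x \<bullet> X x)" for k
    by (rule integrable_continuous_ball) (auto simp: X0 intro!: continuous_intros cX c2)
  have iq: "integrable lborel (\<lambda>x. \<phi> k x * Y x)" for k
    by (rule integrable_continuous_ball) (auto simp: Y0 intro!: continuous_intros cY c1)
  obtain k where k: "integrable lborel (\<lambda>x. v k x \<bullet> X x)" using eventually_happens'[OF sequentially_bot pv(1)] by blast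
  have iG: "integrable lborel (\<lambda>x. G x \<bullet> X x)"
    using Bochner_Integration.integrable_diff[OF ip[of k] k] by (simp add: vX)
  obtain k where k: "integrable lborel (\<lambda>x. w k x \<bullet> Y x)" using eventually_happens'[OF sequentially_bot pw(1)] by blast
  have iu: "integrable lborel (\<lambda>x. u x * Y x)"
    using Bochner_Integration.integrable_diff[OF iq[of k] k] by (simp add: wY del: inner_real_def)
  have GX: "G x \<bullet> X x = \<theta> ((norm x)\<^sup>2) * (G x \<bullet> x)" for x by (simp add: X_def)
  show "integrable lborel (\<lambda>x. \<theta> ((norm x)\<^sup>2) * (G x \<bullet> x))" using iG by (simp add: GX)
  show "integrable lborel (\<lambda>x. u x * div_coeff CARD('n) ((norm x)\<^sup>2))" using iu by (simp add: Y_def)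
  have "(\<lambda>k. (\<integral>x. pgrad (\<phi> k) x \<bullet> X x \<partial>lborel) - (\<integral>x. G x \<bullet> X x \<partial>lborel)) \<longlonglongrightarrow> 0"
    using pv(2) ip iG by (simp add: vX)
  then have L1: "(\<lambda>k. \<integral>x. pgrad (\<phi> k) x \<bullet> X x \<partial>lborel) \<longlonglongrightarrow> (\<integral>x. G x \<bullet> X x \<partial>lborel)"
    by (rule LIM_zero_cancel)
  have "(\<lambda>k. (\<integral>x. \<phi> k x * Y x \<partial>lborel) - (\<integral>x. u x * Y x \<partial>lborel)) \<longlonglongrightarrow> 0"
    using pw(2) iq iu unfolding wY by simp
  then have L2: "(\<lambda>k. - (\<integral>x. \<phi> k x * Y x \<partial>lborel)) \<longlonglongrightarrow> - (\<integral>x. u x * Y x \<partial>lborel)"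
    by (intro tendsto_minus) (rule LIM_zero_cancel)
  have "(\<integral>x. pgrad (\<phi> k) x \<bullet> X x \<partial>lborel) = - (\<integral>x. \<phi> k x * Y x \<partial>lborel)" for k
    using divergence_radial[OF s1[of k]] by (simp add: X_def Y_def)
  then have "(\<integral>x. G x \<bullet> X x \<partial>lborel) = - (\<integral>x. u x * Y x \<partial>lborel)"
    using LIMSEQ_unique[OF L1] L2 by simp
  then show "(\<integral>x. \<theta> ((norm x)\<^sup>2) * (G x \<bullet> x) \<partial>lborel) = - (\<integral>x. u x * div_coeff CARD('n) ((norm x)\<^sup>2) \<partial>lborel)"
    by (simp add: GX Y_def)
qed

text \<open>Weighted Young inequality with factors 1/2. For a field proportional to the weighted
  gradient of the solution the last term will be at most half the left side and can be
  absorbed.\<close>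

lemma (in radial_field) H1_gradient_pairing_le:
  fixes u :: "real^'n \<Rightarrow> real"
  assumes N: "2 \<le> CARD('n)" and H: "H1 u G" and M: "0 \<le> M" "H1_normsq u G \<le> ennreal M"
  shows "(\<integral>x. \<theta> ((norm x)\<^sup>2) * (G x \<bullet> x) \<partial>lborel)
     \<le> M / 2 + (\<integral>x. ((1 - (norm x)\<^sup>2) / 2) ^ (CARD('n) - 2) * (\<theta> ((norm x)\<^sup>2))\<^sup>2 * (norm (x::real^'n))\<^sup>2 \<partial>lborel) / 2"
proof -
  have um[measurable]: "u \<in> borel_measurable borel" and Gm[measurable]: "G \<in> borel_measurable borel"
    using H by (auto simp: H1_def)
  define E where "E x = vol_weight x * hgrad_sq x (G x)" for x
  have E0: "0 \<le> E x" for x using vol_weight_nonneg[of x] by (simp add: E_def hgrad_sq_def)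
  have [measurable]: "(\<lambda>x. hgrad_sq x (G x)) \<in> borel_measurable borel" unfolding hgrad_sq_def by measurable
  then have [measurable]: "E \<in> borel_measurable borel" unfolding E_def by measurable
  have nnE: "(\<integral>\<^sup>+x. ennreal (E x) \<partial>lborel) \<le> ennreal M"
  proof -
    have "(\<integral>\<^sup>+x. ennreal (E x) \<partial>lborel) = (\<integral>\<^sup>+x. ennreal (hgrad_sq x (G x)) \<partial>hypvol)"
      unfolding hypvol_eq by (subst nn_integral_density) (auto simp: E_def ennreal_mult' vol_weight_nonneg)
    also have "\<dots> \<le> H1_normsq u G"
      unfolding H1_normsq_def by (intro nn_integral_mono ennreal_leI) simp
    finally show ?thesis using M(2) by simp
  qed
  have iE: "integrable lborel E"
    using nnE E0 by (intro integrableI_nonneg) (auto intro: le_less_trans)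
  have "ennreal (\<integral>x. E x \<partial>lborel) \<le> ennreal M" using nnE nn_integral_eq_integral[OF iE] E0 by simp
  then have EM: "(\<integral>x. E x \<partial>lborel) \<le> M" using M(1) by simp
  define Z where "Z x = ((1 - (norm x)\<^sup>2) / 2) ^ (CARD('n) - 2) * (\<theta> ((norm x)\<^sup>2))\<^sup>2 * (norm (x::real^'n))\<^sup>2" for x
  have iZ: "integrable lborel Z"
    by (rule integrable_continuous_ball)
       (use theta_out[OF out_of_ball] in \<open>auto simp: Z_def intro!: continuous_intros cont_comp\<close>)
  have ptw: "\<theta> ((norm x)\<^sup>2) * (G x \<bullet> x) \<le> E x / 2 + Z x / 2" for x
  proof (cases "x \<in> ball 0 1")
    case True
    define a where "a = (2 / (1 - (norm x)\<^sup>2)) ^ (CARD('n) - 2)"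
    have a: "0 < a" unfolding a_def using vol_weight_hgrad_sq(3)[OF N True] by (intro zero_less_power) linarith
    have E: "E x = a * (norm (G x))\<^sup>2" unfolding E_def a_def by (rule vol_weight_hgrad_sq(1)[OF N True])
    have "((1 - (norm x)\<^sup>2) / 2) ^ (CARD('n) - 2) = 1 / a"
      by (simp add: a_def power_divide)
    then have Z: "Z x = (\<bar>\<theta> ((norm x)\<^sup>2)\<bar> * norm x)\<^sup>2 / a" by (simp add: Z_def power_mult_distrib)
    have "\<theta> ((norm x)\<^sup>2) * (G x \<bullet> x) \<le> \<bar>\<theta> ((norm x)\<^sup>2)\<bar> * \<bar>G x \<bullet> x\<bar>"
      unfolding abs_mult[symmetric] by simp
    also have "\<dots> \<le> \<bar>\<theta> ((norm x)\<^sup>2)\<bar> * (norm (G x) * norm x)"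
      by (intro mult_left_mono Cauchy_Schwarz_ineq2) simp
    also have "\<dots> = norm (G x) * (\<bar>\<theta> ((norm x)\<^sup>2)\<bar> * norm x)" by simp
    also have "\<dots> \<le> a * (norm (G x))\<^sup>2 / 2 + (\<bar>\<theta> ((norm x)\<^sup>2)\<bar> * norm x)\<^sup>2 / a / 2"
    proof -
      have "g * y \<le> a * g\<^sup>2 / 2 + y\<^sup>2 / a / 2" for g y :: real
      proof -
        have "0 \<le> (a * g - y)\<^sup>2 / (2 * a)" using a by simp
        also have "\<dots> = a * g\<^sup>2 / 2 + y\<^sup>2 / a / 2 - g * y"
          using a by (simp add: power2_eq_square field_simps)
        finally show ?thesis by simp
      qed
      then show ?thesis .
    qed
    finally show ?thesis by (simp add: E Z)
  next
    case False
    then have "1 \<le> norm x" by simp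
    then have "\<theta> ((norm x)\<^sup>2) = 0" by (rule theta_out[OF out_of_ball])
    then show ?thesis using E0[of x] by (simp add: Z_def)
  qed
  have "(\<integral>x. \<theta> ((norm x)\<^sup>2) * (G x \<bullet> x) \<partial>lborel) \<le> (\<integral>x. E x / 2 + Z x / 2 \<partial>lborel)"
    using H1_weak_gradient(1)[OF N H] iE iZ ptw by (intro integral_mono) auto
  also have "\<dots> = (\<integral>x. E x \<partial>lborel) / 2 + (\<integral>x. Z x \<partial>lborel) / 2" using iE iZ by simp
  finally show ?thesis using EM by (simp add: Z_def)
qed

text \<open>\<open>h\<close> is regular only inside (0,1); the compactly supported factor
  \<open>g\<close> extends the product to the whole line.\<close>

lemma radial_fieldI:
  fixes h h' g g' :: "real \<Rightarrow> real"
  assumes h: "\<And>s. s \<in> {0<..<1} \<Longrightarrow> (h has_real_derivative h' s) (at s)" "continuous_on {0<..<1} h'"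
    and chi: "\<And>s. (g has_real_derivative g' s) (at s)" "continuous_on UNIV g'"
    and cd: "0 < c" "c < d" "d < 1" "\<And>s. s \<notin> {c..d} \<Longrightarrow> g s = 0"
  shows "radial_field (\<lambda>s. h s * g s) (\<lambda>s. h s * g' s + h' s * g s) c d"
proof
  have out: "g' s = 0" if "s \<notin> {c..d}" for s using deriv_zero_outside[OF cd(4) that chi(1)] .
  show "((\<lambda>s. h s * g s) has_real_derivative h s * g' s + h' s * g s) (at s)" for s
  proof (cases "s \<in> {c..d}")
    case True
    then show ?thesis using cd by (intro DERIV_mult' h chi) auto
  next
    case False
    have "((\<lambda>_. 0) has_real_derivative h s * g' s + h' s * g s) (at s)"
      using out[OF False] cd(4)[OF False] by simp
    then show ?thesis
      by (rule has_field_derivative_transform_within_open[of _ _ _ "- {c..d}"]) (use False cd(4) in auto)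
  qed
  have "continuous_on {0<..<1} h"
    by (rule DERIV_continuous_on, rule has_field_derivative_at_within, rule h)
  moreover have "continuous_on {0<..<1} g"
    by (rule DERIV_continuous_on, rule has_field_derivative_at_within, rule chi)
  ultimately have 1: "continuous_on {0<..<1} (\<lambda>s. h s * g' s + h' s * g s)"
    by (intro continuous_intros h continuous_on_subset[OF chi(2)]) auto
  have 2: "continuous_on (- {c..d}) (\<lambda>s. h s * g' s + h' s * g s)"
    by (rule continuous_on_eq[OF continuous_on_const[of _ 0]]) (use out cd(4) in auto)
  have "{0<..<1} \<union> - {c..d} = (UNIV :: real set)" using cd by auto
  then show "continuous_on UNIV (\<lambda>s. h s * g' s + h' s * g s)"
    using continuous_on_open_Un[OF _ _ 1 2] by (simp add: open_Compl)
qed (use cd in auto)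

section \<open>Polar coordinates in the variable s = |x|^2\<close>

text \<open>Half the area of the unit sphere: for s = r^2 the measure r^(N-1) dr becomes s^(N/2-1)
  ds / 2.\<close>

definition polar_const :: "nat \<Rightarrow> real" where
  "polar_const N = unit_ball_vol (real N) * (real N / 2)"

lemma polar_const_pos: "0 < N \<Longrightarrow> 0 < polar_const N"
  by (simp add: polar_const_def)

text \<open>The primitive is a multiple of |s|^(N/2). \<open>5 \<le> N\<close> makes the exponent
  exceed 2, so \<open>abs_powr_has_real_derivative\<close> gives differentiability also at s =
  0.\<close>

lemma nn_integral_polar_weight:
  assumes N: "5 \<le> N" and b: "0 \<le> b" "b \<le> 1"
  shows "(\<integral>\<^sup>+s. ennreal (indicat_real {b<..<1} s * (polar_const N * s powr (real N / 2 - 1))) \<partial>lborel)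
     = ennreal (unit_ball_vol (real N) * (1 - b powr (real N / 2)))"
proof -
  define V where "V = unit_ball_vol (real N)"
  have V: "0 \<le> V" by (simp add: V_def)
  define f where "f s = V * (real N / 2 * (\<bar>s\<bar> powr (real N / 2 - 2) * s))" for s :: real
  have f: "((\<lambda>s. V * \<bar>s\<bar> powr (real N / 2)) has_real_derivative f s) (at s)" for s
    unfolding f_def using N by (intro DERIV_cmult abs_powr_has_real_derivative) auto
  have fs: "f s = polar_const N * s powr (real N / 2 - 1)" if "0 < s" for s
  proof -
    have "s powr (real N / 2 - 2) * s = s powr (real N / 2 - 1)"
      using that powr_add[of s "real N / 2 - 2" 1] by simp
    then show ?thesis using that by (simp add: f_def polar_const_def V_def)
  qed
  have f0: "0 \<le> f s" if "0 \<le> s" for s using that V by (simp add: f_def)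
  have [measurable]: "f \<in> borel_measurable borel" unfolding f_def by measurable
  have "(\<integral>\<^sup>+s. ennreal (indicat_real {b<..<1} s * (polar_const N * s powr (real N / 2 - 1))) \<partial>lborel)
     = (\<integral>\<^sup>+s. ennreal (f s) * indicator {b..1} s \<partial>lborel)"
  proof (rule nn_integral_cong_AE)
    have "AE s in lborel. s \<noteq> b" "AE s in lborel. s \<noteq> (1::real)" by (auto intro: AE_lborel_singleton)
    then show "AE s in lborel. ennreal (indicat_real {b<..<1} s * (polar_const N * s powr (real N / 2 - 1))) = ennreal (f s) * indicator {b..1} s"
      by eventually_elim (use b fs in \<open>auto simp: indicator_def\<close>)
  qed
  also have "\<dots> = ennreal (V * \<bar>1\<bar> powr (real N / 2) - V * \<bar>b\<bar> powr (real N / 2))"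
    using f b f0 by (intro nn_integral_FTC_Icc) auto
  also have "V * \<bar>1\<bar> powr (real N / 2) - V * \<bar>b\<bar> powr (real N / 2) = V * (1 - b powr (real N / 2))"
    using b by (simp add: algebra_simps)
  finally show ?thesis by (simp add: V_def)
qed

text \<open>Under |x|^2 half lines pull back to differences of concentric balls, whose volumes are
  known, and half lines determine a measure that is finite on them.\<close>

lemma polar_distr:
  assumes N: "5 \<le> CARD('n)"
  shows "distr (density lborel (indicator (ball 0 1))) borel (\<lambda>x::real^'n. (norm x)\<^sup>2)
     = density lborel (\<lambda>s. ennreal (indicat_real {0<..<1} s * (polar_const CARD('n) * s powr (real CARD('n) / 2 - 1))))"
  (is "?L = ?R")
proof (rule measure_eqI_lessThan)
  define V where "V = unit_ball_vol (real CARD('n))"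
  have V: "0 \<le> V" by (simp add: V_def)
  have ind[measurable]: "(indicator (ball 0 1) :: real^'n \<Rightarrow> ennreal) \<in> borel_measurable lborel"
    by (intro borel_measurable_indicator) simp
  have nm[measurable]: "(\<lambda>x::real^'n. (norm x)\<^sup>2) \<in> borel_measurable borel"
    by (intro borel_measurable_power borel_measurable_norm measurable_ident_sets)
  have L: "emeasure ?L {a<..} = emeasure lborel (ball 0 1 \<inter> {x::real^'n. a < (norm x)\<^sup>2})" for a
  proof -
    have S: "{x::real^'n. a < (norm x)\<^sup>2} \<in> sets borel"
      using measurable_sets[OF nm, of "{a<..}"] by (simp add: vimage_def)
    have "emeasure ?L {a<..} = emeasure (density lborel (indicator (ball 0 1))) {x::real^'n. a < (norm x)\<^sup>2}"
      by (subst emeasure_distr) (auto simp: vimage_def)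
    also have "\<dots> = (\<integral>\<^sup>+x. indicator (ball 0 1) x * indicator {x::real^'n. a < (norm x)\<^sup>2} x \<partial>lborel)"
      using S by (intro emeasure_density ind) simp
    also have "\<dots> = (\<integral>\<^sup>+x. indicator (ball 0 1 \<inter> {x::real^'n. a < (norm x)\<^sup>2}) x \<partial>lborel)"
      by (intro nn_integral_cong) (auto simp: indicator_def)
    also have "\<dots> = emeasure lborel (ball 0 1 \<inter> {x::real^'n. a < (norm x)\<^sup>2})"
      using S by (intro nn_integral_indicator) auto
    finally show ?thesis .
  qed
  have R: "emeasure ?R {a<..} = (\<integral>\<^sup>+s. ennreal (indicat_real {max 0 a<..<1} s * (polar_const CARD('n) * s powr (real CARD('n) / 2 - 1))) \<partial>lborel)" for a
    by (subst emeasure_density) (auto intro!: nn_integral_cong simp: indicator_def)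
  have ball: "emeasure lborel (ball (0::real^'n) 1) = ennreal V" by (simp add: emeasure_ball V_def)
  fix a :: real
  have "emeasure lborel (ball 0 1 \<inter> {x::real^'n. a < (norm x)\<^sup>2}) \<le> emeasure lborel (ball (0::real^'n) 1)"
    by (intro emeasure_mono) auto
  also have "\<dots> < \<infinity>" unfolding ball by simp
  finally show "emeasure ?L {a<..} < \<infinity>" unfolding L .
  consider "a < 0" | "0 \<le> a" "a < 1" | "1 \<le> a" by linarith
  then show "emeasure ?L {a<..} = emeasure ?R {a<..}"
  proof cases
    case 1
    then have "ball 0 1 \<inter> {x::real^'n. a < (norm x)\<^sup>2} = ball 0 1"
      by (auto intro: less_le_trans[OF _ zero_le_power2])
    then show ?thesis unfolding L R using nn_integral_polar_weight[OF N, of 0] 1 ball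
      by (simp add: max_def V_def)
  next
    case 2
    have eq: "ball 0 1 \<inter> {x::real^'n. a < (norm x)\<^sup>2} = ball 0 1 - cball 0 (sqrt a)"
      using 2 by (auto simp: not_le real_less_rsqrt dest: real_sqrt_less_mono)
        (metis real_le_rsqrt not_le)
    have sq: "sqrt a ^ CARD('n) = a powr (real CARD('n) / 2)"
      using 2 by (simp add: powr_half_sqrt[symmetric] powr_powr powr_realpow'[symmetric])
    have "emeasure lborel (ball 0 1 - cball 0 (sqrt a) :: (real^'n) set)
       = emeasure lborel (ball (0::real^'n) 1) - emeasure lborel (cball (0::real^'n) (sqrt a))"
    proof (rule emeasure_Diff)
      have "sqrt a < 1" using 2 by simp
      then show "cball 0 (sqrt a) \<subseteq> ball (0::real^'n) 1" unfolding cball_def ball_def by (auto simp del: real_sqrt_lt_1_iff)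
      show "emeasure lborel (cball (0::real^'n) (sqrt a)) \<noteq> \<infinity>" using emeasure_lborel_cball_finite[of 0 "sqrt a"] by (metis less_irrefl)
    qed auto
    also have "\<dots> = ennreal V - ennreal (V * sqrt a ^ CARD('n))"
      using 2 by (simp add: ball emeasure_cball V_def)
    also have "\<dots> = ennreal (V * (1 - a powr (real CARD('n) / 2)))"
      using V 2 by (simp add: sq ennreal_minus algebra_simps)
    finally show ?thesis unfolding L R eq using nn_integral_polar_weight[OF N, of a] 2
      by (simp add: max_def V_def)
  next
    case 3
    have "(norm x)\<^sup>2 < 1" if "x \<in> ball 0 1" for x :: "real^'n"
      using that by (simp add: power_less_one_iff)
    then have "ball 0 1 \<inter> {x::real^'n. a < (norm x)\<^sup>2} = {}" using 3 by force
    moreover have "{max 0 a<..<1} = {}" using 3 by auto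
    ultimately show ?thesis unfolding L R by simp
  qed
qed simp_all

lemma AE_radial:
  assumes N: "5 \<le> CARD('n)" and P: "AE s in lborel. s \<in> {0<..<1} \<longrightarrow> P s"
  shows "AE x::real^'n in lborel. x \<in> ball 0 1 \<longrightarrow> x \<noteq> 0 \<longrightarrow> P ((norm x)\<^sup>2)"
proof -
  have nm[measurable]: "(\<lambda>x::real^'n. (norm x)\<^sup>2) \<in> borel_measurable borel"
    by (intro borel_measurable_power borel_measurable_norm measurable_ident_sets)
  have ind[measurable]: "(indicator (ball 0 1) :: real^'n \<Rightarrow> ennreal) \<in> borel_measurable lborel"
    by (intro borel_measurable_indicator) simp
  obtain Z where Z: "Z \<in> null_sets lborel" "{s. \<not> (s \<in> {0<..<1} \<longrightarrow> P s)} \<subseteq> Z"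
    using P unfolding eventually_ae_filter by (auto simp: subset_eq)
  have Zb[measurable]: "Z \<in> sets borel" using Z by auto
  have "AE s in lborel. s \<notin> Z" using AE_not_in[OF Z(1)] .
  then have "AE s in density lborel (\<lambda>s. ennreal (indicat_real {0<..<1} s * (polar_const CARD('n) * s powr (real CARD('n) / 2 - 1)))). s \<notin> Z"
    by (subst AE_density) (auto elim: eventually_mono)
  then have "AE s in distr (density lborel (indicator (ball 0 1))) borel (\<lambda>x::real^'n. (norm x)\<^sup>2). s \<notin> Z"
    unfolding polar_distr[OF N] .
  then have "AE x in density lborel (indicator (ball 0 1)). (norm (x::real^'n))\<^sup>2 \<notin> Z"
    by (subst (asm) AE_distr_iff) auto
  then have "AE x::real^'n in lborel. 0 < (indicator (ball 0 1) x :: ennreal) \<longrightarrow> (norm x)\<^sup>2 \<notin> Z"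
    by (subst (asm) AE_density) auto
  then show ?thesis
  proof eventually_elim
    case (elim x)
    show ?case
    proof (intro impI)
      assume x: "x \<in> ball 0 1" "x \<noteq> 0"
      then have "(norm x)\<^sup>2 \<in> {0<..<1}" by (simp add: power_less_one_iff)
      moreover have "(norm x)\<^sup>2 \<notin> Z" using elim x by simp
      ultimately show "P ((norm x)\<^sup>2)" using Z(2) by blast
    qed
  qed
qed

lemma polar_integral:
  fixes g :: "real \<Rightarrow> real"
  assumes N: "5 \<le> CARD('n)" and g[measurable]: "g \<in> borel_measurable borel"
  shows "integrable lborel (\<lambda>x::real^'n. indicat_real (ball 0 1) x * g ((norm x)\<^sup>2))
      \<longleftrightarrow> integrable lborel (\<lambda>s. indicat_real {0<..<1} s * (s powr (real CARD('n) / 2 - 1) * g s))"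
    and "(\<integral>x. indicat_real (ball 0 1) x * g ((norm (x::real^'n))\<^sup>2) \<partial>lborel)
      = polar_const CARD('n) * (\<integral>s. indicat_real {0<..<1} s * (s powr (real CARD('n) / 2 - 1) * g s) \<partial>lborel)"
proof -
  have nm[measurable]: "(\<lambda>x::real^'n. (norm x)\<^sup>2) \<in> borel_measurable borel"
    by (intro borel_measurable_power borel_measurable_norm measurable_ident_sets)
  have ind[measurable]: "(indicat_real (ball 0 1) :: real^'n \<Rightarrow> real) \<in> borel_measurable lborel"
    by (intro borel_measurable_indicator) simp
  define L where "L = distr (density lborel (indicator (ball 0 1))) borel (\<lambda>x::real^'n. (norm x)\<^sup>2)"
  have pcp: "0 < polar_const CARD('n)" using N by (intro polar_const_pos) simp
  have id: "density lborel (indicator (ball 0 1)) = density lborel (\<lambda>x::real^'n. ennreal (indicat_real (ball 0 1) x))"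
    by (simp add: ennreal_indicator)
  have gm: "(\<lambda>x::real^'n. g ((norm x)\<^sup>2)) \<in> borel_measurable lborel"
    using measurable_compose[OF nm g] by simp
  define f where "f s = indicat_real {0<..<1} s * (polar_const CARD('n) * s powr (real CARD('n) / 2 - 1))" for s
  have f0: "0 \<le> f s" for s using pcp by (simp add: f_def)
  have [measurable]: "f \<in> borel_measurable borel" unfolding f_def by measurable
  have LR: "L = density lborel (\<lambda>s. ennreal (f s))" unfolding L_def f_def by (rule polar_distr[OF N])
  have 1: "integrable L g \<longleftrightarrow> integrable lborel (\<lambda>x::real^'n. indicat_real (ball 0 1) x *\<^sub>R g ((norm x)\<^sup>2))"
    unfolding L_def id by (subst integrable_distr_eq, simp, simp, subst integrable_density) (auto intro: gm ind)
  have 2: "integrable L g \<longleftrightarrow> integrable lborel (\<lambda>s. f s *\<^sub>R g s)"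
    unfolding LR by (rule integrable_density) (auto simp: f0)
  have 3: "integral\<^sup>L L g = (\<integral>x. indicat_real (ball 0 1) x *\<^sub>R g ((norm (x::real^'n))\<^sup>2) \<partial>lborel)"
    unfolding L_def id by (subst integral_distr, simp, simp, subst integral_density) (auto intro: gm ind)
  have 4: "integral\<^sup>L L g = (\<integral>s. f s *\<^sub>R g s \<partial>lborel)"
    unfolding LR by (rule integral_density) (auto simp: f0)
  have fg: "f s *\<^sub>R g s = polar_const CARD('n) * (indicat_real {0<..<1} s * (s powr (real CARD('n) / 2 - 1) * g s))" for s
    by (simp add: f_def)
  show "integrable lborel (\<lambda>x::real^'n. indicat_real (ball 0 1) x * g ((norm x)\<^sup>2))
      \<longleftrightarrow> integrable lborel (\<lambda>s. indicat_real {0<..<1} s * (s powr (real CARD('n) / 2 - 1) * g s))"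
    using 1 2 pcp unfolding fg by simp
  show "(\<integral>x. indicat_real (ball 0 1) x * g ((norm (x::real^'n))\<^sup>2) \<partial>lborel)
      = polar_const CARD('n) * (\<integral>s. indicat_real {0<..<1} s * (s powr (real CARD('n) / 2 - 1) * g s) \<partial>lborel)"
    using 3 4 unfolding fg by simp
qed

section \<open>The profile of a radial weak solution\<close>

text \<open>The conformal factor of the Poincare ball in the variable s = |x|^2.\<close>

definition rho :: "real \<Rightarrow> real" where "rho s = 2 / (1 - s)"

lemma rho_pos: "s < 1 \<Longrightarrow> 0 < rho s"
  by (simp add: rho_def)

lemma rho_power_deriv:
  assumes "s < 1"
  shows "((\<lambda>s. rho s ^ k) has_real_derivative real k * rho s ^ (k + 1) / 2) (at s)"
proof (cases k)
  case (Suc j)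
  have "(rho has_real_derivative 2 / (1 - s)\<^sup>2) (at s)"
    unfolding rho_def using assms by (auto intro!: derivative_eq_intros simp: power2_eq_square)
  moreover have "2 / (1 - s)\<^sup>2 = (rho s)\<^sup>2 / 2" by (simp add: rho_def power_divide)
  ultimately have r: "(rho has_real_derivative (rho s)\<^sup>2 / 2) (at s)" by simp
  have "((\<lambda>s. rho s ^ Suc j) has_real_derivative real (Suc j) * (rho s ^ j * ((rho s)\<^sup>2 / 2))) (at s)"
    using DERIV_power_Suc[OF r, of j] by (simp add: mult_ac)
  then show ?thesis unfolding Suc by (simp add: power2_eq_square mult_ac)
qed simp

lemma rho_continuous: "continuous_on {0<..<1} (\<lambda>s. rho s ^ k)"
  unfolding rho_def by (intro continuous_intros) auto

lemma abs_powr_mult_continuous: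
  fixes f :: "real \<Rightarrow> real"
  assumes "0 < q" "continuous_on S f"
  shows "continuous_on S (\<lambda>s. \<bar>f s\<bar> powr q * f s)"
  using assms by (intro continuous_intros continuous_on_powr') auto

lemma powr_pred: "0 < s \<Longrightarrow> s * s powr (a - 1) = s powr (a::real)"
  using powr_add[of s 1 "a - 1"] by simp

lemma prim_diff:
  assumes "loc_int j" "0 < a" "a \<le> b" "b < 1"
  shows "prim j b - prim j a = integral {a..b} j"
proof -
  define c where "c = min a (1/2)"
  have c: "0 < c" "c \<le> 1/2" "c \<le> a" using assms by (auto simp: c_def)
  have "integral {c..a} j + integral {a..b} j = integral {c..b} j"
    using c assms by (intro Henstock_Kurzweil_Integration.integral_combine loc_int_integrable_on) auto
  then show ?thesis using prim_eq[OF assms(1) c(1,2)] c assms by simp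
qed

lemma cutoff_mono: "x \<le> y \<Longrightarrow> cutoff x \<le> cutoff y"
  unfolding cutoff_def by (auto simp: field_simps intro!: divide_left_mono)

lemma bump_ge_half:
  assumes "c < c'" "d' < d"
  obtains n where "\<And>t. t \<in> {c'..d'} \<Longrightarrow> 1/2 \<le> bump c d n t"
proof -
  have "\<forall>\<^sub>F n in sequentially. 3/4 < cutoff (real n * (c' - c))"
    by (rule order_tendstoD(1)[OF cutoff_tendsto]) (use assms in auto)
  moreover have "\<forall>\<^sub>F n in sequentially. 3/4 < cutoff (real n * (d - d'))"
    by (rule order_tendstoD(1)[OF cutoff_tendsto]) (use assms in auto)
  ultimately have "\<forall>\<^sub>F n in sequentially. 3/4 < cutoff (real n * (c' - c)) \<and> 3/4 < cutoff (real n * (d - d'))"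
    by (rule eventually_conj)
  then obtain n where n: "3/4 < cutoff (real n * (c' - c))" "3/4 < cutoff (real n * (d - d'))"
    using eventually_happens'[OF sequentially_bot] by blast
  show ?thesis
  proof (rule that[of n])
    fix t assume t: "t \<in> {c'..d'}"
    have "cutoff (real n * (c' - c)) \<le> cutoff (real n * (t - c))"
      "cutoff (real n * (d - d')) \<le> cutoff (real n * (d - t))"
      using t by (auto intro!: cutoff_mono mult_left_mono)
    then have "(3/4) * (3/4) \<le> bump c d n t"
      unfolding bump_def using n by (intro mult_mono) (auto intro: cutoff_bounds)
    then show "1/2 \<le> bump c d n t" by simp
  qed
qed

section \<open>Reduction of the weak equation to one variable\<close>

locale radial_weak_solution =
  fixes u :: "real^'n \<Rightarrow> real" and G :: "real^'n \<Rightarrow> real^'n" and lam p M :: real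
  assumes N: "7 \<le> CARD('n)" and rad: "radial u" and H: "H1 u G"
    and M: "0 \<le> M" "H1_normsq u G \<le> ennreal M"
    and p: "2 < p" and sol: "weak_sol lam p u G"
begin

text \<open>The profile of \<open>u\<close> along an arbitrary coordinate axis; in this form it
  inherits measurability from \<open>u\<close>.\<close>

definition zeta :: "real \<Rightarrow> real" where
  "zeta s = u (sqrt s *\<^sub>R axis undefined 1)"

definition W :: "real \<Rightarrow> real" where "W s = s powr (real CARD('n) / 2 - 1)"

text \<open>Leading coefficient of the radial operator in s: 4 s from the squared gradient of |x|^2,
  \<open>W s\<close> from polar coordinates and rho^(N-2) from the metric.\<close>

definition B :: "real \<Rightarrow> real" where
  "B s = 4 * (s powr (real CARD('n) / 2) * rho s ^ (CARD('n) - 2))"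

lemma N5: "5 \<le> CARD('n)" and N2: "2 \<le> CARD('n)" using N by auto

lemma pcp: "0 < polar_const CARD('n)" using N by (intro polar_const_pos) simp

lemma u_meas[measurable]: "u \<in> borel_measurable borel" using H by (auto simp: H1_def)

lemma u_eq: "x \<in> ball 0 1 \<Longrightarrow> u x = zeta ((norm x)\<^sup>2)"
proof -
  assume x: "x \<in> ball 0 1"
  obtain f where f: "\<And>x. x \<in> ball 0 1 \<Longrightarrow> u x = f (norm x)" using rad unfolding radial_def by blast
  have n: "norm (norm x *\<^sub>R (axis undefined 1 :: real^'n)) = norm x" by (simp add: norm_axis_1)
  then have "norm x *\<^sub>R (axis undefined 1 :: real^'n) \<in> ball 0 1" using x by simp
  then show ?thesis using f[OF x] f n by (simp add: zeta_def)
qed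

lemma zeta_meas[measurable]: "zeta \<in> borel_measurable borel"
  unfolding zeta_def[abs_def] by (rule measurable_compose[OF _ u_meas]) measurable

lemma W_cont: "continuous_on {0<..<1} W"
  unfolding W_def by (intro continuous_intros) auto

lemma W_pos: "s \<in> {0<..<1} \<Longrightarrow> 0 < W s" by (simp add: W_def)

lemma sW: "s \<in> {0<..<1} \<Longrightarrow> s * W s = s powr (real CARD('n) / 2)"
  unfolding W_def by (rule powr_pred) simp

lemma B_pos: "s \<in> {0<..<1} \<Longrightarrow> 0 < B s"
  unfolding B_def using rho_pos[of s] by simp

lemma polarW:
  assumes [measurable]: "g \<in> borel_measurable borel"
  shows "integrable lborel (\<lambda>x::real^'n. indicat_real (ball 0 1) x * g ((norm x)\<^sup>2))
      \<longleftrightarrow> integrable lborel (\<lambda>s. indicat_real {0<..<1} s * (W s * g s))"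
    and "(\<integral>x. indicat_real (ball 0 1) x * g ((norm (x::real^'n))\<^sup>2) \<partial>lborel)
      = polar_const CARD('n) * (\<integral>s. indicat_real {0<..<1} s * (W s * g s) \<partial>lborel)"
  using polar_integral[OF N5 assms] by (simp_all add: W_def)

lemma hypvol_radial:
  fixes U :: "real^'n \<Rightarrow> real"
  assumes U: "\<And>x. x \<in> ball 0 1 \<Longrightarrow> U x = g ((norm x)\<^sup>2)" and g[measurable]: "g \<in> borel_measurable borel"
    and int: "integrable hypvol U"
  shows "integrable lborel (\<lambda>s. indicat_real {0<..<1} s * (W s * (rho s ^ CARD('n) * g s)))"
    and "(\<integral>x. U x \<partial>hypvol) = polar_const CARD('n) * (\<integral>s. indicat_real {0<..<1} s * (W s * (rho s ^ CARD('n) * g s)) \<partial>lborel)"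
proof -
  have rm[measurable]: "rho \<in> borel_measurable borel" unfolding rho_def[abs_def] by measurable
  have Um[measurable]: "U \<in> borel_measurable lborel"
    using borel_measurable_integrable[OF int] by (simp add: hypvol_eq)
  have vol_weightU: "vol_weight x *\<^sub>R U x = indicat_real (ball 0 1) x * (rho ((norm x)\<^sup>2) ^ CARD('n) * g ((norm x)\<^sup>2))" for x
    using U[of x] by (auto simp: vol_weight_def rho_def indicator_def)
  have "integrable lborel (\<lambda>x. vol_weight x *\<^sub>R U x)"
    using int unfolding hypvol_eq by (subst (asm) integrable_density) (auto simp: vol_weight_nonneg)
  then show "integrable lborel (\<lambda>s. indicat_real {0<..<1} s * (W s * (rho s ^ CARD('n) * g s)))"
    unfolding vol_weightU using polarW(1)[of "\<lambda>s. rho s ^ CARD('n) * g s"] by simp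
  have "(\<integral>x. U x \<partial>hypvol) = (\<integral>x. vol_weight x *\<^sub>R U x \<partial>lborel)"
    unfolding hypvol_eq by (rule integral_density) (auto simp: vol_weight_nonneg)
  also have "\<dots> = polar_const CARD('n) * (\<integral>s. indicat_real {0<..<1} s * (W s * (rho s ^ CARD('n) * g s)) \<partial>lborel)"
    unfolding vol_weightU by (rule polarW(2)) measurable
  finally show "(\<integral>x. U x \<partial>hypvol) = polar_const CARD('n) * (\<integral>s. indicat_real {0<..<1} s * (W s * (rho s ^ CARD('n) * g s)) \<partial>lborel)" .
qed

text \<open>The weak formulation provides integrability only against test functions. On a compact
  interval a bump that is positive there can be divided out together with the continuous
  weights.\<close>

lemma loc_int_of_tests:
  assumes int: "\<And>f. test1 f \<Longrightarrow> integrable lborel (\<lambda>s. indicat_real {0<..<1} s * (W s * (rho s ^ CARD('n) * (g s * f s))))"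
  shows "loc_int g"
  unfolding loc_int_def
proof (intro allI impI)
  fix c0 d0 :: real assume cd0: "0 < c0" "d0 < 1"
  show "set_integrable lborel {c0..d0} g"
  proof (cases "c0 \<le> d0")
    case True
    define c where "c = c0 / 2"
    define d where "d = (d0 + 1) / 2"
    have cd: "0 < c" "c < c0" "d0 < d" "d < 1" using cd0 by (auto simp: c_def d_def)
    define f where "f = bump c d 1"
    have f: "test1 f" unfolding f_def using cd True by (intro test1_bump) auto
    have fc: "continuous_on S f" for S unfolding f_def by (intro smooth1_continuous_on smooth1_bump)
    have fpos: "0 < f s" if "s \<in> {c0..d0}" for s unfolding f_def using that cd by (intro bump_bounds) auto
    have sub: "{c0..d0} \<subseteq> {0<..<1}" using cd0 by auto
    have "set_integrable lborel {c0..d0} (\<lambda>s. indicat_real {0<..<1} s * (W s * (rho s ^ CARD('n) * (g s * f s))))"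
      using integrable_mult_indicator[OF _ int[OF f], of "{c0..d0}"] by (simp add: set_integrable_def)
    then have "set_integrable lborel {c0..d0} (\<lambda>s. indicat_real {0<..<1} s * (W s * (rho s ^ CARD('n) * (g s * f s)))
        * (1 / (W s * rho s ^ CARD('n) * f s)))"
    proof (rule set_integrable_mult_continuous)
      show "continuous_on {c0..d0} (\<lambda>s. 1 / (W s * rho s ^ CARD('n) * f s))"
      proof (intro continuous_on_divide continuous_on_mult continuous_on_const fc
          continuous_on_subset[OF W_cont sub] continuous_on_subset[OF rho_continuous sub] ballI)
        fix s assume s: "s \<in> {c0..d0}"
        then have "0 < W s" "0 < rho s" "0 < f s" using sub W_pos rho_pos fpos cd0 by auto
        then show "W s * rho s ^ CARD('n) * f s \<noteq> 0" by simp
      qed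
    qed
    also have "?this \<longleftrightarrow> set_integrable lborel {c0..d0} g"
    proof (rule set_integrable_cong)
      fix s assume s: "s \<in> {c0..d0}"
      then have "0 < W s" "0 < rho s" "0 < f s" "s \<in> {0<..<1}" using sub W_pos rho_pos fpos cd0 by auto
      then show "indicat_real {0<..<1} s * (W s * (rho s ^ CARD('n) * (g s * f s))) * (1 / (W s * rho s ^ CARD('n) * f s)) = g s"
        by simp
    qed auto
    finally show ?thesis .
  qed (simp add: set_integrable_def)
qed

definition zp :: "real \<Rightarrow> real" where "zp s = \<bar>zeta s\<bar> powr (p - 2) * zeta s"

lemma zp_meas[measurable]: "zp \<in> borel_measurable borel" unfolding zp_def[abs_def] by measurable

lemma test_terms:
  assumes f: "test1 f"
  defines "\<phi> \<equiv> (\<lambda>x::real^'n. f ((norm x)\<^sup>2))"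
  shows "integrable lborel (\<lambda>s. indicat_real {0<..<1} s * (W s * (rho s ^ CARD('n) * (zeta s * f s))))"
    and "integrable lborel (\<lambda>s. indicat_real {0<..<1} s * (W s * (rho s ^ CARD('n) * (zp s * f s))))"
    and "(\<integral>x. u x * \<phi> x \<partial>hypvol) = polar_const CARD('n) * (\<integral>s. indicat_real {0<..<1} s * (W s * (rho s ^ CARD('n) * (zeta s * f s))) \<partial>lborel)"
    and "(\<integral>x. \<bar>u x\<bar> powr (p - 2) * u x * \<phi> x \<partial>hypvol) = polar_const CARD('n) * (\<integral>s. indicat_real {0<..<1} s * (W s * (rho s ^ CARD('n) * (zp s * f s))) \<partial>lborel)"
proof -
  have fm[measurable]: "f \<in> borel_measurable borel"
    using f by (intro borel_measurable_continuous_onI smooth1_continuous_on) (auto simp: test1_def)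
  have T: "test_fun \<phi>" unfolding \<phi>_def by (rule test_fun_radial[OF f])
  then have i1: "integrable hypvol (\<lambda>x. u x * \<phi> x)" and i2: "integrable hypvol (\<lambda>x. \<bar>u x\<bar> powr (p - 2) * u x * \<phi> x)"
    using sol by (auto simp: weak_sol_def)
  have e1: "u x * \<phi> x = zeta ((norm x)\<^sup>2) * f ((norm x)\<^sup>2)" if "x \<in> ball 0 1" for x
    using u_eq[OF that] by (simp add: \<phi>_def)
  have e2: "\<bar>u x\<bar> powr (p - 2) * u x * \<phi> x = zp ((norm x)\<^sup>2) * f ((norm x)\<^sup>2)" if "x \<in> ball 0 1" for x
    using u_eq[OF that] by (simp add: \<phi>_def zp_def)
  show "integrable lborel (\<lambda>s. indicat_real {0<..<1} s * (W s * (rho s ^ CARD('n) * (zeta s * f s))))"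
    "(\<integral>x. u x * \<phi> x \<partial>hypvol) = polar_const CARD('n) * (\<integral>s. indicat_real {0<..<1} s * (W s * (rho s ^ CARD('n) * (zeta s * f s))) \<partial>lborel)"
    using hypvol_radial[OF e1 _ i1] by auto
  show "integrable lborel (\<lambda>s. indicat_real {0<..<1} s * (W s * (rho s ^ CARD('n) * (zp s * f s))))"
    "(\<integral>x. \<bar>u x\<bar> powr (p - 2) * u x * \<phi> x \<partial>hypvol) = polar_const CARD('n) * (\<integral>s. indicat_real {0<..<1} s * (W s * (rho s ^ CARD('n) * (zp s * f s))) \<partial>lborel)"
    using hypvol_radial[OF e2 _ i2] by auto
qed

lemma loc_int_zeta: "loc_int zeta" and loc_int_zp: "loc_int zp"
  by (rule loc_int_of_tests, erule test_terms)+

definition K :: "real \<Rightarrow> real" where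
  "K s = (lam * zeta s + zp s) * (W s * rho s ^ CARD('n))"

lemma loc_int_K: "loc_int K"
proof -
  have c: "continuous_on {0<..<1} (\<lambda>s. W s * rho s ^ CARD('n))" by (intro continuous_intros W_cont rho_continuous)
  have "loc_int (\<lambda>s. zeta s * lam)" by (intro loc_int_mult loc_int_zeta continuous_intros)
  then have "loc_int (\<lambda>s. lam * zeta s)" by (simp add: mult.commute)
  then show ?thesis unfolding K_def[abs_def] by (rule loc_int_mult[OF loc_int_add[OF _ loc_int_zp] c])
qed

definition B' :: "real \<Rightarrow> real" where
  "B' s = 4 * (s powr (real CARD('n) / 2) * (real (CARD('n) - 2) * rho s ^ (CARD('n) - 1) / 2)
     + real CARD('n) / 2 * W s * rho s ^ (CARD('n) - 2))"

lemma powr_half_deriv: "s \<in> {0<..<1} \<Longrightarrow>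
   ((\<lambda>s. s powr (real CARD('n) / 2)) has_real_derivative real CARD('n) / 2 * W s) (at s)"
  unfolding W_def by (auto intro!: derivative_eq_intros)

lemma B_deriv: "s \<in> {0<..<1} \<Longrightarrow> (B has_real_derivative B' s) (at s)"
proof -
  assume s: "s \<in> {0<..<1}"
  have c: "CARD('n) - 2 + 1 = CARD('n) - 1" using N by simp
  have r: "((\<lambda>s. rho s ^ (CARD('n) - 2)) has_real_derivative real (CARD('n) - 2) * rho s ^ (CARD('n) - 1) / 2) (at s)"
    using rho_power_deriv[of s "CARD('n) - 2"] s unfolding c by simp
  show "(B has_real_derivative B' s) (at s)"
    unfolding B_def[abs_def] B'_def by (intro DERIV_cmult DERIV_mult' powr_half_deriv s r)
qed

lemma B'_cont: "continuous_on {0<..<1} B'"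
  unfolding B'_def[abs_def] by (intro continuous_intros W_cont rho_continuous) auto

lemma pairing_eq:
  assumes rf: "radial_field \<theta> \<theta>' c d"
  shows "integrable lborel (\<lambda>s. indicat_real {0<..<1} s * (W s * (zeta s * (real CARD('n) * \<theta> s + 2 * s * \<theta>' s))))"
    and "(\<integral>x. \<theta> ((norm x)\<^sup>2) * (G x \<bullet> x) \<partial>lborel)
     = - (polar_const CARD('n) * (\<integral>s. indicat_real {0<..<1} s * (W s * (zeta s * (real CARD('n) * \<theta> s + 2 * s * \<theta>' s))) \<partial>lborel))"
proof -
  interpret radial_field \<theta> \<theta>' c d by (rule rf)
  have [measurable]: "\<theta> \<in> borel_measurable borel" "\<theta>' \<in> borel_measurable borel"
    using theta_cont theta'_cont by (auto intro: borel_measurable_continuous_onI)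
  then have [measurable]: "div_coeff CARD('n) \<in> borel_measurable borel" unfolding div_coeff_def[abs_def] by measurable
  have eq: "u x * div_coeff CARD('n) ((norm x)\<^sup>2) = indicat_real (ball 0 1) x * (zeta ((norm x)\<^sup>2) * div_coeff CARD('n) ((norm x)\<^sup>2))" for x
    using u_eq[of x] div_coeff_out[OF out_of_ball[of x]] by (cases "x \<in> ball 0 1") auto
  have i: "integrable lborel (\<lambda>x. u x * div_coeff CARD('n) ((norm x)\<^sup>2))" by (rule H1_weak_gradient(2)[OF N2 H])
  show "integrable lborel (\<lambda>s. indicat_real {0<..<1} s * (W s * (zeta s * (real CARD('n) * \<theta> s + 2 * s * \<theta>' s))))"
    using i unfolding eq using polarW(1)[of "\<lambda>s. zeta s * div_coeff CARD('n) s"] by (simp add: div_coeff_def)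
  show "(\<integral>x. \<theta> ((norm x)\<^sup>2) * (G x \<bullet> x) \<partial>lborel)
     = - (polar_const CARD('n) * (\<integral>s. indicat_real {0<..<1} s * (W s * (zeta s * (real CARD('n) * \<theta> s + 2 * s * \<theta>' s))) \<partial>lborel))"
    using H1_weak_gradient(3)[OF N2 H] polarW(2)[of "\<lambda>s. zeta s * div_coeff CARD('n) s"] unfolding eq by (simp add: div_coeff_def)
qed

text \<open>For the test function f(|x|^2) the gradient term is the pairing of \<open>G\<close> with
  a radial field, so \<open>pairing_eq\<close> moves the derivative off the solution; W times the
  divergence of that field is (B f')'.\<close>

lemma weak_profile:
  assumes f: "test1 f"
  shows "(\<integral>s. zeta s * (B s * deriv (deriv f) s + B' s * deriv f s) \<partial>lborel) + (\<integral>s. K s * f s \<partial>lborel) = 0"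
proof -
  obtain c d where fs: "smooth1 f" "0 < c" "c < d" "d < 1" "\<And>t. t \<notin> {c..d} \<Longrightarrow> f t = 0"
    using f by (auto simp: test1_def)
  note d1 = smooth1_has_derivative[OF fs(1)] and d2 = smooth1_has_derivative[OF smooth1_deriv[OF fs(1)]]
  have o1: "deriv f s = 0" if "s \<notin> {c..d}" for s using deriv_zero_outside[OF fs(5) that d1] .
  have o2: "deriv (deriv f) s = 0" if "s \<notin> {c..d}" for s using deriv_zero_outside[OF o1 that d2] .
  \<comment> \<open>Factor 2 from the gradient of |x|^2; the exponent drops from N to N - 2 because
    the inverse metric contributes rho^(-2).\<close>
  define h where "h s = 2 * rho s ^ (CARD('n) - 2)" for s
  define h' where "h' s = 2 * (real (CARD('n) - 2) * rho s ^ (CARD('n) - 1) / 2)" for s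
  have cN: "CARD('n) - 2 + 1 = CARD('n) - 1" using N by simp
  have rf: "radial_field (\<lambda>s. h s * deriv f s) (\<lambda>s. h s * deriv (deriv f) s + h' s * deriv f s) c d"
  proof (rule radial_fieldI)
    show "(h has_real_derivative h' s) (at s)" if "s \<in> {0<..<1}" for s
      unfolding h_def[abs_def] h'_def using rho_power_deriv[of s "CARD('n) - 2"] that unfolding cN
      by (intro DERIV_cmult) auto
    show "continuous_on {0<..<1} h'" unfolding h'_def[abs_def] by (intro continuous_intros rho_continuous) auto
    show "continuous_on UNIV (deriv (deriv f))" by (intro smooth1_continuous_on smooth1_deriv fs)
  qed (use fs d2 o1 in auto)
  define \<phi> where "\<phi> = (\<lambda>x::real^'n. f ((norm x)\<^sup>2))"
  have T: "test_fun \<phi>" unfolding \<phi>_def by (rule test_fun_radial[OF f])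
  have pg: "pgrad \<phi> x = (2 * deriv f ((norm x)\<^sup>2)) *\<^sub>R x" for x unfolding \<phi>_def by (rule pgrad_radial[OF fs(1)])
  have sol': "integrable hypvol (\<lambda>x. ((1 - (norm x)\<^sup>2) / 2)\<^sup>2 * (G x \<bullet> pgrad \<phi> x))"
    "(\<integral>x. ((1 - (norm x)\<^sup>2) / 2)\<^sup>2 * (G x \<bullet> pgrad \<phi> x) \<partial>hypvol) - lam * (\<integral>x. u x * \<phi> x \<partial>hypvol)
       = (\<integral>x. \<bar>u x\<bar> powr (p - 2) * u x * \<phi> x \<partial>hypvol)"
    using sol T unfolding weak_sol_def by blast+
  have T1: "(\<integral>x. ((1 - (norm x)\<^sup>2) / 2)\<^sup>2 * (G x \<bullet> pgrad \<phi> x) \<partial>hypvol)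
     = (\<integral>x. h ((norm x)\<^sup>2) * deriv f ((norm x)\<^sup>2) * (G x \<bullet> x) \<partial>lborel)"
  proof -
    have "(\<lambda>x. ((1 - (norm x)\<^sup>2) / 2)\<^sup>2 * (G x \<bullet> pgrad \<phi> x)) \<in> borel_measurable lborel"
      using borel_measurable_integrable[OF sol'(1)] by (simp add: hypvol_eq)
    then have "(\<integral>x. ((1 - (norm x)\<^sup>2) / 2)\<^sup>2 * (G x \<bullet> pgrad \<phi> x) \<partial>hypvol)
       = (\<integral>x. vol_weight x *\<^sub>R (((1 - (norm x)\<^sup>2) / 2)\<^sup>2 * (G x \<bullet> pgrad \<phi> x)) \<partial>lborel)"
      unfolding hypvol_eq by (intro integral_density) (auto simp: vol_weight_nonneg)
    moreover have "vol_weight x *\<^sub>R (((1 - (norm x)\<^sup>2) / 2)\<^sup>2 * (G x \<bullet> pgrad \<phi> x)) = h ((norm x)\<^sup>2) * deriv f ((norm x)\<^sup>2) * (G x \<bullet> x)" for x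
    proof (cases "x \<in> ball 0 1")
      case True
      define a where "a = rho ((norm x)\<^sup>2)"
      have "(norm x)\<^sup>2 < 1" using True by (simp add: power_less_one_iff)
      then have a: "0 < a" unfolding a_def by (rule rho_pos)
      have "vol_weight x = a ^ CARD('n)" using True by (simp add: vol_weight_def a_def rho_def)
      moreover have "a ^ CARD('n) = a ^ (CARD('n) - 2) * a\<^sup>2" by (metis N2 le_add_diff_inverse2 power_add)
      moreover have "((1 - (norm x)\<^sup>2) / 2)\<^sup>2 = 1 / a\<^sup>2" by (simp add: a_def rho_def power_divide)
      ultimately show ?thesis using a by (simp add: pg h_def a_def[symmetric])
    next
      case False
      then have "1 \<le> norm x" by simp
      then have "(norm x)\<^sup>2 \<notin> {c..d}" using fs(4) one_le_power[of "norm x" 2] by (auto simp del: one_le_power)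
      then show ?thesis using False o1 by (simp add: vol_weight_def)
    qed
    ultimately show ?thesis by simp
  qed
  have key: "W s * (real CARD('n) * (h s * deriv f s) + 2 * s * (h s * deriv (deriv f) s + h' s * deriv f s))
      = B s * deriv (deriv f) s + B' s * deriv f s" if "s \<in> {0<..<1}" for s
    unfolding B_def B'_def h_def h'_def sW[OF that, symmetric] by (simp add: algebra_simps)
  have inn: "indicat_real {0<..<1} s * (W s * (zeta s * (real CARD('n) * (h s * deriv f s) + 2 * s * (h s * deriv (deriv f) s + h' s * deriv f s))))
     = zeta s * (B s * deriv (deriv f) s + B' s * deriv f s)" for s
  proof (cases "s \<in> {0<..<1}")
    case True
    then show ?thesis unfolding key[OF True, symmetric] by simp
  next
    case False
    then have "s \<notin> {c..d}" using fs by auto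
    then show ?thesis using o1 o2 by simp
  qed
  have Ksplit: "(\<integral>s. K s * f s \<partial>lborel)
     = lam * (\<integral>s. indicat_real {0<..<1} s * (W s * (rho s ^ CARD('n) * (zeta s * f s))) \<partial>lborel)
       + (\<integral>s. indicat_real {0<..<1} s * (W s * (rho s ^ CARD('n) * (zp s * f s))) \<partial>lborel)"
  proof -
    have "K s * f s = lam * (indicat_real {0<..<1} s * (W s * (rho s ^ CARD('n) * (zeta s * f s))))
       + indicat_real {0<..<1} s * (W s * (rho s ^ CARD('n) * (zp s * f s)))" for s
      using fs(2-4) fs(5)[of s] by (cases "s \<in> {0<..<1}") (auto simp: K_def algebra_simps)
    then show ?thesis using test_terms(1,2)[OF f] by simp
  qed
  have P: "polar_const CARD('n) * ((\<integral>s. zeta s * (B s * deriv (deriv f) s + B' s * deriv f s) \<partial>lborel) + (\<integral>s. K s * f s \<partial>lborel)) = 0"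
  proof -
    have gen: "c * (Z + (l * I + J)) = 0" if "- (c * Z) - l * (c * I) = c * J" for c Z l I J :: real
      using that by (simp add: algebra_simps)
    show ?thesis unfolding Ksplit
      by (rule gen, rule sol'(2)[unfolded T1 pairing_eq(2)[OF rf] inn, unfolded \<phi>_def test_terms(3,4)[OF f]])
  qed
  then show ?thesis using pcp by simp
qed


section \<open>Regularity and energy of the profile\<close>

lemma u_sq_energy:
  shows "integrable lborel (\<lambda>s. indicat_real {0<..<1} s * (W s * (rho s ^ CARD('n) * (zeta s)\<^sup>2)))"
    and "polar_const CARD('n) * (\<integral>s. indicat_real {0<..<1} s * (W s * (rho s ^ CARD('n) * (zeta s)\<^sup>2)) \<partial>lborel) \<le> M"
proof -
  have m: "(\<lambda>x. (u x)\<^sup>2) \<in> borel_measurable hypvol" unfolding hypvol_eq by simp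
  have "(\<integral>\<^sup>+x. ennreal ((u x)\<^sup>2) \<partial>hypvol) \<le> H1_normsq u G"
    unfolding H1_normsq_def by (intro nn_integral_mono ennreal_leI) (simp add: hgrad_sq_def)
  then have le: "(\<integral>\<^sup>+x. ennreal ((u x)\<^sup>2) \<partial>hypvol) \<le> ennreal M" using M(2) by simp
  then have i: "integrable hypvol (\<lambda>x. (u x)\<^sup>2)"
    using m by (intro integrableI_nonneg) (auto intro: le_less_trans)
  have "ennreal (\<integral>x. (u x)\<^sup>2 \<partial>hypvol) \<le> ennreal M"
    using le nn_integral_eq_integral[OF i] by simp
  then have "(\<integral>x. (u x)\<^sup>2 \<partial>hypvol) \<le> M" using M(1) by simp
  moreover have "\<And>x. x \<in> ball 0 1 \<Longrightarrow> (u x)\<^sup>2 = (zeta ((norm x)\<^sup>2))\<^sup>2" using u_eq by simp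
  note hr = hypvol_radial[OF this _ i]
  ultimately show "polar_const CARD('n) * (\<integral>s. indicat_real {0<..<1} s * (W s * (rho s ^ CARD('n) * (zeta s)\<^sup>2)) \<partial>lborel) \<le> M"
    using hr(2) by simp
  show "integrable lborel (\<lambda>s. indicat_real {0<..<1} s * (W s * (rho s ^ CARD('n) * (zeta s)\<^sup>2)))"
    using hr(1) by simp
qed

text \<open>The zero-order term is first treated as a mere locally integrable datum. Once
  \<open>z0\<close> is available, that datum agrees almost everywhere with a continuous function of
  \<open>z0\<close>, so the flux y = B z0' is differentiable too.\<close>

lemma profile_regular:
  obtains z0 y where
    "\<And>s. s \<in> {0<..<1} \<Longrightarrow> (z0 has_real_derivative y s / B s) (at s)"
    "\<And>s. s \<in> {0<..<1} \<Longrightarrow> (y has_real_derivative - ((lam * z0 s + \<bar>z0 s\<bar> powr (p - 2) * z0 s) * (W s * rho s ^ CARD('n)))) (at s)"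
    "AE s in lborel. s \<in> {0<..<1} \<longrightarrow> zeta s = z0 s"
proof -
  have Bne: "\<And>s. s \<in> {0<..<1} \<Longrightarrow> B s \<noteq> 0" using B_pos by (metis less_irrefl)
  obtain z0 a where z0: "\<And>s. s \<in> {0<..<1} \<Longrightarrow> (z0 has_real_derivative (a - prim K s) / B s) (at s)"
    and ae: "AE s in lborel. s \<in> {0<..<1} \<longrightarrow> zeta s = z0 s"
    using weak_ode_regularity[OF loc_int_zeta loc_int_K B_deriv B'_cont Bne weak_profile] by blast
  define K0 where "K0 s = (lam * z0 s + \<bar>z0 s\<bar> powr (p - 2) * z0 s) * (W s * rho s ^ CARD('n))" for s
  have cz: "continuous_on {0<..<1} z0"
    by (rule DERIV_continuous_on, rule has_field_derivative_at_within, rule z0)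
  have cK: "continuous_on {0<..<1} K0"
    unfolding K0_def[abs_def]
    by (intro continuous_on_mult continuous_on_add continuous_on_const cz W_cont rho_continuous abs_powr_mult_continuous)
       (use p in simp)
  have aeK: "AE s in lborel. s \<in> {0<..<1} \<longrightarrow> K s = K0 s"
    using ae by eventually_elim (auto simp: K_def K0_def zp_def)
  have pK: "prim K s = prim K0 s" if "s \<in> {0<..<1}" for s
    by (rule prim_cong_AE[OF loc_int_K loc_int_continuous[OF cK] aeK that])
  show ?thesis
  proof (rule that[of z0 "\<lambda>s. a - prim K s"])
    fix s :: real assume s: "s \<in> {0<..<1}"
    have "((\<lambda>s. a - prim K0 s) has_real_derivative - K0 s) (at s)"
      using prim_has_derivative[OF cK s] by (auto intro!: derivative_eq_intros)
    then have "((\<lambda>s. a - prim K s) has_real_derivative - K0 s) (at s)"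
      by (rule has_field_derivative_transform_within_open[of _ _ _ "{0<..<1}"]) (use s pK in auto)
    then show "((\<lambda>s. a - prim K s) has_real_derivative - ((lam * z0 s + \<bar>z0 s\<bar> powr (p - 2) * z0 s) * (W s * rho s ^ CARD('n)))) (at s)"
      by (simp add: K0_def)
  qed (use z0 ae in auto)
qed

text \<open>The weak gradient is paired with the gradient of the regular representative, cut off by a bump:
  this recovers the Dirichlet energy without identifying G pointwise.\<close>

lemma gradient_energy_bump:
  assumes z0: "\<And>s. s \<in> {0<..<1} \<Longrightarrow> (z0 has_real_derivative y s / B s) (at s)"
    and y: "\<And>s. s \<in> {0<..<1} \<Longrightarrow> (y has_real_derivative y1 s) (at s)" "continuous_on {0<..<1} y1"
    and ae: "AE s in lborel. s \<in> {0<..<1} \<longrightarrow> zeta s = z0 s"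
    and cd: "0 < c" "c < d" "d < 1"
  shows "polar_const CARD('n) * (\<integral>s. indicat_real {c..d} s * ((y s)\<^sup>2 / B s * bump c d n s) \<partial>lborel) \<le> M"
proof -
  define g where "g = bump c d n"
  define g1 where "g1 = deriv g"
  have g: "smooth1 g" unfolding g_def by (rule smooth1_bump)
  have gd: "(g has_real_derivative g1 s) (at s)" for s unfolding g1_def by (rule smooth1_has_derivative[OF g])
  have gc: "continuous_on S g" "continuous_on S g1" for S unfolding g1_def by (intro smooth1_continuous_on smooth1_deriv g)+
  have gout: "g s = 0" if "s \<notin> {c<..<d}" for s unfolding g_def by (rule bump_bounds(3)[OF that])
  have g01: "0 \<le> g s" "g s \<le> 1" for s unfolding g_def by (rule bump_bounds)+
  have sub: "{c..d} \<subseteq> {0<..<1}" using cd by auto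
  have cy: "continuous_on {0<..<1} y"
    by (rule DERIV_continuous_on, rule has_field_derivative_at_within, rule y)
  have cz: "continuous_on {0<..<1} z0"
    by (rule DERIV_continuous_on, rule has_field_derivative_at_within, rule z0)
  have cB: "continuous_on {0<..<1} B"
    by (rule DERIV_continuous_on, rule has_field_derivative_at_within, rule B_deriv)
  define q where "q s = s powr (real CARD('n) / 2)" for s
  have q0: "0 < q s" if "s \<in> {0<..<1}" for s using that by (simp add: q_def)
  have qd: "(q has_real_derivative real CARD('n) / 2 * W s) (at s)" if "s \<in> {0<..<1}" for s
    unfolding q_def[abs_def] by (rule powr_half_deriv[OF that])
  have cq: "continuous_on {0<..<1} q"
    by (rule DERIV_continuous_on, rule has_field_derivative_at_within, rule qd)
  \<comment> \<open>The Euclidean gradient of z0(|x|^2) is (2 y / B) x, and 2 y / B = k / rho^(N-2);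
    hence k(|x|^2) x is rho^(N-2) times that gradient.\<close>
  define k where "k s = y s / (2 * q s)" for s
  define k' where "k' s = (y1 s - real CARD('n) * W s * k s) / (2 * q s)" for s
  have kd: "(k has_real_derivative k' s) (at s)" if s: "s \<in> {0<..<1}" for s
  proof -
    have "(k has_real_derivative (y1 s * (2 * q s) - y s * (2 * (real CARD('n) / 2 * W s))) / ((2 * q s) * (2 * q s))) (at s)"
      unfolding k_def[abs_def] using q0[OF s] by (intro DERIV_divide y(1) DERIV_cmult qd s) auto
    moreover have "(y1 s * (2 * q s) - y s * (2 * (real CARD('n) / 2 * W s))) / ((2 * q s) * (2 * q s)) = k' s"
      using q0[OF s] by (simp add: k'_def k_def field_simps)
    ultimately show ?thesis by simp
  qed
  have ck: "continuous_on {0<..<1} k"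
    by (rule DERIV_continuous_on, rule has_field_derivative_at_within, rule kd)
  have ck': "continuous_on {0<..<1} k'"
    unfolding k'_def[abs_def] using q0
    by (intro continuous_on_divide continuous_on_diff continuous_on_mult continuous_on_const y(2) W_cont ck cq)
       (metis less_irrefl mult_eq_0_iff zero_neq_numeral)
  have rf: "radial_field (\<lambda>s. k s * g s) (\<lambda>s. k s * g1 s + k' s * g s) c d"
  proof (rule radial_fieldI[OF kd ck' gd gc(2) cd])
    show "g s = 0" if "s \<notin> {c..d}" for s using that by (intro gout) auto
  qed
  interpret radial_field "\<lambda>s. k s * g s" "\<lambda>s. k s * g1 s + k' s * g s" c d by (rule rf)
  have g1out: "g1 s = 0" if "s \<notin> {c..d}" for s
  proof (rule deriv_zero_outside[OF _ that gd])
    show "g t = 0" if "t \<notin> {c..d}" for t using that by (intro gout) auto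
  qed
  define Q where "Q s = indicat_real {c..d} s * ((y s)\<^sup>2 / B s * g s)" for s
  have Bq: "B s = 4 * (q s * rho s ^ (CARD('n) - 2))" for s by (simp add: B_def q_def)
  have cQ: "set_integrable lborel {c..d} (\<lambda>s. (y s)\<^sup>2 / B s * r s)" if "continuous_on {c..d} r" for r :: "real \<Rightarrow> real"
  proof (rule borel_integrable_atLeastAtMost', intro continuous_on_mult continuous_on_divide continuous_on_power that
      continuous_on_subset[OF cy sub] continuous_on_subset[OF cB sub] ballI)
    show "B s \<noteq> 0" if "s \<in> {c..d}" for s using B_pos[of s] that sub by auto
  qed
  have iQ: "integrable lborel Q" using cQ[OF gc(1)] by (simp add: set_integrable_def Q_def[abs_def])
  \<comment> \<open>W times the divergence of the cut-off field is the derivative of y g, which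
    prepares integration by parts against \<open>z0\<close>.\<close>
  have divW: "W s * (real CARD('n) * (k s * g s) + 2 * s * (k s * g1 s + k' s * g s)) = y1 s * g s + y s * g1 s"
    if s: "s \<in> {0<..<1}" for s
  proof -
    have a: "2 * q s * k s = y s" using q0[OF s] by (simp add: k_def)
    have b: "2 * q s * k' s = y1 s - real CARD('n) * W s * k s" using q0[OF s] by (simp add: k'_def)
    have "W s * (real CARD('n) * (k s * g s) + 2 * s * (k s * g1 s + k' s * g s))
      = real CARD('n) * W s * k s * g s + 2 * (s * W s) * k s * g1 s + 2 * (s * W s) * k' s * g s"
      by (simp add: algebra_simps)
    also have "s * W s = q s" using sW[OF s] by (simp add: q_def)
    also have "real CARD('n) * W s * k s * g s + 2 * q s * k s * g1 s + 2 * q s * k' s * g s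
       = real CARD('n) * W s * k s * g s + y s * g1 s + (y1 s - real CARD('n) * W s * k s) * g s"
      by (simp only: a b)
    finally show ?thesis by (simp add: algebra_simps)
  qed
  have "(\<integral>s. indicat_real {0<..<1} s * (W s * (zeta s * (real CARD('n) * (k s * g s) + 2 * s * (k s * g1 s + k' s * g s)))) \<partial>lborel)
      = (\<integral>s. (z0 s * (y1 s * g s + y s * g1 s)) * indicat_real {c..d} s \<partial>lborel)"
  proof (rule integral_cong_AE)
    show "(\<lambda>s. indicat_real {0<..<1} s * (W s * (zeta s * (real CARD('n) * (k s * g s) + 2 * s * (k s * g1 s + k' s * g s))))) \<in> borel_measurable lborel"
      using borel_measurable_integrable[OF pairing_eq(1)[OF rf]] .
    have "set_integrable lborel {c..d} (\<lambda>s. z0 s * (y1 s * g s + y s * g1 s))"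
      by (rule borel_integrable_atLeastAtMost')
         (intro continuous_on_mult continuous_on_add gc continuous_on_subset[OF cy sub] continuous_on_subset[OF cz sub] continuous_on_subset[OF y(2) sub])
    from borel_measurable_integrable[OF this[unfolded set_integrable_def]]
    show "(\<lambda>s. (z0 s * (y1 s * g s + y s * g1 s)) * indicat_real {c..d} s) \<in> borel_measurable lborel"
      by (simp add: mult.commute)
    show "AE s in lborel. indicat_real {0<..<1} s * (W s * (zeta s * (real CARD('n) * (k s * g s) + 2 * s * (k s * g1 s + k' s * g s))))
        = (z0 s * (y1 s * g s + y s * g1 s)) * indicat_real {c..d} s"
      using ae
    proof eventually_elim
      case (elim s)
      consider "s \<in> {c..d}" | "s \<notin> {c..d}" by blast
      then show ?case
      proof cases
        case 1
        then have s: "s \<in> {0<..<1}" using sub by auto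
        show ?thesis unfolding divW[OF s, symmetric] using 1 s elim by simp
      next
        case 2
        then have "g s = 0" by (intro gout) auto
        then show ?thesis using 2 g1out by simp
      qed
    qed
  qed
  also have "\<dots> = - (\<integral>s. Q s \<partial>lborel)"
  proof -
    have FTC: "(\<integral>s. (z0 s * (y1 s * g s + y s * g1 s) + y s / B s * (y s * g s)) * indicat_real {c..d} s \<partial>lborel)
        = z0 d * (y d * g d) - z0 c * (y c * g c)"
    proof (rule integral_FTC_Icc_real)
      fix s assume s: "c \<le> s" "s \<le> d"
      then have s01: "s \<in> {0<..<1}" using sub by auto
      have "((\<lambda>s. y s * g s) has_real_derivative y s * g1 s + y1 s * g s) (at s)"
        by (intro DERIV_mult' y(1) gd s01)
      from DERIV_mult'[OF z0[OF s01] this]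
      show "((\<lambda>s. z0 s * (y s * g s)) has_real_derivative z0 s * (y1 s * g s + y s * g1 s) + y s / B s * (y s * g s)) (at s)"
        by (simp add: add.commute)
      have "continuous_on {0<..<1} (\<lambda>s. z0 s * (y1 s * g s + y s * g1 s) + y s / B s * (y s * g s))"
        using B_pos by (intro continuous_on_mult continuous_on_add continuous_on_divide gc cy cz y(2) cB)
          (metis less_irrefl)
      then show "isCont (\<lambda>s. z0 s * (y1 s * g s + y s * g1 s) + y s / B s * (y s * g s)) s"
        using s01 by (intro continuous_on_interior[of "{0<..<1}"]) (auto simp: interior_open)
    qed (use cd in simp)
    have i1: "integrable lborel (\<lambda>s. (z0 s * (y1 s * g s + y s * g1 s)) * indicat_real {c..d} s)"
    proof -
      have "set_integrable lborel {c..d} (\<lambda>s. z0 s * (y1 s * g s + y s * g1 s))"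
        by (rule borel_integrable_atLeastAtMost')
           (intro continuous_on_mult continuous_on_add gc continuous_on_subset[OF cy sub] continuous_on_subset[OF cz sub] continuous_on_subset[OF y(2) sub])
      then show ?thesis by (simp add: set_integrable_def mult.commute)
    qed
    have "(z0 s * (y1 s * g s + y s * g1 s) + y s / B s * (y s * g s)) * indicat_real {c..d} s
        = (z0 s * (y1 s * g s + y s * g1 s)) * indicat_real {c..d} s + Q s" for s
      by (cases "s \<in> {c..d}") (auto simp: Q_def power2_eq_square)
    then have "(\<integral>s. (z0 s * (y1 s * g s + y s * g1 s)) * indicat_real {c..d} s \<partial>lborel) + (\<integral>s. Q s \<partial>lborel) = z0 d * (y d * g d) - z0 c * (y c * g c)"
      using FTC Bochner_Integration.integral_add[OF i1 iQ] by simp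
    moreover have "g c = 0" "g d = 0" by (auto intro!: gout)
    ultimately show ?thesis by simp
  qed
  finally have lhs: "(\<integral>x. k ((norm x)\<^sup>2) * g ((norm x)\<^sup>2) * (G x \<bullet> x) \<partial>lborel) = polar_const CARD('n) * (\<integral>s. Q s \<partial>lborel)"
    using pairing_eq(2)[OF rf] by simp
  define R where "R s = indicat_real {c..d} s * ((y s)\<^sup>2 / B s * (g s)\<^sup>2)" for s
  have iR: "integrable lborel R" using cQ[OF continuous_on_power[OF gc(1)]] by (simp add: set_integrable_def R_def[abs_def])
  \<comment> \<open>The bump takes values in [0,1], so its square is at most itself.\<close>
  have RQ: "(\<integral>s. R s \<partial>lborel) \<le> (\<integral>s. Q s \<partial>lborel)"
  proof (rule integral_mono[OF iR iQ])
    fix s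
    show "R s \<le> Q s"
    proof (cases "s \<in> {c..d}")
      case True
      have "(g s)\<^sup>2 \<le> g s" using g01[of s] by (simp add: power2_eq_square mult_left_le_one_le)
      moreover have "0 < B s" using B_pos[of s] True sub by auto
      ultimately show ?thesis using True by (auto simp: R_def Q_def intro!: divide_right_mono mult_left_mono)
    qed (simp add: R_def Q_def)
  qed
  have rhs: "(\<integral>x. ((1 - (norm x)\<^sup>2) / 2) ^ (CARD('n) - 2) * (k ((norm x)\<^sup>2) * g ((norm x)\<^sup>2))\<^sup>2 * (norm (x::real^'n))\<^sup>2 \<partial>lborel)
     = polar_const CARD('n) * (\<integral>s. R s \<partial>lborel)"
  proof -
    define r where "r s = ((1 - s) / 2) ^ (CARD('n) - 2) * (k s * g s)\<^sup>2 * s" for s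
    have [measurable]: "r \<in> borel_measurable borel"
      unfolding r_def[abs_def] by (intro borel_measurable_continuous_onI continuous_intros theta_cont) auto
    have "((1 - (norm x)\<^sup>2) / 2) ^ (CARD('n) - 2) * (k ((norm x)\<^sup>2) * g ((norm x)\<^sup>2))\<^sup>2 * (norm x)\<^sup>2
        = indicat_real (ball 0 1) x * r ((norm x)\<^sup>2)" for x :: "real^'n"
      using theta_out[OF out_of_ball[of x]] by (cases "x \<in> ball 0 1") (auto simp: r_def)
    then have "(\<integral>x. ((1 - (norm x)\<^sup>2) / 2) ^ (CARD('n) - 2) * (k ((norm x)\<^sup>2) * g ((norm x)\<^sup>2))\<^sup>2 * (norm (x::real^'n))\<^sup>2 \<partial>lborel)
       = polar_const CARD('n) * (\<integral>s. indicat_real {0<..<1} s * (W s * r s) \<partial>lborel)"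
      using polarW(2)[of r] by simp
    moreover have "indicat_real {0<..<1} s * (W s * r s) = R s" for s
    proof (cases "s \<in> {c..d}")
      case True
      then have s: "s \<in> {0<..<1}" using sub by auto
      have h: "((1 - s) / 2) ^ (CARD('n) - 2) = 1 / rho s ^ (CARD('n) - 2)" by (simp add: rho_def power_divide)
      have rp: "0 < rho s" using s by (intro rho_pos) simp
      have "W s * r s = (s * W s) * ((k s * g s)\<^sup>2 / rho s ^ (CARD('n) - 2))" by (simp add: r_def h)
      also have "s * W s = q s" using sW[OF s] by (simp add: q_def)
      also have "q s * ((k s * g s)\<^sup>2 / rho s ^ (CARD('n) - 2)) = (y s)\<^sup>2 / B s * (g s)\<^sup>2"
        using q0[OF s] rp by (simp add: k_def Bq power_mult_distrib power_divide power2_eq_square field_simps)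
      finally show ?thesis using s True by (simp add: R_def)
    next
      case False
      then have "g s = 0" by (intro gout) auto
      then show ?thesis using False by (simp add: r_def R_def)
    qed
    ultimately show ?thesis by simp
  qed
  \<comment> \<open>Absorption: the energy with one factor of the bump is at most M/2 plus half of
    itself.\<close>
  have "polar_const CARD('n) * (\<integral>s. Q s \<partial>lborel) \<le> M / 2 + polar_const CARD('n) * (\<integral>s. R s \<partial>lborel) / 2"
    using H1_gradient_pairing_le[OF N2 H M] unfolding lhs rhs .
  moreover have "polar_const CARD('n) * (\<integral>s. R s \<partial>lborel) \<le> polar_const CARD('n) * (\<integral>s. Q s \<partial>lborel)"
    using RQ pcp by simp
  ultimately show ?thesis by (simp add: Q_def g_def)
qed


text \<open>The division by 2 in \<open>e\<close> comes from the Jacobian of s = exp (-2 t): 2 s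
  e(s) is the energy density in t. A bump of at least 1/2 on [a,b] costs a factor 2 in the gradient
  part.\<close>

lemma energy_interval:
  assumes z0: "\<And>s. s \<in> {0<..<1} \<Longrightarrow> (z0 has_real_derivative y s / B s) (at s)"
    and y: "\<And>s. s \<in> {0<..<1} \<Longrightarrow> (y has_real_derivative y1 s) (at s)" "continuous_on {0<..<1} y1"
    and ae: "AE s in lborel. s \<in> {0<..<1} \<longrightarrow> zeta s = z0 s"
    and ab: "0 < a" "a \<le> b" "b < 1"
  defines "e \<equiv> \<lambda>s. ((y s)\<^sup>2 / B s + W s * (rho s ^ CARD('n) * (z0 s)\<^sup>2)) / 2"
  shows "continuous_on {0<..<1} e" and "integral {a..b} e \<le> 2 * M / polar_const CARD('n)"
proof -
  have cy: "continuous_on {0<..<1} y"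
    by (rule DERIV_continuous_on, rule has_field_derivative_at_within, rule y)
  have cz: "continuous_on {0<..<1} z0"
    by (rule DERIV_continuous_on, rule has_field_derivative_at_within, rule z0)
  have cB: "continuous_on {0<..<1} B"
    by (rule DERIV_continuous_on, rule has_field_derivative_at_within, rule B_deriv)
  have Bne: "B s \<noteq> 0" if "s \<in> {0<..<1}" for s using B_pos[OF that] by simp
  have c1: "continuous_on {0<..<1} (\<lambda>s. (y s)\<^sup>2 / B s)"
    by (intro continuous_on_divide continuous_on_power cy cB ballI Bne)
  have c2: "continuous_on {0<..<1} (\<lambda>s. W s * (rho s ^ CARD('n) * (z0 s)\<^sup>2))"
    by (intro continuous_on_mult continuous_on_power[of _ z0] W_cont rho_continuous cz)
  show ce: "continuous_on {0<..<1} e"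
    unfolding e_def by (intro continuous_on_divide continuous_on_add c1 c2 continuous_on_const) auto
  define c d where "c = a / 2" and "d = (b + 1) / 2"
  have cd: "0 < c" "c < a" "b < d" "d < 1" "c < d" using ab by (auto simp: c_def d_def)
  have sub: "{a..b} \<subseteq> {0<..<1}" "{c..d} \<subseteq> {0<..<1}" "{a..b} \<subseteq> {c..d}" using ab cd by auto
  obtain n where n: "\<And>t. t \<in> {a..b} \<Longrightarrow> 1/2 \<le> bump c d n t" using bump_ge_half[OF cd(2,3)] by blast
  have i1: "integrable lborel (\<lambda>s. indicat_real {a..b} s * ((y s)\<^sup>2 / B s))"
    using borel_integrable_atLeastAtMost'[OF continuous_on_subset[OF c1 sub(1)]] by (simp add: set_integrable_def)
  have i2: "integrable lborel (\<lambda>s. indicat_real {a..b} s * (W s * (rho s ^ CARD('n) * (z0 s)\<^sup>2)))"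
    using borel_integrable_atLeastAtMost'[OF continuous_on_subset[OF c2 sub(1)]] by (simp add: set_integrable_def)
  have "set_integrable lborel {c..d} (\<lambda>s. (y s)\<^sup>2 / B s * bump c d n s)"
    by (rule borel_integrable_atLeastAtMost')
       (intro continuous_on_mult continuous_on_subset[OF c1 sub(2)] smooth1_continuous_on smooth1_bump)
  then have i3: "integrable lborel (\<lambda>s. indicat_real {c..d} s * ((y s)\<^sup>2 / B s * bump c d n s))"
    by (simp add: set_integrable_def)
  have "(\<integral>s. indicat_real {a..b} s * ((y s)\<^sup>2 / B s) \<partial>lborel)
      \<le> (\<integral>s. 2 * (indicat_real {c..d} s * ((y s)\<^sup>2 / B s * bump c d n s)) \<partial>lborel)"
  proof (rule integral_mono[OF i1 integrable_mult_right[OF i3]])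
    fix s
    show "indicat_real {a..b} s * ((y s)\<^sup>2 / B s) \<le> 2 * (indicat_real {c..d} s * ((y s)\<^sup>2 / B s * bump c d n s))"
    proof (cases "s \<in> {c..d}")
      case True
      then have B0: "0 \<le> (y s)\<^sup>2 / B s" using B_pos[of s] sub by auto
      show ?thesis
      proof (cases "s \<in> {a..b}")
        case ab: True
        have "(y s)\<^sup>2 / B s * (1/2) \<le> (y s)\<^sup>2 / B s * bump c d n s" using n[OF ab] B0 by (intro mult_left_mono)
        then show ?thesis using ab True by simp
      next
        case False
        define T where "T = (y s)\<^sup>2 / B s * bump c d n s"
        have "0 \<le> T" unfolding T_def by (intro mult_nonneg_nonneg B0 bump_bounds)
        then show ?thesis using True False unfolding T_def[symmetric] by simp
      qed
    next
      case False
      then have "s \<notin> {a..b}" using sub(3) by blast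
      then show ?thesis using False by simp
    qed
  qed
  also have "\<dots> = 2 * (\<integral>s. indicat_real {c..d} s * ((y s)\<^sup>2 / B s * bump c d n s) \<partial>lborel)"
    by (rule integral_mult_right_zero)
  also have "\<dots> \<le> 2 * (M / polar_const CARD('n))"
    using gradient_energy_bump[OF z0 y ae cd(1,5,4), of n] pcp by (subst mult_le_cancel_left_pos) (simp_all add: pos_le_divide_eq mult.commute)
  finally have e1: "(\<integral>s. indicat_real {a..b} s * ((y s)\<^sup>2 / B s) \<partial>lborel) \<le> 2 * (M / polar_const CARD('n))" .
  have "(\<integral>s. indicat_real {a..b} s * (W s * (rho s ^ CARD('n) * (z0 s)\<^sup>2)) \<partial>lborel)
     \<le> (\<integral>s. indicat_real {0<..<1} s * (W s * (rho s ^ CARD('n) * (zeta s)\<^sup>2)) \<partial>lborel)"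
  proof (rule integral_mono_AE[OF i2 u_sq_energy(1)])
    show "AE s in lborel. indicat_real {a..b} s * (W s * (rho s ^ CARD('n) * (z0 s)\<^sup>2))
       \<le> indicat_real {0<..<1} s * (W s * (rho s ^ CARD('n) * (zeta s)\<^sup>2))"
      using ae
    proof eventually_elim
      case (elim s)
      show ?case
      proof (cases "s \<in> {0<..<1}")
        case True
        then have "0 \<le> W s * (rho s ^ CARD('n) * (zeta s)\<^sup>2)" "zeta s = z0 s"
          using W_pos[of s] rho_pos[of s] elim by auto
        then show ?thesis using True by (auto simp: indicator_def)
      next
        case False
        then have "s \<notin> {a..b}" using sub(1) by blast
        then show ?thesis using False by simp
      qed
    qed
  qed
  also have "\<dots> \<le> M / polar_const CARD('n)" using u_sq_energy(2) pcp by (simp add: pos_le_divide_eq mult.commute)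
  finally have e2: "(\<integral>s. indicat_real {a..b} s * (W s * (rho s ^ CARD('n) * (z0 s)\<^sup>2)) \<partial>lborel) \<le> M / polar_const CARD('n)" .
  have "integral {a..b} e = (LINT s:{a..b}|lborel. e s)"
    by (rule set_borel_integral_eq_integral(2)[symmetric])
       (rule borel_integrable_atLeastAtMost'[OF continuous_on_subset[OF ce sub(1)]])
  also have "\<dots> = (\<integral>s. (indicat_real {a..b} s * ((y s)\<^sup>2 / B s) + indicat_real {a..b} s * (W s * (rho s ^ CARD('n) * (z0 s)\<^sup>2))) / 2 \<partial>lborel)"
    unfolding set_lebesgue_integral_def by (rule Bochner_Integration.integral_cong) (auto simp: e_def indicator_def)
  also have "\<dots> = ((\<integral>s. indicat_real {a..b} s * ((y s)\<^sup>2 / B s) \<partial>lborel)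
     + (\<integral>s. indicat_real {a..b} s * (W s * (rho s ^ CARD('n) * (z0 s)\<^sup>2)) \<partial>lborel)) / 2"
    unfolding integral_divide_zero Bochner_Integration.integral_add[OF i1 i2] ..
  also have "\<dots> \<le> (2 * (M / polar_const CARD('n)) + M / polar_const CARD('n)) / 2" using e1 e2 by simp
  also have "\<dots> \<le> 2 * M / polar_const CARD('n)" using M(1) pcp by (simp add: field_simps)
  finally show "integral {a..b} e \<le> 2 * M / polar_const CARD('n)" .
qed

section \<open>The change of variable s = exp (-2 t)\<close>

lemma rho_exp:
  assumes t: "0 < t"
  shows "rho (exp (- (2 * t))) = exp t / sinh t"
proof -
  have s: "0 < sinh t" using t by simp
  have e: "exp (- (2 * t)) < 1" using t by simp
  have "exp t * (1 - exp (- (2 * t))) = 2 * sinh t"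
  proof -
    have "exp (- t) = exp t * exp (- (2 * t))" by (simp flip: exp_add)
    then show ?thesis by (simp add: sinh_def algebra_simps)
  qed
  then show ?thesis using s e by (simp add: rho_def field_simps)
qed

lemma rho_exp_power:
  assumes t: "0 < t"
  shows "rho (exp (- (2 * t))) ^ k = exp (real k * t) * sinh t powr (- real k)"
proof -
  have "0 < sinh t" using t by simp
  then show ?thesis unfolding rho_exp[OF t]
    by (simp add: power_divide exp_of_nat_mult powr_minus powr_realpow del: sinh_real_pos_iff)
       (simp add: divide_inverse)
qed

text \<open>Conformal equivalence with the half cylinder: all exponentials cancel except the
  Jacobian factor \<open>s\<close>, and pure powers of sinh remain.\<close>

lemma weights_exp:
  assumes t: "0 < t"
  defines "s \<equiv> exp (- (2 * t))"
  shows "B s = 4 * s * sinh t powr (- (2 * (real CARD('n) / 2 - 1)))"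
    and "s * (W s * rho s ^ CARD('n)) = sinh t powr (- (2 * (real CARD('n) / 2 - 1)) - 2)"
proof -
  have s: "s \<in> {0<..<1}" using t by (simp add: s_def)
  have sp: "s powr x = exp (- (2 * t * x))" for x by (simp add: s_def powr_def)
  have n: "real (CARD('n) - 2) = real CARD('n) - 2" using N by simp
  have "s powr (real CARD('n) / 2) * rho s ^ (CARD('n) - 2)
     = exp (- (2 * t * (real CARD('n) / 2))) * exp ((real CARD('n) - 2) * t) * sinh t powr (- (real CARD('n) - 2))"
    unfolding sp unfolding s_def rho_exp_power[OF t] n by simp
  also have "exp (- (2 * t * (real CARD('n) / 2))) * exp ((real CARD('n) - 2) * t) = s"
    unfolding exp_add[symmetric] s_def by (simp add: algebra_simps)
  finally show "B s = 4 * s * sinh t powr (- (2 * (real CARD('n) / 2 - 1)))" by (simp add: B_def)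
  have "s * (W s * rho s ^ CARD('n)) = s powr (real CARD('n) / 2) * rho s ^ CARD('n)"
    using sW[OF s] by simp
  also have "\<dots> = exp (- (2 * t * (real CARD('n) / 2))) * exp (real CARD('n) * t) * sinh t powr (- real CARD('n))"
    unfolding sp unfolding s_def rho_exp_power[OF t] by simp
  also have "exp (- (2 * t * (real CARD('n) / 2))) * exp (real CARD('n) * t) = 1"
    unfolding exp_add[symmetric] by simp
  finally show "s * (W s * rho s ^ CARD('n)) = sinh t powr (- (2 * (real CARD('n) / 2 - 1)) - 2)" by simp
qed

lemma radial_solution_profile:
  assumes lam: "real CARD('n) * (real CARD('n) - 2) / 4 < lam"
    and p_le: "p \<le> 2 * real CARD('n) / (real CARD('n) - 2)"
  obtains z0 z1 Ez where
    "radial_solution (real CARD('n) / 2 - 1) lam (2 * M / polar_const CARD('n)) p (\<lambda>t. z0 (exp (- (2 * t)))) z1 Ez"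
    "AE s in lborel. s \<in> {0<..<1} \<longrightarrow> zeta s = z0 s"
proof -
  obtain z0 y where
    z0: "\<And>s. s \<in> {0<..<1} \<Longrightarrow> (z0 has_real_derivative y s / B s) (at s)" and
    y: "\<And>s. s \<in> {0<..<1} \<Longrightarrow> (y has_real_derivative - ((lam * z0 s + \<bar>z0 s\<bar> powr (p - 2) * z0 s) * (W s * rho s ^ CARD('n)))) (at s)" and
    ae: "AE s in lborel. s \<in> {0<..<1} \<longrightarrow> zeta s = z0 s"
    using profile_regular by blast
  define y1 where "y1 s = - ((lam * z0 s + \<bar>z0 s\<bar> powr (p - 2) * z0 s) * (W s * rho s ^ CARD('n)))" for s
  have yd: "(y has_real_derivative y1 s) (at s)" if "s \<in> {0<..<1}" for s using y[OF that] by (simp add: y1_def)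
  have cz: "continuous_on {0<..<1} z0"
    by (rule DERIV_continuous_on, rule has_field_derivative_at_within, rule z0)
  have y1c: "continuous_on {0<..<1} y1"
    unfolding y1_def[abs_def]
    by (intro continuous_on_minus continuous_on_mult continuous_on_add continuous_on_const cz W_cont rho_continuous abs_powr_mult_continuous)
       (use p in simp)
  define e where "e s = ((y s)\<^sup>2 / B s + W s * (rho s ^ CARD('n) * (z0 s)\<^sup>2)) / 2" for s
  note en = energy_interval[OF z0 yd y1c ae, folded e_def]
  have ce: "continuous_on {0<..<1} e"
    using energy_interval(1)[OF z0 yd y1c ae, of "1/2" "1/2"] by (simp add: e_def[abs_def])
  define m where "m = real CARD('n) / 2 - 1"
  define S where "S t = exp (- (2 * t))" for t :: real
  have S: "S t \<in> {0<..<1}" if "0 < t" for t using that by (simp add: S_def)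
  have Sd: "(S has_real_derivative - 2 * S t) (at t)" for t
    unfolding S_def[abs_def] by (auto intro!: derivative_eq_intros)
  define z1 where "z1 t = y (S t) / B (S t) * (- 2 * S t)" for t
  \<comment> \<open>The minus sign makes \<open>Ez\<close> nondecreasing, since \<open>S\<close>
    decreases in t.\<close>
  define Ez where "Ez t = - prim e (S t)" for t
  have w1: "B (S t) = 4 * S t * sinh t powr (- (2 * m))" and w2: "S t * (W (S t) * rho (S t) ^ CARD('n)) = sinh t powr (- (2 * m) - 2)"
    if "0 < t" for t
    using weights_exp[OF that] by (simp_all add: S_def m_def)
  \<comment> \<open>In the variable t the weighted derivative is a multiple of the flux
    \<open>y\<close>, whose differentiability is already known.\<close>
  have sz1: "sinh t powr (- (2 * m)) * z1 t = - (y (S t) / 2)" if t: "0 < t" for t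
  proof -
    have "sinh t powr (- (2 * m)) = B (S t) / (4 * S t)" using w1[OF t] S[OF t] by simp
    then show ?thesis using S[OF t] B_pos[OF S[OF t]] by (simp add: z1_def)
  qed
  have "radial_solution m lam (2 * M / polar_const CARD('n)) p (\<lambda>t. z0 (S t)) z1 Ez"
  proof
    show "5/2 \<le> m" using N by (simp add: m_def)
    have "m * (m + 1) = real CARD('n) * (real CARD('n) - 2) / 4" by (simp add: m_def field_simps)
    then show "m * (m + 1) < lam" using lam by simp
    show "2 < p" by (rule p)
    have "p * (real CARD('n) - 2) \<le> 2 * real CARD('n)" using p_le N by (simp add: field_simps)
    then show "p * m \<le> 2 * m + 2" by (simp add: m_def field_simps)
  next
    fix t :: real assume t: "0 < t"
    show "((\<lambda>t. z0 (S t)) has_real_derivative z1 t) (at t)"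
      unfolding z1_def by (rule DERIV_chain2[OF z0[OF S[OF t]] Sd])
    have "((\<lambda>t. - (y (S t) / 2)) has_real_derivative - (y1 (S t) * (- 2 * S t) / 2)) (at t)"
      by (intro DERIV_minus DERIV_cdivide DERIV_chain2[OF yd[OF S[OF t]] Sd])
    moreover have "- (y1 (S t) * (- 2 * S t) / 2) = - (sinh t powr (- (2 * m) - 2) * (lam * z0 (S t) + \<bar>z0 (S t)\<bar> powr (p - 2) * z0 (S t)))"
      unfolding w2[OF t, symmetric] by (simp add: y1_def algebra_simps)
    ultimately have "((\<lambda>t. - (y (S t) / 2)) has_real_derivative - (sinh t powr (- (2 * m) - 2) * (lam * z0 (S t) + \<bar>z0 (S t)\<bar> powr (p - 2) * z0 (S t)))) (at t)"
      by simp
    then show "((\<lambda>t. sinh t powr (- (2 * m)) * z1 t) has_real_derivative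
        - (sinh t powr (- (2 * m) - 2) * (lam * z0 (S t) + \<bar>z0 (S t)\<bar> powr (p - 2) * z0 (S t)))) (at t)"
      by (rule has_field_derivative_transform_within_open[of _ _ _ "{0<..}"]) (use t sz1 in auto)
    have "(Ez has_real_derivative - (e (S t) * (- 2 * S t))) (at t)"
      unfolding Ez_def[abs_def] by (intro DERIV_minus DERIV_chain2[OF prim_has_derivative[OF ce S[OF t]] Sd])
    moreover have "- (e (S t) * (- 2 * S t)) = sinh t powr (- (2 * m)) * (z1 t)\<^sup>2 + sinh t powr (- (2 * m) - 2) * (z0 (S t))\<^sup>2"
    proof -
      have "sinh t powr (- (2 * m)) * (z1 t)\<^sup>2 = (sinh t powr (- (2 * m)) * z1 t) * z1 t" by (simp add: power2_eq_square)
      also have "\<dots> = S t * ((y (S t))\<^sup>2 / B (S t))" unfolding sz1[OF t] by (simp add: z1_def power2_eq_square)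
      finally have a: "sinh t powr (- (2 * m)) * (z1 t)\<^sup>2 = S t * ((y (S t))\<^sup>2 / B (S t))" .
      have "- (e (S t) * (- 2 * S t)) = S t * ((y (S t))\<^sup>2 / B (S t) + W (S t) * (rho (S t) ^ CARD('n) * (z0 (S t))\<^sup>2))"
        by (simp add: e_def)
      then show ?thesis unfolding a w2[OF t, symmetric] by (simp add: distrib_left mult.assoc)
    qed
    ultimately show "(Ez has_real_derivative sinh t powr (- (2 * m)) * (z1 t)\<^sup>2 + sinh t powr (- (2 * m) - 2) * (z0 (S t))\<^sup>2) (at t)"
      by simp
  next
    fix r t :: real assume rt: "0 < r" "r \<le> t"
    have "S t \<le> S r" using rt by (simp add: S_def)
    moreover have "0 < S t" "S r < 1" using S[of t] S[of r] rt by auto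
    ultimately show "Ez t - Ez r \<le> 2 * M / polar_const CARD('n)"
      using prim_diff[OF loc_int_continuous[OF ce], of "S t" "S r"]
        energy_interval(2)[OF z0 yd y1c ae, of "S t" "S r"] by (simp add: Ez_def e_def[abs_def])
  qed
  then show ?thesis using that ae by (simp add: S_def m_def)
qed

end

text \<open>Elements of H^1 are determined only up to null sets, so the pointwise bound is read
  almost everywhere; the proof bounds the continuous representative at every x other than 0.\<close>

theorem theorem3p2:
  fixes A :: "(real^'n \<Rightarrow> real) set" and lam :: real
  assumes dim: "CARD('n) \<ge> 7"
    and lam_lo: "real CARD('n) * (real CARD('n) - 2) / 4 < lam"
    and lam_hi: "lam < ((real CARD('n) - 1) / 2)\<^sup>2"
    and radialA: "\<forall>u\<in>A. radial u"
    and bounded_sol: "\<exists>M::real. \<forall>u\<in>A. \<exists>G. H1 u G \<and> H1_normsq u G \<le> ennreal M \<and>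
        (\<exists>p. 2 < p \<and> p \<le> 2 * real CARD('n) / (real CARD('n) - 2) \<and> weak_sol lam p u G)"
  shows "\<exists>C::real. \<forall>u\<in>A. AE x in lborel. x \<in> ball 0 1 \<longrightarrow>
           \<bar>u x\<bar> \<le> C * (1 - (norm x)\<^sup>2) powr ((real CARD('n) - 1) / 2)"
proof -
  obtain M0 :: real where M0: "\<And>u. u \<in> A \<Longrightarrow> \<exists>G. H1 u G \<and> H1_normsq u G \<le> ennreal M0 \<and>
        (\<exists>p. 2 < p \<and> p \<le> 2 * real CARD('n) / (real CARD('n) - 2) \<and> weak_sol lam p u G)"
    using bounded_sol by blast
  \<comment> \<open>\<open>ennreal\<close> sends negative reals to 0, so the energy bound may be
    taken nonnegative.\<close>
  define M where "M = max 0 M0"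
  define m where "m = real CARD('n) / 2 - 1"
  have pcp: "0 < polar_const CARD('n)" using dim by (intro polar_const_pos) simp
  have m: "5/2 \<le> m" using dim by (simp add: m_def)
  have "m * (m + 1) = real CARD('n) * (real CARD('n) - 2) / 4" by (simp add: m_def field_simps)
  then have lm: "m * (m + 1) < lam" using lam_lo by simp
  have "0 \<le> 2 * M / polar_const CARD('n)" using pcp by (simp add: M_def)
  \<comment> \<open>The constant is fixed here, before any \<open>u\<close> or its exponent
    \<open>p\<close> is chosen.\<close>
  then obtain C where C: "\<And>p z z1 Ez t. radial_solution m lam (2 * M / polar_const CARD('n)) p z z1 Ez \<Longrightarrow> 0 < t \<Longrightarrow>
    \<bar>z t\<bar> \<le> C * (1 - exp (- (2 * t))) powr (m + 1/2)"
    using radial_solution_uniform_bound[OF m lm] by blast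
  show ?thesis
  proof (intro exI[of _ C] ballI)
    fix u assume u: "u \<in> A"
    obtain G p where G: "H1 u G" "H1_normsq u G \<le> ennreal M0" and pp: "2 < p"
      "p \<le> 2 * real CARD('n) / (real CARD('n) - 2)" "weak_sol lam p u G" using M0[OF u] by blast
    have "H1_normsq u G \<le> ennreal M" using G(2) by (rule order_trans) (auto intro!: ennreal_leI simp: M_def)
    then interpret radial_weak_solution u G lam p M
      using dim radialA u G pp by unfold_locales (auto simp: M_def)
    obtain z0 z1 Ez where rs: "radial_solution (real CARD('n) / 2 - 1) lam (2 * M / polar_const CARD('n)) p (\<lambda>t. z0 (exp (- (2 * t)))) z1 Ez"
      and ae: "AE s in lborel. s \<in> {0<..<1} \<longrightarrow> zeta s = z0 s"
      using radial_solution_profile[OF lam_lo pp(2)] by blast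
    have bd: "\<bar>z0 s\<bar> \<le> C * (1 - s) powr ((real CARD('n) - 1) / 2)" if s: "s \<in> {0<..<1}" for s
    proof -
      define t where "t = - ln s / 2"
      have t: "0 < t" "exp (- (2 * t)) = s" using s by (auto simp: t_def)
      have "m + 1/2 = (real CARD('n) - 1) / 2" by (simp add: m_def field_simps)
      then show ?thesis using C[OF rs[folded m_def] t(1)] unfolding t(2) by metis
    qed
    have "AE s in lborel. s \<in> {0<..<1} \<longrightarrow> \<bar>zeta s\<bar> \<le> C * (1 - s) powr ((real CARD('n) - 1) / 2)"
      using ae by eventually_elim (use bd in auto)
    from AE_radial[OF N5 this]
    have "AE x::real^'n in lborel. x \<in> ball 0 1 \<longrightarrow> x \<noteq> 0 \<longrightarrow>
        \<bar>zeta ((norm x)\<^sup>2)\<bar> \<le> C * (1 - (norm x)\<^sup>2) powr ((real CARD('n) - 1) / 2)" .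
    moreover have "AE x::real^'n in lborel. x \<noteq> 0" by (rule AE_lborel_singleton)
    ultimately show "AE x in lborel. x \<in> ball 0 1 \<longrightarrow>
           \<bar>u x\<bar> \<le> C * (1 - (norm x)\<^sup>2) powr ((real CARD('n) - 1) / 2)"
      by eventually_elim (use u_eq in auto)
  qed
qed

end
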